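(* The theory of the variety $\mathcal V_6$ has a model completion, which is axiomatized (together with the axioms of $\mathcal V_6$) by the density axiom D6 and the splitting axiom S6.
   Context: A co-Heyting algebra is a bounded distributive lattice $(L,\mathbf{0},\mathbf{1},\vee,\wedge)$ with a binary operation $-$ such that $a-b$ is the least $c\in L$ with $a\le b\vee c$, viewed as a structure in the language $\{\mathbf 0,\mathbf 1,\vee,\wedge,-\}$. For $a,b\in L$ write $b\ll a$ iff $a-b=a$ and $b\le a$. $\mathcal V_6$ is the variety of co-Heyting algebras satisfying $(x-y)\wedge(y-x)=\mathbf 0$ (the variety generated by chains). Model completion is in the usual model-theoretic sense. Axiom D6: for all $a,c$ with $c\ll a$ and $a\neq\mathbf 0$ there is $b\neq\mathbf 0$ with $c\ll b\ll a$. Axiom S6: for all $a,b_1,b_2$ with $b_1\vee b_2\ll a\ne\mathbf 0$ and $b_1\wedge b_2=\mathbf 0$ there are non-zero $a_1,a_2$ with $a-a_2=a_1\ge b_1$, $a-a_1=a_2\ge b_2$, and $a_1\wedge a_2=b_1\wedge b_2$. *)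

theory Defs
  imports Main
begin

section \<open>First-order logic over the language of co-Heyting algebras\<close>

datatype tm =
    Var nat  ("\<^bold>x _" [100] 100)
  | Zero  ("\<^bold>0")
  | One  ("\<^bold>1")
  | Join tm tm  (infixl "\<^bold>\<squnion>" 65)
  | Meet tm tm  (infixl "\<^bold>\<sqinter>" 70)
  | Diff tm tm  (infixl "\<^bold>-" 75)

text \<open>Variables are named by natural numbers, and a quantifier carries the name it binds.\<close>

datatype fm =
    Eq tm tm  (infix "\<^bold>=" 50)
  | Neg fm  ("\<^bold>\<not> _" [40] 40)
  | Conj fm fm  (infixr "\<^bold>\<and>" 35)
  | All nat fm  ("(\<^bold>\<forall>_./ _)" [0, 10] 10)

abbreviation Imp :: "fm \<Rightarrow> fm \<Rightarrow> fm"  (infixr "\<^bold>\<longrightarrow>" 25)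
  where "p \<^bold>\<longrightarrow> q \<equiv> \<^bold>\<not> (p \<^bold>\<and> \<^bold>\<not> q)"

abbreviation Ex :: "nat \<Rightarrow> fm \<Rightarrow> fm"  ("(\<^bold>\<exists>_./ _)" [0, 10] 10)
  where "\<^bold>\<exists>n. p \<equiv> \<^bold>\<not> (\<^bold>\<forall>n. \<^bold>\<not> p)"

record 'a struct =
  carrier :: "'a set"
  zero_of :: 'a
  one_of :: 'a
  join_of :: "'a \<Rightarrow> 'a \<Rightarrow> 'a"
  meet_of :: "'a \<Rightarrow> 'a \<Rightarrow> 'a"
  diff_of :: "'a \<Rightarrow> 'a \<Rightarrow> 'a"

definition is_struct :: "'a struct \<Rightarrow> bool" where
  "is_struct A \<longleftrightarrow>
     zero_of A \<in> carrier A \<and> one_of A \<in> carrier A \<and>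
     (\<forall>x\<in>carrier A. \<forall>y\<in>carrier A.
        join_of A x y \<in> carrier A \<and> meet_of A x y \<in> carrier A \<and> diff_of A x y \<in> carrier A)"

primrec tval :: "'a struct \<Rightarrow> (nat \<Rightarrow> 'a) \<Rightarrow> tm \<Rightarrow> 'a" where
  "tval A v (Var n) = v n"
| "tval A v Zero = zero_of A"
| "tval A v One = one_of A"
| "tval A v (Join s t) = join_of A (tval A v s) (tval A v t)"
| "tval A v (Meet s t) = meet_of A (tval A v s) (tval A v t)"
| "tval A v (Diff s t) = diff_of A (tval A v s) (tval A v t)"

primrec sat :: "'a struct \<Rightarrow> (nat \<Rightarrow> 'a) \<Rightarrow> fm \<Rightarrow> bool" where
  "sat A v (Eq s t) \<longleftrightarrow> tval A v s = tval A v t"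
| "sat A v (Neg p) \<longleftrightarrow> \<not> sat A v p"
| "sat A v (Conj p q) \<longleftrightarrow> sat A v p \<and> sat A v q"
| "sat A v (All n p) \<longleftrightarrow> (\<forall>x\<in>carrier A. sat A (v(n := x)) p)"

text \<open>Formulas with free variables, if any, are read as their universal closures.\<close>

definition is_model :: "'a struct \<Rightarrow> fm set \<Rightarrow> bool" where
  "is_model A T \<longleftrightarrow>
     is_struct A \<and> (\<forall>p\<in>T. \<forall>v. range v \<subseteq> carrier A \<longrightarrow> sat A v p)"

definition embedding :: "('a \<Rightarrow> 'b) \<Rightarrow> 'a struct \<Rightarrow> 'b struct \<Rightarrow> bool" where
  "embedding f A B \<longleftrightarrow>
     f ` carrier A \<subseteq> carrier B \<and> inj_on f (carrier A) \<and>
     f (zero_of A) = zero_of B \<and> f (one_of A) = one_of B \<and>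
     (\<forall>x\<in>carrier A. \<forall>y\<in>carrier A.
        f (join_of A x y) = join_of B (f x) (f y) \<and>
        f (meet_of A x y) = meet_of B (f x) (f y) \<and>
        f (diff_of A x y) = diff_of B (f x) (f y))"

text \<open>
  \<open>T'\<close> is a model completion of \<open>T\<close>: every model of \<open>T'\<close> is a model of \<open>T\<close>, every model of
  \<open>T\<close> embeds into a model of \<open>T'\<close>, and for every model \<open>M\<close> of \<open>T\<close> the theory
  \<open>T' \<union> Diag(M)\<close> is complete. A model of \<open>T' \<union> Diag(M)\<close> is a model of \<open>T'\<close> together with an
  embedding of \<open>M\<close>, and a sentence with constants from \<open>M\<close> is a formula \<open>p\<close> together with a
  valuation \<open>v\<close> in \<open>M\<close>.

  HOL cannot quantify over types inside a formula, so the types of the elements of the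
  structures are parameters, and the notion is meant to be asserted for all types
  \<open>'a\<close>, \<open>'b\<close>, \<open>'c\<close>. The model that the second clause asks for may have any cardinality. As the
  language is countable, by the downward Loewenheim-Skolem theorem one can be found with at most
  \<open>max |M| \<aleph>\<^sub>0\<close> elements, hence with carrier a subset of the type \<open>'a + nat\<close>.
\<close>

definition model_completion ::
    "'a itself \<Rightarrow> 'b itself \<Rightarrow> 'c itself \<Rightarrow> fm set \<Rightarrow> fm set \<Rightarrow> bool" where
  "model_completion _ _ _ T T' \<longleftrightarrow>
     (\<forall>N :: 'a struct. is_model N T' \<longrightarrow> is_model N T) \<and>
     (\<forall>M :: 'a struct. is_model M T \<longrightarrow>
        (\<exists>(N :: ('a + nat) struct) f. is_model N T' \<and> embedding f M N)) \<and>
     (\<forall>(M :: 'a struct) (N\<^sub>1 :: 'b struct) (N\<^sub>2 :: 'c struct) f\<^sub>1 f\<^sub>2.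
        is_model M T \<and> is_model N\<^sub>1 T' \<and> is_model N\<^sub>2 T' \<and>
        embedding f\<^sub>1 M N\<^sub>1 \<and> embedding f\<^sub>2 M N\<^sub>2 \<longrightarrow>
        (\<forall>p v. range v \<subseteq> carrier M \<longrightarrow> sat N\<^sub>1 (f\<^sub>1 \<circ> v) p = sat N\<^sub>2 (f\<^sub>2 \<circ> v) p))"


section \<open>The axioms\<close>

abbreviation Le :: "tm \<Rightarrow> tm \<Rightarrow> fm"  (infix "\<^bold>\<le>" 50)
  where "s \<^bold>\<le> t \<equiv> s \<^bold>\<squnion> t \<^bold>= t"

abbreviation Below :: "tm \<Rightarrow> tm \<Rightarrow> fm"  (infix "\<^bold>\<lless>" 50)
  where "t \<^bold>\<lless> s \<equiv> (s \<^bold>- t \<^bold>= s) \<^bold>\<and> (t \<^bold>\<le> s)"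

definition bounded_distrib_lattice_axioms :: "fm set" where
  "bounded_distrib_lattice_axioms =
    {\<^bold>\<forall>0. \<^bold>\<forall>1. \<^bold>\<forall>2. (\<^bold>x 0 \<^bold>\<squnion> \<^bold>x 1) \<^bold>\<squnion> \<^bold>x 2 \<^bold>= \<^bold>x 0 \<^bold>\<squnion> (\<^bold>x 1 \<^bold>\<squnion> \<^bold>x 2),
     \<^bold>\<forall>0. \<^bold>\<forall>1. \<^bold>\<forall>2. (\<^bold>x 0 \<^bold>\<sqinter> \<^bold>x 1) \<^bold>\<sqinter> \<^bold>x 2 \<^bold>= \<^bold>x 0 \<^bold>\<sqinter> (\<^bold>x 1 \<^bold>\<sqinter> \<^bold>x 2),
     \<^bold>\<forall>0. \<^bold>\<forall>1. \<^bold>x 0 \<^bold>\<squnion> \<^bold>x 1 \<^bold>= \<^bold>x 1 \<^bold>\<squnion> \<^bold>x 0,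
     \<^bold>\<forall>0. \<^bold>\<forall>1. \<^bold>x 0 \<^bold>\<sqinter> \<^bold>x 1 \<^bold>= \<^bold>x 1 \<^bold>\<sqinter> \<^bold>x 0,
     \<^bold>\<forall>0. \<^bold>\<forall>1. \<^bold>x 0 \<^bold>\<squnion> (\<^bold>x 0 \<^bold>\<sqinter> \<^bold>x 1) \<^bold>= \<^bold>x 0,
     \<^bold>\<forall>0. \<^bold>\<forall>1. \<^bold>x 0 \<^bold>\<sqinter> (\<^bold>x 0 \<^bold>\<squnion> \<^bold>x 1) \<^bold>= \<^bold>x 0,
     \<^bold>\<forall>0. \<^bold>\<forall>1. \<^bold>\<forall>2. \<^bold>x 0 \<^bold>\<sqinter> (\<^bold>x 1 \<^bold>\<squnion> \<^bold>x 2) \<^bold>= (\<^bold>x 0 \<^bold>\<sqinter> \<^bold>x 1) \<^bold>\<squnion> (\<^bold>x 0 \<^bold>\<sqinter> \<^bold>x 2),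
     \<^bold>\<forall>0. \<^bold>0 \<^bold>\<le> \<^bold>x 0,
     \<^bold>\<forall>0. \<^bold>x 0 \<^bold>\<le> \<^bold>1}"

definition co_heyting_axioms :: "fm set" where
  "co_heyting_axioms = bounded_distrib_lattice_axioms \<union>
    {\<^bold>\<forall>0. \<^bold>\<forall>1. \<^bold>x 0 \<^bold>\<le> \<^bold>x 1 \<^bold>\<squnion> (\<^bold>x 0 \<^bold>- \<^bold>x 1),
     \<^bold>\<forall>0. \<^bold>\<forall>1. \<^bold>\<forall>2. (\<^bold>x 0 \<^bold>\<le> \<^bold>x 1 \<^bold>\<squnion> \<^bold>x 2) \<^bold>\<longrightarrow> (\<^bold>x 0 \<^bold>- \<^bold>x 1 \<^bold>\<le> \<^bold>x 2)}"

definition V6 :: "fm set" where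
  "V6 = co_heyting_axioms \<union>
    {\<^bold>\<forall>0. \<^bold>\<forall>1. (\<^bold>x 0 \<^bold>- \<^bold>x 1) \<^bold>\<sqinter> (\<^bold>x 1 \<^bold>- \<^bold>x 0) \<^bold>= \<^bold>0}"

text \<open>In \<open>D6\<close> the variables \<open>0, 1, 2\<close> stand for \<open>a, c, b\<close>.\<close>

definition D6 :: fm where
  "D6 = (\<^bold>\<forall>0. \<^bold>\<forall>1. (\<^bold>x 1 \<^bold>\<lless> \<^bold>x 0) \<^bold>\<and> \<^bold>\<not> (\<^bold>x 0 \<^bold>= \<^bold>0) \<^bold>\<longrightarrow>
           (\<^bold>\<exists>2. \<^bold>\<not> (\<^bold>x 2 \<^bold>= \<^bold>0) \<^bold>\<and> (\<^bold>x 1 \<^bold>\<lless> \<^bold>x 2) \<^bold>\<and> (\<^bold>x 2 \<^bold>\<lless> \<^bold>x 0)))"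

text \<open>In \<open>S6\<close> the variables \<open>0, 1, 2, 3, 4\<close> stand for \<open>a, b\<^sub>1, b\<^sub>2, a\<^sub>1, a\<^sub>2\<close>.\<close>

definition S6 :: fm where
  "S6 = (\<^bold>\<forall>0. \<^bold>\<forall>1. \<^bold>\<forall>2.
           (\<^bold>x 1 \<^bold>\<squnion> \<^bold>x 2 \<^bold>\<lless> \<^bold>x 0) \<^bold>\<and> \<^bold>\<not> (\<^bold>x 0 \<^bold>= \<^bold>0) \<^bold>\<and> (\<^bold>x 1 \<^bold>\<sqinter> \<^bold>x 2 \<^bold>= \<^bold>0) \<^bold>\<longrightarrow>
           (\<^bold>\<exists>3. \<^bold>\<exists>4. \<^bold>\<not> (\<^bold>x 3 \<^bold>= \<^bold>0) \<^bold>\<and> \<^bold>\<not> (\<^bold>x 4 \<^bold>= \<^bold>0) \<^bold>\<and>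
              (\<^bold>x 0 \<^bold>- \<^bold>x 4 \<^bold>= \<^bold>x 3) \<^bold>\<and> (\<^bold>x 1 \<^bold>\<le> \<^bold>x 3) \<^bold>\<and>
              (\<^bold>x 0 \<^bold>- \<^bold>x 3 \<^bold>= \<^bold>x 4) \<^bold>\<and> (\<^bold>x 2 \<^bold>\<le> \<^bold>x 4) \<^bold>\<and>
              (\<^bold>x 3 \<^bold>\<sqinter> \<^bold>x 4 \<^bold>= \<^bold>x 1 \<^bold>\<sqinter> \<^bold>x 2)))"


section \<open>The axioms read in a structure\<close>

definition le_in :: "'a struct \<Rightarrow> 'a \<Rightarrow> 'a \<Rightarrow> bool" where
  "le_in A x y \<longleftrightarrow> join_of A x y = y"

definition below_in :: "'a struct \<Rightarrow> 'a \<Rightarrow> 'a \<Rightarrow> bool" where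
  "below_in A b a \<longleftrightarrow> diff_of A a b = a \<and> le_in A b a"

lemma sat_Imp: "sat A v (p \<^bold>\<longrightarrow> q) \<longleftrightarrow> (sat A v p \<longrightarrow> sat A v q)"
  by simp

lemma sat_Ex: "sat A v (\<^bold>\<exists>n. p) \<longleftrightarrow> (\<exists>x\<in>carrier A. sat A (v(n := x)) p)"
  by simp

lemma sat_D6_iff:
  "sat A v D6 \<longleftrightarrow>
     (\<forall>a\<in>carrier A. \<forall>c\<in>carrier A. below_in A c a \<and> a \<noteq> zero_of A \<longrightarrow>
        (\<exists>b\<in>carrier A. b \<noteq> zero_of A \<and> below_in A c b \<and> below_in A b a))"
  unfolding D6_def sat_Imp sat_Ex sat.simps(4)
  by (simp add: le_in_def below_in_def cong: conj_cong)

lemma sat_S6_iff: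
  "sat A v S6 \<longleftrightarrow>
     (\<forall>a\<in>carrier A. \<forall>b\<^sub>1\<in>carrier A. \<forall>b\<^sub>2\<in>carrier A.
        below_in A (join_of A b\<^sub>1 b\<^sub>2) a \<and> a \<noteq> zero_of A \<and> meet_of A b\<^sub>1 b\<^sub>2 = zero_of A \<longrightarrow>
        (\<exists>a\<^sub>1\<in>carrier A. \<exists>a\<^sub>2\<in>carrier A. a\<^sub>1 \<noteq> zero_of A \<and> a\<^sub>2 \<noteq> zero_of A \<and>
           diff_of A a a\<^sub>2 = a\<^sub>1 \<and> le_in A b\<^sub>1 a\<^sub>1 \<and>
           diff_of A a a\<^sub>1 = a\<^sub>2 \<and> le_in A b\<^sub>2 a\<^sub>2 \<and>
           meet_of A a\<^sub>1 a\<^sub>2 = meet_of A b\<^sub>1 b\<^sub>2))"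
  unfolding S6_def sat_Imp sat_Ex sat.simps(4)
  by (simp add: le_in_def below_in_def cong: conj_cong)

lemma is_model_V6_iff:
  "is_model A V6 \<longleftrightarrow> is_struct A \<and>
     (\<forall>x\<in>carrier A. \<forall>y\<in>carrier A. \<forall>z\<in>carrier A.
        join_of A (join_of A x y) z = join_of A x (join_of A y z) \<and>
        meet_of A (meet_of A x y) z = meet_of A x (meet_of A y z) \<and>
        join_of A x y = join_of A y x \<and>
        meet_of A x y = meet_of A y x \<and>
        join_of A x (meet_of A x y) = x \<and>
        meet_of A x (join_of A x y) = x \<and>
        meet_of A x (join_of A y z) = join_of A (meet_of A x y) (meet_of A x z) \<and>
        le_in A (zero_of A) x \<and> le_in A x (one_of A) \<and>
        le_in A x (join_of A y (diff_of A x y)) \<and>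
        (le_in A x (join_of A y z) \<longrightarrow> le_in A (diff_of A x y) z) \<and>
        meet_of A (diff_of A x y) (diff_of A y x) = zero_of A)"
proof (cases "is_struct A")
  case True
  then obtain e where e: "e \<in> carrier A"
    by (auto simp: is_struct_def)
  then have "range (\<lambda>_ :: nat. e) \<subseteq> carrier A"
    by auto
  then have v: "\<exists>v :: nat \<Rightarrow> 'a. range v \<subseteq> carrier A"
    by blast
  have ne: "\<exists>x. x \<in> carrier A"
    using e by blast
  show ?thesis
    unfolding is_model_def V6_def co_heyting_axioms_def bounded_distrib_lattice_axioms_def le_in_def
    by (simp add: True ne v ball_conj_distrib ball_Un) (auto simp only:)
next
  case False
  then show ?thesis
    by (simp add: is_model_def)
qed

end

(*
  Modulo a prime ideal an algebra of the variety is a chain, so it embeds into a product of chains,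
  on which x - y is 0 where x <= y and is x elsewhere; every identity needed is checked in a chain.

  Embedding into a model of D6 and S6: after enlarging the chains to dense ones, D6 holds in the
  product, but S6 may fail because b1 can be nonzero on the whole support of a. Passing to a quotient
  chain, in which all values up to a cut t become 0, makes b1 vanish while a survives. Elements of the
  constructed algebra are therefore functions that may depend on finitely many cuts t 0, ..., t (n - 1)
  and are cut off at the remaining ones; the additional coordinate t n is what S6 splits along. A
  Skolem hull bounds the cardinality.

  Completeness over a diagram: a finite subalgebra consists of the joins of nodes of a finite forest
  (its join irreducible elements), where the children of a node are disjoint and their join is far
  below the node. If one side of an isomorphism of such forests is refined by a new element, then
  only two operations are needed, splitting a node and inserting a node above some of the children of
  another one. S6 and D6 say that these can be copied on the other side. This is a back-and-forth
  system.
*)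
theory Submission
  imports Defs Complex_Main
begin

section \<open>A dense linear order extending inclusion\<close>

text \<open>The quotients modulo different prime ideals are different chains, while a statement
  about all of them at once needs values in one type. Representing a class by the set of elements
  strictly below it turns each quotient order into inclusion. A single linear order on sets that
  extends inclusion therefore contains all the quotients, and a rational second coordinate supplies
  intermediate values. A single cut would not be enough for S6: elements that depend on it freely
  are no longer cut off there, so the obstacle can return for them. Hence there is a whole sequence
  of cuts; an element uses finitely many of them and the next one is still free. Splitting a forest
  produces pieces that may be zero. Nodes are therefore allowed to be zero, provided that they are
  so on both sides, and no node ever has to be deleted.\<close>

definition wo :: "'a rel" where
  "wo = (SOME r. well_order_on UNIV r)"

lemma wo: "well_order_on UNIV wo"
  unfolding wo_def using well_order_on by (rule someI_ex)

definition before :: "'a \<Rightarrow> 'a \<Rightarrow> bool" where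
  "before x y \<longleftrightarrow> (x, y) \<in> wo - Id"

lemma before_linear: "before x y \<or> x = y \<or> before y x"
proof -
  have "total wo"
    using wo unfolding well_order_on_def linear_order_on_def by blast
  then show ?thesis
    by (auto simp: before_def total_on_def)
qed

lemma before_trans: "before x y \<Longrightarrow> before y z \<Longrightarrow> before x z"
proof -
  have "trans wo" "antisym wo"
    using wo unfolding well_order_on_def linear_order_on_def partial_order_on_def
      preorder_on_def by blast+
  then show "before x y \<Longrightarrow> before y z \<Longrightarrow> before x z"
    using transD[of wo x y z] antisymD[of wo x y] unfolding before_def by auto
qed

lemma before_minimal:
  assumes "P x"
  obtains z where "P z" "\<And>y. before y z \<Longrightarrow> \<not> P y"
proof -
  have "wf (wo - Id :: 'a rel)"
    using wo[where 'a = 'a] by (simp add: well_order_on_def)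
  then have "\<exists>z\<in>Collect P. \<forall>y. (y, z) \<in> wo - Id \<longrightarrow> y \<notin> Collect P"
    using assms unfolding wf_eq_minimal by blast
  then show thesis
    using that by (auto simp: before_def)
qed

text \<open>Characteristic functions are compared lexicographically along the well-order: the set
  that contains the first point of difference is the larger one.\<close>

definition lex_less :: "'a set \<Rightarrow> 'a set \<Rightarrow> bool" where
  "lex_less A B \<longleftrightarrow> (\<exists>z. z \<in> B \<and> z \<notin> A \<and> (\<forall>y. before y z \<longrightarrow> (y \<in> A \<longleftrightarrow> y \<in> B)))"

lemma lex_less_irrefl: "\<not> lex_less A A"
  by (auto simp: lex_less_def)

lemma lex_less_trans:
  assumes "lex_less A B" "lex_less B C"
  shows "lex_less A C"
proof -
  obtain z where z: "z \<in> B" "z \<notin> A" "\<And>y. before y z \<Longrightarrow> y \<in> A \<longleftrightarrow> y \<in> B"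
    using assms(1) by (auto simp: lex_less_def)
  obtain w where w: "w \<in> C" "w \<notin> B" "\<And>y. before y w \<Longrightarrow> y \<in> B \<longleftrightarrow> y \<in> C"
    using assms(2) by (auto simp: lex_less_def)
  \<comment> \<open>The earlier of the two first differences is the first difference of
    \<open>A\<close> and \<open>C\<close>; they cannot coincide, as \<open>z\<close> is in
    \<open>B\<close> and \<open>w\<close> is not.\<close>
  consider "before z w" | "before w z"
    using before_linear z w by metis
  then show ?thesis
  proof cases
    case 1
    then show ?thesis
      using z w(3)[OF before_trans[OF _ 1]] w(3)[OF 1] unfolding lex_less_def by (intro exI[of _ z]) auto
  next
    case 2
    then show ?thesis
      using w z(3)[OF before_trans[OF _ 2]] z(3)[OF 2] unfolding lex_less_def by (intro exI[of _ w]) auto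
  qed
qed

lemma lex_less_linear: "lex_less A B \<or> A = B \<or> lex_less B A"
proof (cases "A = B")
  case False
  then obtain x where "(x \<in> A) \<noteq> (x \<in> B)"
    by blast
  then obtain z where "(z \<in> A) \<noteq> (z \<in> B)" "\<And>y. before y z \<Longrightarrow> \<not> (y \<in> A) \<noteq> (y \<in> B)"
    using before_minimal[of "\<lambda>x. (x \<in> A) \<noteq> (x \<in> B)"] by metis
  then show ?thesis
    unfolding lex_less_def by metis
qed simp

lemma psubset_lex_less:
  assumes "A \<subset> B"
  shows "lex_less A B"
proof -
  obtain x where "x \<in> B \<and> x \<notin> A"
    using assms by blast
  then obtain z where "z \<in> B \<and> z \<notin> A" "\<And>y. before y z \<Longrightarrow> \<not> (y \<in> B \<and> y \<notin> A)"
    using before_minimal[of "\<lambda>x. x \<in> B \<and> x \<notin> A"] by metis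
  then show ?thesis
    using assms unfolding lex_less_def by (intro exI[of _ z]) blast
qed

text \<open>The lexicographic product with the rationals makes the order dense.\<close>

typedef 'a chain = "UNIV :: ('a set \<times> rat) set" ..

definition shape :: "'a chain \<Rightarrow> 'a set" where
  "shape x = fst (Rep_chain x)"

definition height :: "'a chain \<Rightarrow> rat" where
  "height x = snd (Rep_chain x)"

lemma chain_eqI: "shape x = shape y \<Longrightarrow> height x = height y \<Longrightarrow> x = y"
  by (simp add: shape_def height_def prod_eq_iff flip: Rep_chain_inject)

lemma shape_Abs [simp]: "shape (Abs_chain (A, q)) = A"
  and height_Abs [simp]: "height (Abs_chain (A, q)) = q"
  by (simp_all add: shape_def height_def Abs_chain_inverse)

instantiation chain :: (type) linorder
begin

definition less_chain :: "'a chain \<Rightarrow> 'a chain \<Rightarrow> bool" where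
  "less_chain x y \<longleftrightarrow> lex_less (shape x) (shape y) \<or> shape x = shape y \<and> height x < height y"

definition less_eq_chain :: "'a chain \<Rightarrow> 'a chain \<Rightarrow> bool" where
  "less_eq_chain x y \<longleftrightarrow> x = y \<or> x < y"

instance
proof
  fix x y z :: "'a chain"
  have irrefl: "\<not> u < u" for u :: "'a chain"
    by (simp add: less_chain_def lex_less_irrefl)
  have trans: "u < w" if "u < v" "v < w" for u v w :: "'a chain"
    using that lex_less_trans unfolding less_chain_def by (metis order.strict_trans)
  have linear: "u < v \<or> u = v \<or> v < u" for u v :: "'a chain"
    using lex_less_linear chain_eqI less_linear unfolding less_chain_def by metis
  show "x < y \<longleftrightarrow> x \<le> y \<and> \<not> y \<le> x"
    unfolding less_eq_chain_def using irrefl[of x] trans[of x y x] by metis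
  show "x \<le> x"
    by (simp add: less_eq_chain_def)
  show "x \<le> z" if "x \<le> y" "y \<le> z"
    using that trans[of x y z] unfolding less_eq_chain_def by metis
  show "x = y" if "x \<le> y" "y \<le> x"
    using that irrefl[of x] trans[of x y x] unfolding less_eq_chain_def by metis
  show "x \<le> y \<or> y \<le> x"
    using linear[of x y] unfolding less_eq_chain_def by auto
qed

end

instance chain :: (type) dense_linorder
proof
  fix x y :: "'a chain"
  show "\<exists>z. x < z \<and> z < y" if "x < y"
  proof (cases "shape x = shape y")
    case True
    then have "height x < height y"
      using that by (simp add: less_chain_def lex_less_irrefl)
    then obtain q where "height x < q" "q < height y"
      using dense by blast
    then show ?thesis
      using True by (intro exI[of _ "Abs_chain (shape x, q)"]) (simp add: less_chain_def)
  next
    case False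
    then show ?thesis
      using that by (intro exI[of _ "Abs_chain (shape x, height x + 1)"])
        (simp add: less_chain_def)
  qed
qed

definition of_set :: "'a set \<Rightarrow> 'a chain" where
  "of_set A = Abs_chain (A, 0)"

text \<open>The common zero of all quotient chains. It is not the least element of the type, since
  the set \<open>{}\<close> also occurs with negative heights; for this reason
  \<open>base \<le> x\<close> accompanies most statements about chains.\<close>

definition base :: "'a chain" where
  "base = of_set {}"

lemma of_set_inject [simp]: "of_set A = of_set B \<longleftrightarrow> A = B"
  by (simp add: of_set_def Abs_chain_inject)

lemma of_set_less: "A \<subset> B \<Longrightarrow> of_set A < of_set B"
  by (simp add: of_set_def less_chain_def psubset_lex_less)

lemma of_set_mono: "A \<subseteq> B \<Longrightarrow> of_set A \<le> of_set B"
  using of_set_less[of A B] by (cases "A = B") (auto simp: less_imp_le)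

section \<open>Algebras of the variety as subdirect products of chains\<close>

definition cdiff :: "'a chain \<Rightarrow> 'a chain \<Rightarrow> 'a chain" where
  "cdiff x y = (if x \<le> y then base else x)"

notation zero_of ("\<zero>\<index>")
  and one_of ("\<one>\<index>")
  and join_of (infixl "\<squnion>\<index>" 65)
  and meet_of (infixl "\<sqinter>\<index>" 70)
  and diff_of (infixl "\<ominus>\<index>" 75)
  and le_in (infix "\<sqsubseteq>\<index>" 50)
  and below_in (infix "\<lless>\<index>" 50)

section \<open>Elementary laws of order, join, meet and difference\<close>

locale v6 =
  fixes A :: "'a struct" (structure)
  assumes model: "is_model A V6"
begin

abbreviation C where "C \<equiv> carrier A"
lemma closed [simp, intro]:
  "\<zero> \<in> C" "\<one> \<in> C"
  "x \<in> C \<Longrightarrow> y \<in> C \<Longrightarrow> x \<squnion> y \<in> C"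
  "x \<in> C \<Longrightarrow> y \<in> C \<Longrightarrow> x \<sqinter> y \<in> C"
  "x \<in> C \<Longrightarrow> y \<in> C \<Longrightarrow> x \<ominus> y \<in> C"
  using model by (auto simp: is_model_def is_struct_def)

lemma
  assumes "x \<in> C" "y \<in> C"
  shows join_comm: "x \<squnion> y = y \<squnion> x"
    and meet_comm: "x \<sqinter> y = y \<sqinter> x"
    and join_absorb: "x \<squnion> (x \<sqinter> y) = x"
    and meet_absorb: "x \<sqinter> (x \<squnion> y) = x"
    and le_join_diff: "x \<sqsubseteq> y \<squnion> (x \<ominus> y)"
    and prelinear: "(x \<ominus> y) \<sqinter> (y \<ominus> x) = \<zero>"
  using model assms unfolding is_model_V6_iff by blast+

lemma zero_le: "x \<in> C \<Longrightarrow> \<zero> \<sqsubseteq> x"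
  and le_one: "x \<in> C \<Longrightarrow> x \<sqsubseteq> \<one>"
  using model unfolding is_model_V6_iff by blast+

lemma
  assumes "x \<in> C" "y \<in> C" "z \<in> C"
  shows join_assoc: "x \<squnion> y \<squnion> z = x \<squnion> (y \<squnion> z)"
    and meet_assoc: "x \<sqinter> y \<sqinter> z = x \<sqinter> (y \<sqinter> z)"
    and distrib: "x \<sqinter> (y \<squnion> z) = (x \<sqinter> y) \<squnion> (x \<sqinter> z)"
    and diff_le_if: "x \<sqsubseteq> y \<squnion> z \<Longrightarrow> x \<ominus> y \<sqsubseteq> z"
  using model assms unfolding is_model_V6_iff by blast+

lemma le_refl: "x \<in> C \<Longrightarrow> x \<sqsubseteq> x"
  unfolding le_in_def by (metis closed(1,3) join_absorb meet_absorb)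

lemma le_antisym: "x \<in> C \<Longrightarrow> y \<in> C \<Longrightarrow> x \<sqsubseteq> y \<Longrightarrow> y \<sqsubseteq> x \<Longrightarrow> x = y"
  unfolding le_in_def using join_comm by metis

lemma le_trans: "x \<in> C \<Longrightarrow> y \<in> C \<Longrightarrow> z \<in> C \<Longrightarrow> x \<sqsubseteq> y \<Longrightarrow> y \<sqsubseteq> z \<Longrightarrow> x \<sqsubseteq> z"
  unfolding le_in_def using join_assoc by metis

lemma le_join1: "x \<in> C \<Longrightarrow> y \<in> C \<Longrightarrow> x \<sqsubseteq> x \<squnion> y"
  unfolding le_in_def by (metis join_assoc le_refl le_in_def)

lemma le_join2: "x \<in> C \<Longrightarrow> y \<in> C \<Longrightarrow> y \<sqsubseteq> x \<squnion> y"
  by (metis join_comm le_join1)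

lemma join_le: "x \<in> C \<Longrightarrow> y \<in> C \<Longrightarrow> z \<in> C \<Longrightarrow> x \<squnion> y \<sqsubseteq> z \<longleftrightarrow> x \<sqsubseteq> z \<and> y \<sqsubseteq> z"
  by (metis closed(3) join_assoc le_in_def le_join1 le_join2 le_trans)

lemma le_joinI1: "x \<in> C \<Longrightarrow> y \<in> C \<Longrightarrow> z \<in> C \<Longrightarrow> x \<sqsubseteq> y \<Longrightarrow> x \<sqsubseteq> y \<squnion> z"
  using le_trans[of x y "y \<squnion> z"] by (simp add: le_join1)

lemma le_joinI2: "x \<in> C \<Longrightarrow> y \<in> C \<Longrightarrow> z \<in> C \<Longrightarrow> x \<sqsubseteq> z \<Longrightarrow> x \<sqsubseteq> y \<squnion> z"
  using le_trans[of x z "y \<squnion> z"] by (simp add: le_join2)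

lemma join_leI: "x \<in> C \<Longrightarrow> y \<in> C \<Longrightarrow> z \<in> C \<Longrightarrow> x \<sqsubseteq> z \<Longrightarrow> y \<sqsubseteq> z \<Longrightarrow> x \<squnion> y \<sqsubseteq> z"
  by (simp add: join_le)

lemmas le_join_rules = join_leI le_join1 le_join2 le_joinI1 le_joinI2 le_refl

lemma le_iff_meet: "x \<in> C \<Longrightarrow> y \<in> C \<Longrightarrow> x \<sqsubseteq> y \<longleftrightarrow> x \<sqinter> y = x"
  unfolding le_in_def by (metis join_absorb join_comm meet_absorb meet_comm closed(4))

lemma meet_le1: "x \<in> C \<Longrightarrow> y \<in> C \<Longrightarrow> x \<sqinter> y \<sqsubseteq> x"
  by (metis closed(4) join_absorb join_comm le_in_def)

lemma meet_le2: "x \<in> C \<Longrightarrow> y \<in> C \<Longrightarrow> x \<sqinter> y \<sqsubseteq> y"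
  by (metis meet_comm meet_le1)

lemma le_meet: "x \<in> C \<Longrightarrow> y \<in> C \<Longrightarrow> z \<in> C \<Longrightarrow> z \<sqsubseteq> x \<sqinter> y \<longleftrightarrow> z \<sqsubseteq> x \<and> z \<sqsubseteq> y"
  by (metis closed(4) le_iff_meet meet_assoc meet_le1 meet_le2 le_trans)

lemma diff_le_iff: "x \<in> C \<Longrightarrow> y \<in> C \<Longrightarrow> z \<in> C \<Longrightarrow> x \<ominus> y \<sqsubseteq> z \<longleftrightarrow> x \<sqsubseteq> y \<squnion> z"
proof
  assume c: "x \<in> C" "y \<in> C" "z \<in> C" and "x \<ominus> y \<sqsubseteq> z"
  then have "y \<squnion> (x \<ominus> y) \<sqsubseteq> y \<squnion> z"
    by (auto intro: le_join_rules)
  then show "x \<sqsubseteq> y \<squnion> z"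
    using c le_trans[of x "y \<squnion> (x \<ominus> y)" "y \<squnion> z"] by (simp add: le_join_diff)
qed (rule diff_le_if)

lemma diff_le: "x \<in> C \<Longrightarrow> y \<in> C \<Longrightarrow> x \<ominus> y \<sqsubseteq> x"
  by (simp add: diff_le_iff le_join2)

section \<open>Existence of prime ideals\<close>

definition prime_ideal :: "'a set \<Rightarrow> bool" where
  "prime_ideal I \<longleftrightarrow> I \<subseteq> C \<and> \<zero> \<in> I \<and> \<one> \<notin> I \<and>
     (\<forall>x\<in>I. \<forall>y\<in>I. x \<squnion> y \<in> I) \<and> (\<forall>x\<in>C. \<forall>y\<in>I. x \<sqsubseteq> y \<longrightarrow> x \<in> I) \<and>
     (\<forall>x\<in>C. \<forall>y\<in>C. x \<sqinter> y \<in> I \<longrightarrow> x \<in> I \<or> y \<in> I)"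

definition ideal_avoiding :: "'a \<Rightarrow> 'a set \<Rightarrow> bool" where
  "ideal_avoiding d I \<longleftrightarrow> I \<subseteq> C \<and> \<zero> \<in> I \<and> d \<notin> I \<and>
     (\<forall>x\<in>I. \<forall>y\<in>I. x \<squnion> y \<in> I) \<and> (\<forall>x\<in>C. \<forall>y\<in>I. x \<sqsubseteq> y \<longrightarrow> x \<in> I)"

text \<open>An ideal that is maximal among those avoiding \<open>d\<close> is prime. If
  \<open>x\<close> and \<open>y\<close> lie outside, the ideals enlarged by them contain
  \<open>d\<close>; so \<open>d\<close> is below \<open>m \<squnion> x\<close> and below
  \<open>m \<squnion> y\<close> for some \<open>m\<close> in the ideal, hence below
  \<open>m \<squnion> (x \<sqinter> y)\<close>.\<close>

lemma prime_ideal_avoiding: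
  assumes d: "d \<in> C" "d \<noteq> \<zero>"
  obtains I where "prime_ideal I" "d \<notin> I"
proof -
  have "ideal_avoiding d {\<zero>}"
    unfolding ideal_avoiding_def using d le_refl[of \<zero>] zero_le
    by (auto simp: le_in_def) (metis closed(1) join_comm le_in_def zero_le)
  moreover have "ideal_avoiding d (\<Union> K)"
    if K: "K \<noteq> {}" "subset.chain (Collect (ideal_avoiding d)) K" for K
  proof -
    have mem: "L \<subseteq> C" "\<zero> \<in> L" "d \<notin> L" "x \<in> L \<Longrightarrow> y \<in> L \<Longrightarrow> x \<squnion> y \<in> L"
      "x \<in> C \<Longrightarrow> y \<in> L \<Longrightarrow> x \<sqsubseteq> y \<Longrightarrow> x \<in> L" if "L \<in> K" for L x y
      using K(2) that unfolding subset_chain_def ideal_avoiding_def by blast+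
    have "x \<squnion> y \<in> \<Union> K" if xy: "x \<in> \<Union> K" "y \<in> \<Union> K" for x y
    proof -
      obtain L L' where L: "L \<in> K" "x \<in> L" "L' \<in> K" "y \<in> L'"
        using xy by blast
      then have "L \<subseteq> L' \<or> L' \<subseteq> L"
        using K(2) unfolding subset_chain_def by blast
      then show ?thesis
        using L mem(4) by blast
    qed
    moreover have "x \<in> \<Union> K" if "x \<in> C" "y \<in> \<Union> K" "x \<sqsubseteq> y" for x y
      using that mem(5) by blast
    moreover have "\<Union> K \<subseteq> C" "\<zero> \<in> \<Union> K" "d \<notin> \<Union> K"
      using mem(1-3) K(1) by blast+
    ultimately show ?thesis
      unfolding ideal_avoiding_def by blast
  qed
  ultimately obtain I where I: "ideal_avoiding d I"
      and max: "\<And>K. ideal_avoiding d K \<Longrightarrow> I \<subseteq> K \<Longrightarrow> K = I"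
    using subset_Zorn_nonempty[of "Collect (ideal_avoiding d)"] by auto
  have I': "I \<subseteq> C" "\<zero> \<in> I" "d \<notin> I" "\<And>x y. x \<in> I \<Longrightarrow> y \<in> I \<Longrightarrow> x \<squnion> y \<in> I"
      "\<And>x y. x \<in> C \<Longrightarrow> y \<in> I \<Longrightarrow> x \<sqsubseteq> y \<Longrightarrow> x \<in> I"
    using I unfolding ideal_avoiding_def by auto
  have above: "\<exists>i\<in>I. d \<sqsubseteq> i \<squnion> x" if x: "x \<in> C" "x \<notin> I" for x
  proof (rule ccontr)
    assume no: "\<not> ?thesis"
    \<comment> \<open>The ideal generated by \<open>I\<close> and \<open>x\<close>. If it avoided
      \<open>d\<close>, it would equal \<open>I\<close> by maximality.\<close>
    define K where "K = {z \<in> C. \<exists>i\<in>I. z \<sqsubseteq> i \<squnion> x}"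
    have "z \<squnion> w \<in> K" if "z \<in> K" "w \<in> K" for z w
    proof -
      obtain i k where ik: "i \<in> I" "k \<in> I" "z \<sqsubseteq> i \<squnion> x" "w \<sqsubseteq> k \<squnion> x" and zw: "z \<in> C" "w \<in> C"
        using \<open>z \<in> K\<close> \<open>w \<in> K\<close> unfolding K_def by auto
      have ikC: "i \<in> C" "k \<in> C"
        using ik I' by auto
      have "i \<squnion> x \<sqsubseteq> i \<squnion> k \<squnion> x" "k \<squnion> x \<sqsubseteq> i \<squnion> k \<squnion> x"
        using ikC x by (auto intro: le_join_rules)
      then have "z \<sqsubseteq> i \<squnion> k \<squnion> x" "w \<sqsubseteq> i \<squnion> k \<squnion> x"
        using le_trans ik(3,4) ikC x(1) zw by (meson closed(3))+
      then have "z \<squnion> w \<sqsubseteq> i \<squnion> k \<squnion> x"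
        using ikC x zw by (simp add: join_le)
      then show ?thesis
        using I'(4)[OF ik(1,2)] zw unfolding K_def by blast
    qed
    moreover have "z \<in> K" if zw: "z \<in> C" "w \<in> K" "z \<sqsubseteq> w" for z w
    proof -
      obtain i where "i \<in> I" "w \<sqsubseteq> i \<squnion> x" "w \<in> C"
        using zw unfolding K_def by auto
      then show ?thesis
        using le_trans[of z w "i \<squnion> x"] zw x I'(1) unfolding K_def by auto
    qed
    moreover have "\<zero> \<in> K"
      using I'(2) x zero_le[of "\<zero> \<squnion> x"] unfolding K_def by blast
    ultimately have "ideal_avoiding d K"
      using no unfolding ideal_avoiding_def by (auto simp: K_def)
    moreover have "I \<subseteq> K"
      using I'(1) x(1) le_join1 unfolding K_def by blast
    ultimately have "K = I"
      by (rule max)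
    moreover have "x \<in> K"
      using I'(2) x(1) le_join2[of \<zero> x] unfolding K_def by blast
    ultimately show False
      using x by simp
  qed
  have prime: "x \<in> I \<or> y \<in> I" if xy: "x \<in> C" "y \<in> C" "x \<sqinter> y \<in> I" for x y
  proof (rule ccontr)
    assume "\<not> ?thesis"
    then obtain i k where ik: "i \<in> I" "d \<sqsubseteq> i \<squnion> x" "k \<in> I" "d \<sqsubseteq> k \<squnion> y"
      using above xy by metis
    have ikC: "i \<in> C" "k \<in> C"
      using ik I' by auto
    define m where "m = i \<squnion> k"
    have m: "m \<in> I" "m \<in> C" "d \<sqsubseteq> m \<squnion> x" "d \<sqsubseteq> m \<squnion> y"
    proof -
      show "m \<in> I" "m \<in> C"
        using ik I'(4) ikC unfolding m_def by auto
      have "i \<squnion> x \<sqsubseteq> m \<squnion> x" "k \<squnion> y \<sqsubseteq> m \<squnion> y"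
        using ikC xy(1,2) unfolding m_def by (auto intro: le_join_rules)
      then show "d \<sqsubseteq> m \<squnion> x" "d \<sqsubseteq> m \<squnion> y"
        using le_trans ik(2,4) ikC xy(1,2) d(1) unfolding m_def by (meson closed(3))+
    qed
    \<comment> \<open>The difference takes the place of the dual distributive law:
      \<open>d \<ominus> m\<close> is below both \<open>x\<close> and \<open>y\<close>.\<close>
    have "d \<ominus> m \<sqsubseteq> x \<sqinter> y"
      using m xy d by (simp add: le_meet diff_le_iff)
    then have "d \<sqsubseteq> m \<squnion> (x \<sqinter> y)"
      using m xy d by (simp add: diff_le_iff)
    moreover have "m \<squnion> (x \<sqinter> y) \<in> I"
      using I'(4) m(1) xy(3) by blast
    ultimately show False
      using I'(3,5) d(1) by blast
  qed
  have "\<one> \<notin> I"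
    using I'(3) I'(5)[OF d(1) _ le_one[OF d(1)]] by blast
  moreover have "\<forall>x\<in>C. \<forall>y\<in>C. x \<sqinter> y \<in> I \<longrightarrow> x \<in> I \<or> y \<in> I"
    using prime by (intro ballI impI)
  ultimately have "prime_ideal I"
    using I unfolding prime_ideal_def ideal_avoiding_def by (elim conjE, intro conjI)
  then show thesis
    using that I'(3) by blast
qed

section \<open>Evaluation in the chain modulo a prime ideal\<close>

text \<open>
  \<open>x\<close> lies below \<open>y\<close> modulo the prime ideal \<open>I\<close> iff \<open>x \<ominus> y \<in> I\<close>; the set is the set of elements strictly
  below \<open>x\<close>. The value at a set that is not a prime ideal is constant, so that the homomorphism
  properties, except for the one about \<open>\<one>\<close>, hold without a side condition.
\<close>

definition val :: "'a set \<Rightarrow> 'a \<Rightarrow> 'a chain" where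
  "val I x = (if prime_ideal I then of_set {z \<in> C. x \<ominus> z \<notin> I} else base)"

lemma val_base_le: "base \<le> val I x"
  unfolding val_def base_def by (auto intro: of_set_mono)

context
  fixes I
  assumes prime: "prime_ideal I"
begin

lemma idealD: "I \<subseteq> C" "\<zero> \<in> I" "\<one> \<notin> I" "x \<in> I \<Longrightarrow> y \<in> I \<Longrightarrow> x \<squnion> y \<in> I"
  "x \<in> C \<Longrightarrow> y \<in> I \<Longrightarrow> x \<sqsubseteq> y \<Longrightarrow> x \<in> I"
  "x \<in> C \<Longrightarrow> y \<in> C \<Longrightarrow> x \<sqinter> y \<in> I \<Longrightarrow> x \<in> I \<or> y \<in> I"
  using prime unfolding prime_ideal_def by blast+

text \<open>Prelinearity puts the meet of the two differences into the ideal, and primality then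
  puts one of them there. This is what makes the quotient a chain.\<close>

lemma mod_total: "x \<in> C \<Longrightarrow> y \<in> C \<Longrightarrow> x \<ominus> y \<in> I \<or> y \<ominus> x \<in> I"
  using idealD(2) idealD(6)[of "x \<ominus> y" "y \<ominus> x"] prelinear by auto

lemma mod_trans:
  assumes "x \<in> C" "y \<in> C" "z \<in> C" "x \<ominus> y \<in> I" "y \<ominus> z \<in> I"
  shows "x \<ominus> z \<in> I"
proof -
  let ?w = "z \<squnion> ((x \<ominus> y) \<squnion> (y \<ominus> z))"
  have "z \<squnion> (y \<ominus> z) \<sqsubseteq> ?w" "x \<ominus> y \<sqsubseteq> ?w"
    using assms(1-3) by (auto intro: le_join_rules)
  then have "y \<squnion> (x \<ominus> y) \<sqsubseteq> ?w"
    using assms(1-3) le_join_diff[of y z] le_trans[of y "z \<squnion> (y \<ominus> z)" ?w] by (simp add: join_le)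
  then have "x \<sqsubseteq> ?w"
    using assms(1-3) le_join_diff[of x y] le_trans[of x "y \<squnion> (x \<ominus> y)" ?w] by simp
  then have "x \<ominus> z \<sqsubseteq> (x \<ominus> y) \<squnion> (y \<ominus> z)"
    using assms by (simp add: diff_le_iff)
  then show ?thesis
    using assms idealD(4)[of "x \<ominus> y" "y \<ominus> z"] idealD(5)[of "x \<ominus> z" "(x \<ominus> y) \<squnion> (y \<ominus> z)"] by simp
qed

lemma mod_of_le:
  assumes "x \<in> C" "y \<in> C" "x \<sqsubseteq> y"
  shows "x \<ominus> y \<in> I"
proof -
  have "x \<ominus> y \<sqsubseteq> \<zero>"
    using assms by (auto simp: diff_le_iff intro: le_join_rules)
  then show ?thesis
    using idealD(2) idealD(5)[of "x \<ominus> y" \<zero>] assms by simp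
qed

lemma val_le_iff:
  assumes "x \<in> C" "y \<in> C"
  shows "val I x \<le> val I y \<longleftrightarrow> x \<ominus> y \<in> I"
proof -
  let ?S = "\<lambda>x. {z \<in> C. x \<ominus> z \<notin> I}"
  have "?S x \<subseteq> ?S y" if "x \<ominus> y \<in> I"
    using that mod_trans assms by blast
  moreover have "?S y \<subset> ?S x" if "x \<ominus> y \<notin> I"
  proof -
    have "y \<ominus> x \<in> I"
      using that mod_total assms by blast
    then have "?S y \<subseteq> ?S x"
      using mod_trans assms by blast
    \<comment> \<open>Modulo \<open>I\<close>, the element \<open>y\<close> is strictly below
      \<open>x\<close> but not strictly below itself, so the inclusion is proper.\<close>
    moreover have "y \<in> ?S x" "y \<notin> ?S y"
      using that assms mod_of_le le_refl by auto
    ultimately show ?thesis by blast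
  qed
  ultimately show ?thesis
    using prime of_set_mono[of "?S x" "?S y"] of_set_less[of "?S y" "?S x"]
    unfolding val_def by (cases "x \<ominus> y \<in> I") (auto simp: not_le)
qed

lemma val_le_if: "x \<in> C \<Longrightarrow> y \<in> C \<Longrightarrow> x \<sqsubseteq> y \<Longrightarrow> val I x \<le> val I y"
  by (simp add: val_le_iff mod_of_le)

lemma val_zero': "val I \<zero> = base"
proof -
  have "{z \<in> C. \<zero> \<ominus> z \<notin> I} = {}"
    using mod_of_le zero_le by auto
  then show ?thesis
    by (simp add: val_def prime base_def)
qed

lemma val_one_gt': "base < val I \<one>"
proof -
  have "\<one> \<ominus> \<zero> \<notin> I"
    using idealD(3) idealD(5)[of \<one> "\<one> \<ominus> \<zero>"] le_join_diff[of \<one> \<zero>] zero_le[of "\<one> \<ominus> \<zero>"]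
    by (metis closed(1,2,5) le_in_def)
  then show ?thesis
    using val_le_iff[of \<one> \<zero>] by (simp add: val_zero')
qed

lemma val_join':
  assumes "x \<in> C" "y \<in> C"
  shows "val I (x \<squnion> y) = max (val I x) (val I y)"
proof (rule antisym)
  have *: "val I (u \<squnion> w) \<le> val I w" if uw: "u \<in> C" "w \<in> C" "val I u \<le> val I w" for u w
  proof -
    have "u \<ominus> w \<in> I"
      using uw val_le_iff by simp
    moreover have "u \<squnion> w \<sqsubseteq> w \<squnion> (u \<ominus> w)"
      using uw by (simp add: join_le le_join_diff le_join1)
    ultimately show ?thesis
      using uw idealD(5)[of "(u \<squnion> w) \<ominus> w" "u \<ominus> w"] by (simp add: val_le_iff diff_le_iff)
  qed
  show "val I (x \<squnion> y) \<le> max (val I x) (val I y)"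
    using *[of x y] *[of y x] assms join_comm by (metis le_cases max_def)
  show "max (val I x) (val I y) \<le> val I (x \<squnion> y)"
    using assms by (simp add: val_le_if le_join1 le_join2)
qed

lemma val_meet':
  assumes "x \<in> C" "y \<in> C"
  shows "val I (x \<sqinter> y) = min (val I x) (val I y)"
proof (rule antisym)
  have *: "val I u \<le> val I (u \<sqinter> w)" if uw: "u \<in> C" "w \<in> C" "val I u \<le> val I w" for u w
  proof -
    have "u \<ominus> w \<in> I"
      using uw val_le_iff by simp
    moreover have "u \<ominus> (u \<sqinter> w) \<sqsubseteq> u \<ominus> w"
    proof -
      have "u \<sqinter> (w \<squnion> (u \<ominus> w)) \<sqsubseteq> (u \<sqinter> w) \<squnion> (u \<ominus> w)"
        using uw by (auto simp: distrib intro: le_join_rules meet_le2)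
      moreover have "u \<sqsubseteq> u \<sqinter> (w \<squnion> (u \<ominus> w))"
        using uw by (simp add: le_meet le_refl le_join_diff)
      ultimately show ?thesis
        using uw le_trans[of u "u \<sqinter> (w \<squnion> (u \<ominus> w))" "(u \<sqinter> w) \<squnion> (u \<ominus> w)"]
        by (simp add: diff_le_iff)
    qed
    ultimately show ?thesis
      using uw idealD(5)[of "u \<ominus> (u \<sqinter> w)" "u \<ominus> w"] by (simp add: val_le_iff)
  qed
  show "val I (x \<sqinter> y) \<le> min (val I x) (val I y)"
    using assms by (simp add: val_le_if meet_le1 meet_le2)
  show "min (val I x) (val I y) \<le> val I (x \<sqinter> y)"
    using *[of x y] *[of y x] assms meet_comm by (metis le_cases min_def)
qed

text \<open>If \<open>x\<close> is not below \<open>y\<close> modulo \<open>I\<close>, then neither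
  is \<open>x \<ominus> y\<close>, so \<open>y\<close> is below \<open>x \<ominus> y\<close> by
  linearity. Since \<open>x \<sqsubseteq> y \<squnion> (x \<ominus> y)\<close>, also
  \<open>x\<close> is below \<open>x \<ominus> y\<close>.\<close>

lemma val_diff':
  assumes "x \<in> C" "y \<in> C"
  shows "val I (x \<ominus> y) = cdiff (val I x) (val I y)"
proof -
  have le: "x \<ominus> y \<sqsubseteq> x"
    using assms by (simp add: diff_le_iff le_join2)
  show ?thesis
  proof (cases "val I x \<le> val I y")
    case True
    then have "x \<ominus> y \<in> I"
      using assms val_le_iff by simp
    then have "x \<ominus> y \<ominus> \<zero> \<in> I"
      using assms idealD(5)[of "x \<ominus> y \<ominus> \<zero>" "x \<ominus> y"] diff_le[of "x \<ominus> y" \<zero>] by simp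
    then have "val I (x \<ominus> y) \<le> base"
      using val_le_iff[of "x \<ominus> y" \<zero>] assms by (simp add: val_zero')
    then show ?thesis
      using True val_base_le by (simp add: cdiff_def antisym)
  next
    case False
    then have notin: "x \<ominus> y \<notin> I"
      using assms val_le_iff by simp
    have "x \<ominus> y \<sqsubseteq> x \<ominus> y \<ominus> y"
    proof -
      have "x \<sqsubseteq> y \<squnion> (x \<ominus> y \<ominus> y)"
        using assms le_join_diff[of "x \<ominus> y" y]
          le_trans[of x "y \<squnion> (x \<ominus> y)" "y \<squnion> (x \<ominus> y \<ominus> y)"]
        by (auto intro: le_join_rules le_join_diff)
      then show ?thesis
        using assms by (simp add: diff_le_iff)
    qed
    then have "x \<ominus> y \<ominus> y \<notin> I"
      using notin idealD(5)[of "x \<ominus> y" "x \<ominus> y \<ominus> y"] assms by auto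
    then have "y \<ominus> (x \<ominus> y) \<in> I"
      using mod_total[of y "x \<ominus> y"] assms by auto
    moreover have "x \<ominus> (x \<ominus> y) \<sqsubseteq> y \<ominus> (x \<ominus> y)"
    proof -
      have "x \<sqsubseteq> (x \<ominus> y) \<squnion> (y \<ominus> (x \<ominus> y))"
        using assms le_join_diff[of y "x \<ominus> y"]
          le_trans[of x "y \<squnion> (x \<ominus> y)" "(x \<ominus> y) \<squnion> (y \<ominus> (x \<ominus> y))"]
        by (auto intro: le_join_rules le_join_diff)
      then show ?thesis
        using assms by (simp add: diff_le_iff)
    qed
    ultimately have "x \<ominus> (x \<ominus> y) \<in> I"
      using idealD(5)[of "x \<ominus> (x \<ominus> y)" "y \<ominus> (x \<ominus> y)"] assms by auto
    then have "val I x \<le> val I (x \<ominus> y)"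
      using assms val_le_iff by simp
    then show ?thesis
      using False le assms by (simp add: cdiff_def antisym val_le_if)
  qed
qed

end

section \<open>Reduction to pointwise statements about chains\<close>

lemma val_zero [simp]: "val I \<zero> = base"
  using val_zero' by (cases "prime_ideal I") (auto simp: val_def)

lemma val_join [simp]: "x \<in> C \<Longrightarrow> y \<in> C \<Longrightarrow> val I (x \<squnion> y) = max (val I x) (val I y)"
  using val_join' by (cases "prime_ideal I") (auto simp: val_def)

lemma val_meet [simp]: "x \<in> C \<Longrightarrow> y \<in> C \<Longrightarrow> val I (x \<sqinter> y) = min (val I x) (val I y)"
  using val_meet' by (cases "prime_ideal I") (auto simp: val_def)

lemma val_diff [simp]: "x \<in> C \<Longrightarrow> y \<in> C \<Longrightarrow> val I (x \<ominus> y) = cdiff (val I x) (val I y)"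
  using val_diff' by (cases "prime_ideal I") (auto simp: val_def cdiff_def)

text \<open>A nonzero difference lies outside some prime ideal, and the valuation at this ideal
  separates the two elements.\<close>

lemma val_eqI:
  assumes "x \<in> C" "y \<in> C" "\<And>I. val I x = val I y"
  shows "x = y"
proof -
  have *: "u \<sqsubseteq> w" if uw: "u \<in> C" "w \<in> C" "\<And>I. val I u \<le> val I w" for u w
  proof -
    have "u \<ominus> w = \<zero>"
    proof (rule ccontr)
      assume "u \<ominus> w \<noteq> \<zero>"
      then obtain I where "prime_ideal I" "u \<ominus> w \<notin> I"
        using prime_ideal_avoiding uw by (metis closed(5))
      then show False
        using val_le_iff uw by blast
    qed
    then show ?thesis
      using uw le_join_diff[of u w] by (metis closed(1) join_comm le_in_def zero_le)
  qed
  show ?thesis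
    using *[of x y] *[of y x] assms le_antisym by simp
qed

lemma eq_iff: "x \<in> C \<Longrightarrow> y \<in> C \<Longrightarrow> x = y \<longleftrightarrow> (\<forall>I. val I x = val I y)"
  using val_eqI by blast

lemma le_iff: "x \<in> C \<Longrightarrow> y \<in> C \<Longrightarrow> x \<sqsubseteq> y \<longleftrightarrow> (\<forall>I. val I x \<le> val I y)"
  by (auto simp: le_in_def eq_iff max_def)

text \<open>In a chain the defining equations of \<open>\<lless>\<close> exclude equality of the two
  values unless both are zero. The second alternative recurs in all the chain lemmas.\<close>

lemma below_iff: "x \<in> C \<Longrightarrow> y \<in> C \<Longrightarrow>
    x \<lless> y \<longleftrightarrow> (\<forall>I. val I x < val I y \<or> val I y = base \<and> val I x = base)"
  (is "_ \<Longrightarrow> _ \<Longrightarrow> _ \<longleftrightarrow> (\<forall>I. ?P I)")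
proof -
  assume xy: "x \<in> C" "y \<in> C"
  have "cdiff b a = b \<and> a \<le> b \<longleftrightarrow> a < b \<or> b = base \<and> a = base" if "base \<le> a" for a b :: "'a chain"
    using that unfolding cdiff_def by (cases a b rule: linorder_cases) auto
  then have "?P I \<longleftrightarrow> cdiff (val I y) (val I x) = val I y \<and> val I x \<le> val I y" for I
    using val_base_le by blast
  then show "x \<lless> y \<longleftrightarrow> (\<forall>I. ?P I)"
    using xy by (simp add: below_in_def le_iff eq_iff all_conj_distrib)
qed

lemma val_base [simp]: "base \<le> val I x" "\<not> val I x < base" "val I x \<le> base \<longleftrightarrow> val I x = base"
  using val_base_le[of I x] by auto

lemmas pointwise = eq_iff le_iff below_iff

lemma below_zero [simp]: "\<zero> \<lless> \<zero>"
  by (simp add: below_iff)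

lemma zero_below: "x \<in> C \<Longrightarrow> \<zero> \<lless> x"
  by (auto simp: below_iff less_le)

lemma below_imp_le: "x \<in> C \<Longrightarrow> y \<in> C \<Longrightarrow> x \<lless> y \<Longrightarrow> x \<sqsubseteq> y"
  by (simp add: below_in_def)

lemma eq_zero_if_below_self: "x \<in> C \<Longrightarrow> y \<in> C \<Longrightarrow> x \<lless> y \<Longrightarrow> y \<sqsubseteq> x \<Longrightarrow> y = \<zero>"
  by (simp add: pointwise) (metis not_le)

lemma le_zero: "x \<in> C \<Longrightarrow> x \<sqsubseteq> \<zero> \<longleftrightarrow> x = \<zero>"
  by (simp add: pointwise)

text \<open>At each prime ideal one of \<open>a\<close> and \<open>b\<close> vanishes, and with it
  one component of every join. So the algebra below \<open>a \<squnion> b\<close> behaves like a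
  product.\<close>

lemma
  assumes "x \<in> C" "y \<in> C" "z \<in> C" "w \<in> C" "a \<in> C" "b \<in> C"
    and "x \<sqsubseteq> a" "z \<sqsubseteq> a" "y \<sqsubseteq> b" "w \<sqsubseteq> b" and "a \<sqinter> b = \<zero>"
  shows disjoint_meet: "(x \<squnion> y) \<sqinter> (z \<squnion> w) = (x \<sqinter> z) \<squnion> (y \<sqinter> w)"
    and disjoint_diff: "(x \<squnion> y) \<ominus> (z \<squnion> w) = (x \<ominus> z) \<squnion> (y \<ominus> w)"
    and disjoint_eq: "x \<squnion> y = z \<squnion> w \<longleftrightarrow> x = z \<and> y = w"
proof -
  have le: "val I x \<le> val I a" "val I z \<le> val I a" "val I y \<le> val I b" "val I w \<le> val I b"
    "val I a = base \<or> val I b = base" for I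
    using assms by (auto simp: pointwise min_def split: if_splits)
  have "val I ((x \<squnion> y) \<sqinter> (z \<squnion> w)) = val I ((x \<sqinter> z) \<squnion> (y \<sqinter> w))"
    "val I ((x \<squnion> y) \<ominus> (z \<squnion> w)) = val I ((x \<ominus> z) \<squnion> (y \<ominus> w))" for I
    using le[of I] assms by (auto simp: max_def min_def cdiff_def)
  then show "(x \<squnion> y) \<sqinter> (z \<squnion> w) = (x \<sqinter> z) \<squnion> (y \<sqinter> w)"
    "(x \<squnion> y) \<ominus> (z \<squnion> w) = (x \<ominus> z) \<squnion> (y \<ominus> w)"
    using assms by (auto intro!: val_eqI)
  have "max (val I x) (val I y) = max (val I z) (val I w) \<longleftrightarrow> val I x = val I z \<and> val I y = val I w" for I
    using le[of I] by (auto simp: max_def)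
  then show "x \<squnion> y = z \<squnion> w \<longleftrightarrow> x = z \<and> y = w"
    using assms by (auto simp: eq_iff)
qed

end

section \<open>Back and forth between models of the density and splitting axioms\<close>

lemma chain_split:
  fixes a :: "'a chain"
  assumes "base \<le> a" "base \<le> a'" "base \<le> u" "base \<le> v" "base \<le> c"
    and "max u v = max a a'" "min u v = base" "min a a' = base"
    and "c < a \<or> a = base \<and> c = base"
  shows "max (min u c) (min v c) = c" "min (min u c) (min v c) = base"
    "max (min u a') (min v a') = a'" "min (min u a') (min v a') = base"
    "max (min u a) (min v a) = a"
    "min u c < min u a \<or> min u a = base \<and> min u c = base"
    "min v c < min v a \<or> min v a = base \<and> min v c = base"
    "min (min u a) (min u a') = base" "min (min v a) (min v a') = base"
    "max (min u a) (min u a') = u" "max (min v a) (min v a') = v"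
proof -
  have "u = base \<or> v = base" "a = base \<or> a' = base"
    using assms(7,8) by (auto simp: min_def split: if_splits)
  then show "max (min u c) (min v c) = c" "min (min u c) (min v c) = base"
    "max (min u a') (min v a') = a'" "min (min u a') (min v a') = base"
    "max (min u a) (min v a) = a"
    "min u c < min u a \<or> min u a = base \<and> min u c = base"
    "min v c < min v a \<or> min v a = base \<and> min v c = base"
    "min (min u a) (min u a') = base" "min (min v a) (min v a') = base"
    "max (min u a) (min u a') = u" "max (min v a) (min v a') = v"
    using assms by (elim disjE; simp add: max_absorb1 max_absorb2 min_absorb1 min_absorb2 less_imp_le)+
qed

text \<open>
  \<open>a1\<close> is \<open>a\<close> where \<open>x\<close> reaches \<open>a\<close>, \<open>a2\<close> is the complementary part of \<open>a\<close>, and \<open>x2\<close> is \<open>x\<close> where it lies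
  strictly between \<open>c\<close> and \<open>a\<close>.
\<close>

lemma chain_extend:
  fixes a :: "'a chain"
  assumes "base \<le> a" "base \<le> a'" "base \<le> x" "base \<le> c"
    and "x \<le> max a a'" "min a a' = base" "c < a \<or> a = base \<and> c = base"
  defines "a2 \<equiv> cdiff a (cdiff (min x a) c)"
  defines "a1 \<equiv> cdiff a a2"
  defines "x2 \<equiv> min (cdiff (min x a) c) a2"
  shows "max (min c a1) (min c a2) = c" "min (min c a1) (min c a2) = base"
    "max a1 a2 = a" "min a1 a2 = base"
    "min c a1 < a1 \<or> a1 = base \<and> min c a1 = base"
    "max (min (min c a2) x2) (cdiff (min c a2) x2) = min c a2"
    "min (min (min c a2) x2) (cdiff (min c a2) x2) = base"
    "min (min c a2) x2 < x2 \<or> x2 = base \<and> min (min c a2) x2 = base"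
    "min x2 (cdiff (min c a2) x2) = base"
    "max x2 (cdiff (min c a2) x2) < a2 \<or> a2 = base \<and> max x2 (cdiff (min c a2) x2) = base"
    "min a2 a' = base" "min a1 (max a2 a') = base"
    "max a1 (max a2 a') = max a a'"
    "x = max (max (min x c) a1) (max x2 (min x a'))"
proof -
  have a: "a = base \<or> a' = base"
    using assms(6) by (auto simp: min_def split: if_splits)
  consider "x \<le> c" | "a \<le> x" "c < x" | "c < x" "x < a"
    by (meson not_le)
  then have "a1 = base \<and> x2 = base \<and> a2 = a \<and> x \<le> max c a' \<or>
    a1 = a \<and> a2 = base \<and> x2 = base \<and> a \<le> x \<and> c < x \<or> a1 = base \<and> a2 = a \<and> x2 = x \<and> c < x \<and> x < a"
    using assms a by cases (auto simp: cdiff_def max_def min_def)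
  then show "max (min c a1) (min c a2) = c" "min (min c a1) (min c a2) = base"
    "max a1 a2 = a" "min a1 a2 = base"
    "min c a1 < a1 \<or> a1 = base \<and> min c a1 = base"
    "max (min (min c a2) x2) (cdiff (min c a2) x2) = min c a2"
    "min (min (min c a2) x2) (cdiff (min c a2) x2) = base"
    "min (min c a2) x2 < x2 \<or> x2 = base \<and> min (min c a2) x2 = base"
    "min x2 (cdiff (min c a2) x2) = base"
    "max x2 (cdiff (min c a2) x2) < a2 \<or> a2 = base \<and> max x2 (cdiff (min c a2) x2) = base"
    "min a2 a' = base" "min a1 (max a2 a') = base"
    "max a1 (max a2 a') = max a a'"
    "x = max (max (min x c) a1) (max x2 (min x a'))"
    using a assms(1-7)
    by (elim disjE; simp add: max_absorb1 max_absorb2 min_absorb1 min_absorb2 cdiff_def less_imp_le;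
       auto simp: max_def min_def)+
qed

context v6
begin

text \<open>Here \<open>a\<close> is a root, \<open>c\<close> the join of its children and
  \<open>a'\<close> the join of the other roots. A decomposition of the join of all roots into
  disjoint \<open>u\<close> and \<open>v\<close> cuts each of them in two. At each prime ideal one
  of \<open>u\<close> and \<open>v\<close> and one of \<open>a\<close> and \<open>a'\<close>
  vanishes, which leaves four cases.\<close>

lemma split_alg:
  assumes C: "a \<in> C" "a' \<in> C" "u \<in> C" "v \<in> C" "c \<in> C"
    and uv: "u \<squnion> v = a \<squnion> a'" "u \<sqinter> v = \<zero>" and a: "a \<sqinter> a' = \<zero>" and c: "c \<lless> a"
  shows "(u \<sqinter> c) \<squnion> (v \<sqinter> c) = c" "(u \<sqinter> c) \<sqinter> (v \<sqinter> c) = \<zero>"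
    and "(u \<sqinter> a') \<squnion> (v \<sqinter> a') = a'" "(u \<sqinter> a') \<sqinter> (v \<sqinter> a') = \<zero>"
    and "(u \<sqinter> a) \<squnion> (v \<sqinter> a) = a"
    and "u \<sqinter> c \<lless> u \<sqinter> a" "v \<sqinter> c \<lless> v \<sqinter> a"
    and "(u \<sqinter> a) \<sqinter> (u \<sqinter> a') = \<zero>" "(v \<sqinter> a) \<sqinter> (v \<sqinter> a') = \<zero>"
    and "(u \<sqinter> a) \<squnion> (u \<sqinter> a') = u" "(v \<sqinter> a) \<squnion> (v \<sqinter> a') = v"
proof -
  have "max (val I u) (val I v) = max (val I a) (val I a')" "min (val I u) (val I v) = base"
     "min (val I a) (val I a') = base" "val I c < val I a \<or> val I a = base \<and> val I c = base" for I
    using assms by (simp_all add: pointwise)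
  note * = chain_split[OF val_base(1) val_base(1) val_base(1) val_base(1) val_base(1) this]
  show "(u \<sqinter> c) \<squnion> (v \<sqinter> c) = c" "(u \<sqinter> c) \<sqinter> (v \<sqinter> c) = \<zero>"
    "(u \<sqinter> a') \<squnion> (v \<sqinter> a') = a'" "(u \<sqinter> a') \<sqinter> (v \<sqinter> a') = \<zero>"
    "(u \<sqinter> a) \<squnion> (v \<sqinter> a) = a"
    "u \<sqinter> c \<lless> u \<sqinter> a" "v \<sqinter> c \<lless> v \<sqinter> a"
    "(u \<sqinter> a) \<sqinter> (u \<sqinter> a') = \<zero>" "(v \<sqinter> a) \<sqinter> (v \<sqinter> a') = \<zero>"
    "(u \<sqinter> a) \<squnion> (u \<sqinter> a') = u" "(v \<sqinter> a) \<squnion> (v \<sqinter> a') = v"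
    using C * by (simp_all only: pointwise closed val_join val_meet val_zero simp_thms) 
qed

text \<open>These are the conditions for three new nodes: \<open>a1\<close> over its share of
  \<open>c\<close>, \<open>x2\<close> over the part of \<open>c\<close> that it dominates, and
  \<open>a2\<close> over \<open>x2\<close> and the rest of its share of \<open>c\<close>. The last
  equation recovers \<open>x\<close> from the new nodes and its parts below \<open>c\<close> and
  \<open>a'\<close>.\<close>

lemma extend_alg:
  assumes C: "a \<in> C" "a' \<in> C" "x \<in> C" "c \<in> C"
    and x: "x \<sqsubseteq> a \<squnion> a'" and a: "a \<sqinter> a' = \<zero>" and c: "c \<lless> a"
    and a2_def: "a2 = a \<ominus> ((x \<sqinter> a) \<ominus> c)"
    and a1_def: "a1 = a \<ominus> a2"
    and x2_def: "x2 = ((x \<sqinter> a) \<ominus> c) \<sqinter> a2"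
  shows "(c \<sqinter> a1) \<squnion> (c \<sqinter> a2) = c" "(c \<sqinter> a1) \<sqinter> (c \<sqinter> a2) = \<zero>"
    "a1 \<squnion> a2 = a" "a1 \<sqinter> a2 = \<zero>"
    "c \<sqinter> a1 \<lless> a1"
    "(c \<sqinter> a2 \<sqinter> x2) \<squnion> (c \<sqinter> a2) \<ominus> x2 = c \<sqinter> a2"
    "(c \<sqinter> a2 \<sqinter> x2) \<sqinter> (c \<sqinter> a2) \<ominus> x2 = \<zero>"
    "c \<sqinter> a2 \<sqinter> x2 \<lless> x2"
    "x2 \<sqinter> (c \<sqinter> a2) \<ominus> x2 = \<zero>"
    "x2 \<squnion> (c \<sqinter> a2) \<ominus> x2 \<lless> a2"
    "a2 \<sqinter> a' = \<zero>" "a1 \<sqinter> (a2 \<squnion> a') = \<zero>"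
    "a1 \<squnion> (a2 \<squnion> a') = a \<squnion> a'"
    "x = (x \<sqinter> c) \<squnion> a1 \<squnion> (x2 \<squnion> (x \<sqinter> a'))"
proof -
  have "val I x \<le> max (val I a) (val I a')"
     "min (val I a) (val I a') = base" "val I c < val I a \<or> val I a = base \<and> val I c = base" for I
    using C x a c by (simp_all add: pointwise)
  note * = chain_extend[OF val_base(1) val_base(1) val_base(1) val_base(1) this]
  have C': "a1 \<in> C" "a2 \<in> C" "x2 \<in> C"
    using C unfolding a1_def a2_def x2_def by auto
  have v: "val I a2 = cdiff (val I a) (cdiff (min (val I x) (val I a)) (val I c))"
    "val I a1 = cdiff (val I a) (val I a2)"
    "val I x2 = min (cdiff (min (val I x) (val I a)) (val I c)) (val I a2)" for I
    using C unfolding a1_def a2_def x2_def by simp_all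
  show "(c \<sqinter> a1) \<squnion> (c \<sqinter> a2) = c" "(c \<sqinter> a1) \<sqinter> (c \<sqinter> a2) = \<zero>"
    "a1 \<squnion> a2 = a" "a1 \<sqinter> a2 = \<zero>"
    "c \<sqinter> a1 \<lless> a1"
    "(c \<sqinter> a2 \<sqinter> x2) \<squnion> (c \<sqinter> a2) \<ominus> x2 = c \<sqinter> a2"
    "(c \<sqinter> a2 \<sqinter> x2) \<sqinter> (c \<sqinter> a2) \<ominus> x2 = \<zero>"
    "c \<sqinter> a2 \<sqinter> x2 \<lless> x2"
    "x2 \<sqinter> (c \<sqinter> a2) \<ominus> x2 = \<zero>"
    "x2 \<squnion> (c \<sqinter> a2) \<ominus> x2 \<lless> a2"
    "a2 \<sqinter> a' = \<zero>" "a1 \<sqinter> (a2 \<squnion> a') = \<zero>"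
    "a1 \<squnion> (a2 \<squnion> a') = a \<squnion> a'"
    "x = (x \<sqinter> c) \<squnion> a1 \<squnion> (x2 \<squnion> (x \<sqinter> a'))"
    \<comment> \<open>The values of \<open>a1\<close> and \<open>x2\<close> are expressed through
      that of \<open>a2\<close>, so \<open>a2\<close> is folded before them.\<close>
    using C C' *[folded v(1), folded v(2,3)]
    by (simp_all only: pointwise closed val_join val_meet val_diff val_zero simp_thms) 
qed

lemma meet_zero_mono:
  assumes "x \<in> C" "y \<in> C" "a \<in> C" "b \<in> C" "x \<sqsubseteq> a" "y \<sqsubseteq> b" "a \<sqinter> b = \<zero>"
  shows "x \<sqinter> y = \<zero>"
proof -
  have "val I x \<le> val I a" "val I y \<le> val I b" "min (val I a) (val I b) = base" for I
    using assms by (simp_all add: pointwise)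
  then have "val I (x \<sqinter> y) = base" for I
    using min.mono[of "val I x" "val I a" "val I y" "val I b"] assms
    by (metis val_meet val_base(3))
  then show ?thesis
    using assms by (simp add: eq_iff)
qed

lemma join_mono:
  "x \<in> C \<Longrightarrow> y \<in> C \<Longrightarrow> a \<in> C \<Longrightarrow> b \<in> C \<Longrightarrow> x \<sqsubseteq> a \<Longrightarrow> y \<sqsubseteq> b \<Longrightarrow> x \<squnion> y \<sqsubseteq> a \<squnion> b"
  by (auto intro: le_join_rules)

lemma below_mono:
  assumes "x \<in> C" "y \<in> C" "z \<in> C" "x \<sqsubseteq> y" "y \<lless> z"
  shows "x \<lless> z"
proof -
  have "val I x \<le> val I y" "val I y < val I z \<or> val I z = base \<and> val I y = base" for I
    using assms by (simp_all add: pointwise)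
  then have "val I x < val I z \<or> val I z = base \<and> val I x = base" for I
    by (metis le_less_trans val_base(3))
  then show ?thesis
    using assms by (simp add: below_iff)
qed

lemma join_zero [simp]: "x \<in> C \<Longrightarrow> x \<squnion> \<zero> = x" "x \<in> C \<Longrightarrow> \<zero> \<squnion> x = x"
  and meet_zero [simp]: "x \<in> C \<Longrightarrow> x \<sqinter> \<zero> = \<zero>" "x \<in> C \<Longrightarrow> \<zero> \<sqinter> x = \<zero>"
  by (simp_all add: eq_iff max_absorb1 max_absorb2 min_absorb1 min_absorb2)

lemma below_alg:
  assumes "x \<in> C" "a \<in> C" "x \<lless> a"
  shows "x \<squnion> a = a" "a \<squnion> x = a" "x \<sqinter> a = x" "a \<sqinter> x = x" "a \<ominus> x = a" "x \<ominus> a = \<zero>"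
proof -
  have *: "val I x < val I a \<or> val I a = base \<and> val I x = base" for I
    using assms by (simp add: below_iff)
  have "val I (x \<squnion> a) = val I a \<and> val I (a \<squnion> x) = val I a \<and> val I (x \<sqinter> a) = val I x \<and>
     val I (a \<sqinter> x) = val I x \<and> val I (a \<ominus> x) = val I a \<and> val I (x \<ominus> a) = base" for I
    using *[of I] assms by (auto simp: max_def min_def cdiff_def)
  then show "x \<squnion> a = a" "a \<squnion> x = a" "x \<sqinter> a = x" "a \<sqinter> x = x" "a \<ominus> x = a" "x \<ominus> a = \<zero>"
    using assms by (simp_all add: eq_iff)
qed

text \<open>The two difference equations force each of \<open>a1\<close> and \<open>a2\<close> to
  be, at every prime ideal, either \<open>a\<close> or zero, and not both zero unless
  \<open>a\<close> is. So a part of something far below \<open>a\<close> is far below the piece that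
  contains it.\<close>

lemma split_below:
  assumes C: "a \<in> C" "a1 \<in> C" "a2 \<in> C" "b1 \<in> C" "b2 \<in> C"
    and "a \<ominus> a2 = a1" "a \<ominus> a1 = a2" "b1 \<squnion> b2 \<lless> a" "b1 \<sqsubseteq> a1" "b2 \<sqsubseteq> a2"
  shows "a1 \<squnion> a2 = a" "b1 \<lless> a1" "b2 \<lless> a2"
proof -
  have *: "cdiff (val I a) (val I a2) = val I a1" "cdiff (val I a) (val I a1) = val I a2"
    "max (val I b1) (val I b2) < val I a \<or> val I a = base \<and> max (val I b1) (val I b2) = base"
    "val I b1 \<le> val I a1" "val I b2 \<le> val I a2"
    "base \<le> val I b1" "base \<le> val I b2" for I
    using assms by (simp_all add: pointwise)
  have "max (val I a1) (val I a2) = val I a"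
    "val I b1 < val I a1 \<or> val I a1 = base \<and> val I b1 = base"
    "val I b2 < val I a2 \<or> val I a2 = base \<and> val I b2 = base" for I
    using *[of I] by (auto simp: cdiff_def max_def split: if_splits)
  then show "a1 \<squnion> a2 = a" "b1 \<lless> a1" "b2 \<lless> a2"
    using C by (simp_all add: pointwise)
qed

end

section \<open>Consequences of D6 and S6\<close>

locale v6_dense = v6 +
  assumes dense_model: "is_model A (V6 \<union> {D6, S6})"
begin

lemma sat_axioms: "sat A (\<lambda>_. \<zero>) D6" "sat A (\<lambda>_. \<zero>) S6"
proof -
  have "range (\<lambda>_ :: nat. \<zero>) \<subseteq> C"
    by auto
  then show "sat A (\<lambda>_. \<zero>) D6" "sat A (\<lambda>_. \<zero>) S6"
    using dense_model unfolding is_model_def by blast+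
qed

lemma density:
  assumes "a \<in> C" "c \<in> C" "c \<lless> a" "a \<noteq> \<zero>"
  obtains b where "b \<in> C" "b \<noteq> \<zero>" "c \<lless> b" "b \<lless> a"
  using sat_axioms(1)[unfolded sat_D6_iff, rule_format, of a c] assms by auto

lemma splitting:
  assumes C: "a \<in> C" "b1 \<in> C" "b2 \<in> C" and b: "b1 \<squnion> b2 \<lless> a" "a \<noteq> \<zero>" "b1 \<sqinter> b2 = \<zero>"
  obtains a1 a2 where "a1 \<in> C" "a2 \<in> C" "a1 \<noteq> \<zero>" "a2 \<noteq> \<zero>" "a1 \<squnion> a2 = a" "a1 \<sqinter> a2 = \<zero>"
    "b1 \<lless> a1" "b2 \<lless> a2"
proof -
  obtain a1 a2 where a: "a1 \<in> C" "a2 \<in> C" "a1 \<noteq> \<zero>" "a2 \<noteq> \<zero>" "a1 \<sqinter> a2 = b1 \<sqinter> b2"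
    and *: "a \<ominus> a2 = a1" "a \<ominus> a1 = a2" "b1 \<sqsubseteq> a1" "b2 \<sqsubseteq> a2"
    using sat_axioms(2)[unfolded sat_S6_iff, rule_format, OF C] b by auto
  show thesis
    using that[OF a(1-4)] a(5) b(3) split_below[OF C(1) a(1,2) C(2,3) *(1,2) b(1) *(3,4)] by simp
qed

text \<open>\<open>P1\<close> and \<open>P2\<close> prescribe which pieces are to be nonzero, as the
  split on the other side dictates. If both are, S6 provides them; otherwise the whole of
  \<open>b\<close> goes to one side.\<close>

lemma realize_split:
  assumes C: "b \<in> C" "d1 \<in> C" "d2 \<in> C" and d: "d1 \<squnion> d2 \<lless> b" "d1 \<sqinter> d2 = \<zero>"
    and P: "b = \<zero> \<longleftrightarrow> \<not> P1 \<and> \<not> P2" "\<not> P1 \<Longrightarrow> d1 = \<zero>" "\<not> P2 \<Longrightarrow> d2 = \<zero>"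
  obtains b1 b2 where "b1 \<in> C" "b2 \<in> C" "b1 \<squnion> b2 = b" "b1 \<sqinter> b2 = \<zero>" "d1 \<lless> b1" "d2 \<lless> b2"
    "b1 = \<zero> \<longleftrightarrow> \<not> P1" "b2 = \<zero> \<longleftrightarrow> \<not> P2"
proof -
  consider "P1" "P2" | "P1" "\<not> P2" | "\<not> P1"
    by blast
  then show thesis
  proof cases
    case 1
    then have "b \<noteq> \<zero>"
      using P by simp
    with splitting[OF C d(1) _ d(2)] show thesis
      using that 1 by metis
  next
    case 2
    then show thesis
      using that[of b \<zero>] P d C by simp
  next
    case 3
    then show thesis
      using that[of \<zero> b] P d C by simp
  qed
qed

text \<open>D6 can only place an element over \<open>d1 \<squnion> d2\<close> as a whole. This
  element is split by S6 over \<open>d1\<close> and \<open>d2\<close>; \<open>r\<close> is the piece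
  over \<open>d1\<close>, and the other piece is dropped, so that \<open>d2\<close> stays beside
  \<open>r\<close>.\<close>

lemma realize_insert:
  assumes C: "b \<in> C" "d1 \<in> C" "d2 \<in> C" and d: "d1 \<squnion> d2 \<lless> b" "d1 \<sqinter> d2 = \<zero>"
    and P: "b = \<zero> \<Longrightarrow> \<not> P" "\<not> P \<Longrightarrow> d1 = \<zero>"
  obtains r where "r \<in> C" "d1 \<lless> r" "r \<squnion> d2 \<lless> b" "r \<sqinter> d2 = \<zero>" "r = \<zero> \<longleftrightarrow> \<not> P"
proof (cases P)
  case True
  then obtain e where e: "e \<in> C" "e \<noteq> \<zero>" "d1 \<squnion> d2 \<lless> e" "e \<lless> b"
    using density[of b "d1 \<squnion> d2"] C d P by auto
  then obtain r r' where r: "r \<in> C" "r' \<in> C" "r \<noteq> \<zero>" "r \<squnion> r' = e" "r \<sqinter> r' = \<zero>" "d1 \<lless> r" "d2 \<lless> r'"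
    using splitting[of e d1 d2] C d by metis
  have "d2 \<sqsubseteq> r'"
    using r(2,7) C(3) by (simp add: below_imp_le)
  then have "r \<squnion> d2 \<sqsubseteq> e"
    using r(1,2) C unfolding r(4)[symmetric] by (auto intro: le_join_rules)
  then have "r \<squnion> d2 \<lless> b"
    using below_mono[of "r \<squnion> d2" e b] r(1) C e by simp
  moreover have "r \<sqinter> d2 = \<zero>"
    using meet_zero_mono[of r d2 r r'] r C by (simp add: le_refl below_imp_le)
  ultimately show thesis
    using that r True by blast
next
  case False
  then show thesis
    using that[of \<zero>] P C d by simp
qed

end

section \<open>Isomorphisms between finite forests\<close>

definition dsum :: "'a struct \<Rightarrow> 'b struct \<Rightarrow> ('a \<times> 'b) set \<Rightarrow> ('a \<times> 'b) set \<Rightarrow> ('a \<times> 'b) set" where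
  "dsum A B R R' = {(join_of A x x', join_of B y y') |x y x' y'. (x, y) \<in> R \<and> (x', y') \<in> R'}"

text \<open>
  A pair of isomorphic finite forests, given by the relation \<open>R\<close> between the joins of nodes of the two
  and by the joins of their roots. The rule \<open>node\<close> puts a new root on top of the first forest and the
  second forest beside it.
\<close>

inductive sys :: "'a struct \<Rightarrow> 'b struct \<Rightarrow> ('a \<times> 'b) set \<Rightarrow> 'a \<Rightarrow> 'b \<Rightarrow> bool" for A B where
  empty: "sys A B {(\<zero>\<^bsub>A\<^esub>, \<zero>\<^bsub>B\<^esub>)} \<zero>\<^bsub>A\<^esub> \<zero>\<^bsub>B\<^esub>"
| node: "sys A B R c d \<Longrightarrow> sys A B R' a' b' \<Longrightarrow> a \<in> carrier A \<Longrightarrow> b \<in> carrier B \<Longrightarrow>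
    a = \<zero>\<^bsub>A\<^esub> \<longleftrightarrow> b = \<zero>\<^bsub>B\<^esub> \<Longrightarrow> c \<lless>\<^bsub>A\<^esub> a \<Longrightarrow> d \<lless>\<^bsub>B\<^esub> b \<Longrightarrow>
    a \<sqinter>\<^bsub>A\<^esub> a' = \<zero>\<^bsub>A\<^esub> \<Longrightarrow> b \<sqinter>\<^bsub>B\<^esub> b' = \<zero>\<^bsub>B\<^esub> \<Longrightarrow>
    sys A B (dsum A B (insert (a, b) R) R') (a \<squnion>\<^bsub>A\<^esub> a') (b \<squnion>\<^bsub>B\<^esub> b')"

lemma dsumI: "(x, y) \<in> R \<Longrightarrow> (x', y') \<in> R' \<Longrightarrow> (join_of A x x', join_of B y y') \<in> dsum A B R R'"
  by (auto simp: dsum_def)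

lemma dsumE:
  assumes "p \<in> dsum A B R R'"
  obtains x y x' y' where "p = (join_of A x x', join_of B y y')" "(x, y) \<in> R" "(x', y') \<in> R'"
  using assms by (auto simp: dsum_def)

lemma sys_converse: "sys A B R a b \<Longrightarrow> sys B A (R\<inverse>) b a"
proof (induction rule: sys.induct)
  case empty
  have "{(\<zero>\<^bsub>A\<^esub>, \<zero>\<^bsub>B\<^esub>)}\<inverse> = {(\<zero>\<^bsub>B\<^esub>, \<zero>\<^bsub>A\<^esub>)}"
    by auto
  then show ?case
    using sys.empty[of B A] by simp
next
  case (node R c d R' a' b' a b)
  have "(dsum A B (insert (a, b) R) R')\<inverse> = dsum B A (insert (b, a) (R\<inverse>)) (R'\<inverse>)"
    unfolding dsum_def by blast
  then show ?case
    using sys.node[OF node.IH] node.hyps by simp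
qed

definition partial_iso :: "'a struct \<Rightarrow> 'b struct \<Rightarrow> ('a \<times> 'b) set \<Rightarrow> bool" where
  "partial_iso A B R \<longleftrightarrow> (\<forall>(x, y)\<in>R. \<forall>(x', y')\<in>R.
     (x \<squnion>\<^bsub>A\<^esub> x', y \<squnion>\<^bsub>B\<^esub> y') \<in> R \<and> (x \<sqinter>\<^bsub>A\<^esub> x', y \<sqinter>\<^bsub>B\<^esub> y') \<in> R \<and> (x \<ominus>\<^bsub>A\<^esub> x', y \<ominus>\<^bsub>B\<^esub> y') \<in> R \<and>
     (x = x' \<longleftrightarrow> y = y'))"

definition bounded_by :: "'a struct \<Rightarrow> 'b struct \<Rightarrow> ('a \<times> 'b) set \<Rightarrow> 'a \<Rightarrow> 'b \<Rightarrow> bool" where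
  "bounded_by A B R a b \<longleftrightarrow> (a, b) \<in> R \<and> (\<zero>\<^bsub>A\<^esub>, \<zero>\<^bsub>B\<^esub>) \<in> R \<and>
     (\<forall>(x, y)\<in>R. x \<in> carrier A \<and> y \<in> carrier B \<and> x \<sqsubseteq>\<^bsub>A\<^esub> a \<and> y \<sqsubseteq>\<^bsub>B\<^esub> b)"

locale v6_pair = A: v6 A + B: v6 B for A :: "'a struct" and B :: "'b struct"
begin

lemma partial_isoD:
  assumes "partial_iso A B R" "(x, y) \<in> R" "(x', y') \<in> R"
  shows "(x \<squnion>\<^bsub>A\<^esub> x', y \<squnion>\<^bsub>B\<^esub> y') \<in> R" "(x \<sqinter>\<^bsub>A\<^esub> x', y \<sqinter>\<^bsub>B\<^esub> y') \<in> R" "(x \<ominus>\<^bsub>A\<^esub> x', y \<ominus>\<^bsub>B\<^esub> y') \<in> R"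
    "x = x' \<longleftrightarrow> y = y'"
  using assms unfolding partial_iso_def by fast+

lemma boundedD:
  assumes "bounded_by A B R a b"
  shows "(a, b) \<in> R" "(\<zero>\<^bsub>A\<^esub>, \<zero>\<^bsub>B\<^esub>) \<in> R"
    "(x, y) \<in> R \<Longrightarrow> x \<in> carrier A" "(x, y) \<in> R \<Longrightarrow> y \<in> carrier B"
    "(x, y) \<in> R \<Longrightarrow> x \<sqsubseteq>\<^bsub>A\<^esub> a" "(x, y) \<in> R \<Longrightarrow> y \<sqsubseteq>\<^bsub>B\<^esub> b"
  using assms unfolding bounded_by_def by auto

text \<open>Below the disjoint tops \<open>a\<close> and \<open>a'\<close> the operations act
  componentwise, so \<open>dsum\<close> forms the product of the two algebras, and likewise on the
  other side.\<close>

lemma dsum_iso: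
  assumes R: "partial_iso A B R" "bounded_by A B R a b" and R': "partial_iso A B R'" "bounded_by A B R' a' b'"
    and ab: "a \<sqinter>\<^bsub>A\<^esub> a' = \<zero>\<^bsub>A\<^esub>" "b \<sqinter>\<^bsub>B\<^esub> b' = \<zero>\<^bsub>B\<^esub>"
  shows "partial_iso A B (dsum A B R R')" "bounded_by A B (dsum A B R R') (a \<squnion>\<^bsub>A\<^esub> a') (b \<squnion>\<^bsub>B\<^esub> b')"
proof -
  note w = boundedD[OF R(2)] and w' = boundedD[OF R'(2)]
  have "(x \<squnion>\<^bsub>A\<^esub> x' \<squnion>\<^bsub>A\<^esub> (z \<squnion>\<^bsub>A\<^esub> z'), y \<squnion>\<^bsub>B\<^esub> y' \<squnion>\<^bsub>B\<^esub> (w \<squnion>\<^bsub>B\<^esub> w')) \<in> dsum A B R R' \<and>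
      ((x \<squnion>\<^bsub>A\<^esub> x') \<sqinter>\<^bsub>A\<^esub> (z \<squnion>\<^bsub>A\<^esub> z'), (y \<squnion>\<^bsub>B\<^esub> y') \<sqinter>\<^bsub>B\<^esub> (w \<squnion>\<^bsub>B\<^esub> w')) \<in> dsum A B R R' \<and>
      ((x \<squnion>\<^bsub>A\<^esub> x') \<ominus>\<^bsub>A\<^esub> (z \<squnion>\<^bsub>A\<^esub> z'), (y \<squnion>\<^bsub>B\<^esub> y') \<ominus>\<^bsub>B\<^esub> (w \<squnion>\<^bsub>B\<^esub> w')) \<in> dsum A B R R' \<and>
      (x \<squnion>\<^bsub>A\<^esub> x' = z \<squnion>\<^bsub>A\<^esub> z' \<longleftrightarrow> y \<squnion>\<^bsub>B\<^esub> y' = w \<squnion>\<^bsub>B\<^esub> w')"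
    if xy: "(x, y) \<in> R" "(x', y') \<in> R'" "(z, w) \<in> R" "(z', w') \<in> R'" for x y x' y' z w z' w'
  proof -
    note c = w(3,4)[OF xy(1)] w(3,4)[OF xy(3)] w'(3,4)[OF xy(2)] w'(3,4)[OF xy(4)]
      w(3,4)[OF w(1)] w'(3,4)[OF w'(1)]
    note l = w(5,6)[OF xy(1)] w(5,6)[OF xy(3)] w'(5,6)[OF xy(2)] w'(5,6)[OF xy(4)]
    note p = partial_isoD[OF R(1) xy(1) xy(3)] and p' = partial_isoD[OF R'(1) xy(2) xy(4)]
    have "x \<squnion>\<^bsub>A\<^esub> x' \<squnion>\<^bsub>A\<^esub> (z \<squnion>\<^bsub>A\<^esub> z') = x \<squnion>\<^bsub>A\<^esub> z \<squnion>\<^bsub>A\<^esub> (x' \<squnion>\<^bsub>A\<^esub> z')"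
      using c by (intro A.val_eqI) (simp_all add: max.assoc max.left_commute)
    moreover have "y \<squnion>\<^bsub>B\<^esub> y' \<squnion>\<^bsub>B\<^esub> (w \<squnion>\<^bsub>B\<^esub> w') = y \<squnion>\<^bsub>B\<^esub> w \<squnion>\<^bsub>B\<^esub> (y' \<squnion>\<^bsub>B\<^esub> w')"
      using c by (intro B.val_eqI) (simp_all add: max.assoc max.left_commute)
    moreover note A.disjoint_meet[OF _ _ _ _ _ _ l(1,3,5,7) ab(1)] B.disjoint_meet[OF _ _ _ _ _ _ l(2,4,6,8) ab(2)]
      A.disjoint_diff[OF _ _ _ _ _ _ l(1,3,5,7) ab(1)] B.disjoint_diff[OF _ _ _ _ _ _ l(2,4,6,8) ab(2)]
      A.disjoint_eq[OF _ _ _ _ _ _ l(1,3,5,7) ab(1)] B.disjoint_eq[OF _ _ _ _ _ _ l(2,4,6,8) ab(2)]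
    ultimately show ?thesis
      using c p(4) p'(4) dsumI[OF p(1) p'(1), of A B] dsumI[OF p(2) p'(2), of A B]
        dsumI[OF p(3) p'(3), of A B] by simp
  qed
  then show "partial_iso A B (dsum A B R R')"
    unfolding partial_iso_def by (auto elim!: dsumE)
  show "bounded_by A B (dsum A B R R') (a \<squnion>\<^bsub>A\<^esub> a') (b \<squnion>\<^bsub>B\<^esub> b')"
    unfolding bounded_by_def
  proof (intro conjI)
    show "(a \<squnion>\<^bsub>A\<^esub> a', b \<squnion>\<^bsub>B\<^esub> b') \<in> dsum A B R R'"
      by (intro dsumI w w')
    show "(\<zero>\<^bsub>A\<^esub>, \<zero>\<^bsub>B\<^esub>) \<in> dsum A B R R'"
      using dsumI[OF w(2) w'(2), of A B] by simp
    show "\<forall>(x, y)\<in>dsum A B R R'.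
       x \<in> carrier A \<and> y \<in> carrier B \<and> x \<sqsubseteq>\<^bsub>A\<^esub> (a \<squnion>\<^bsub>A\<^esub> a') \<and> y \<sqsubseteq>\<^bsub>B\<^esub> (b \<squnion>\<^bsub>B\<^esub> b')"
      using w w' by (auto elim!: dsumE intro!: A.join_mono B.join_mono)
  qed
qed

text \<open>With a top far above everything else, each operation yields one of its arguments or
  zero. The top can coincide with an old element only if it is zero; agreement about this on both
  sides keeps the correspondence one-to-one.\<close>

lemma insert_iso:
  assumes R: "partial_iso A B R" "bounded_by A B R c d"
    and ab: "a \<in> carrier A" "b \<in> carrier B" "a = \<zero>\<^bsub>A\<^esub> \<longleftrightarrow> b = \<zero>\<^bsub>B\<^esub>" "c \<lless>\<^bsub>A\<^esub> a" "d \<lless>\<^bsub>B\<^esub> b"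
  shows "partial_iso A B (insert (a, b) R)" "bounded_by A B (insert (a, b) R) a b"
proof -
  note w = boundedD[OF R(2)]
  have le: "x \<sqsubseteq>\<^bsub>A\<^esub> a" "y \<sqsubseteq>\<^bsub>B\<^esub> b" "x \<lless>\<^bsub>A\<^esub> a" "y \<lless>\<^bsub>B\<^esub> b" if "(x, y) \<in> R" for x y
  proof -
    show *: "x \<lless>\<^bsub>A\<^esub> a" "y \<lless>\<^bsub>B\<^esub> b"
      using A.below_mono[of x c a] B.below_mono[of y d b] that w ab by auto
    then show "x \<sqsubseteq>\<^bsub>A\<^esub> a" "y \<sqsubseteq>\<^bsub>B\<^esub> b"
      by (simp_all add: below_in_def)
  qed
  show "bounded_by A B (insert (a, b) R) a b"
    using w ab le(1,2) unfolding bounded_by_def by (auto simp: A.le_refl B.le_refl)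
  have below: "x \<squnion>\<^bsub>A\<^esub> a = a \<and> a \<squnion>\<^bsub>A\<^esub> x = a \<and> x \<sqinter>\<^bsub>A\<^esub> a = x \<and> a \<sqinter>\<^bsub>A\<^esub> x = x \<and> a \<ominus>\<^bsub>A\<^esub> x = a \<and>
      x \<ominus>\<^bsub>A\<^esub> a = \<zero>\<^bsub>A\<^esub> \<and> y \<squnion>\<^bsub>B\<^esub> b = b \<and> b \<squnion>\<^bsub>B\<^esub> y = b \<and> y \<sqinter>\<^bsub>B\<^esub> b = y \<and> b \<sqinter>\<^bsub>B\<^esub> y = y \<and>
      b \<ominus>\<^bsub>B\<^esub> y = b \<and> y \<ominus>\<^bsub>B\<^esub> b = \<zero>\<^bsub>B\<^esub> \<and> (x = a \<longleftrightarrow> y = b)" if xy: "(x, y) \<in> R" for x y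
  proof -
    have "x = \<zero>\<^bsub>A\<^esub> \<longleftrightarrow> y = \<zero>\<^bsub>B\<^esub>"
      using partial_isoD(4)[OF R(1) xy w(2)] .
    moreover have "a = \<zero>\<^bsub>A\<^esub>" if "x = a"
      using A.eq_zero_if_below_self[OF ab(1) ab(1)] le(3)[OF xy] A.le_refl[OF ab(1)] that by simp
    moreover have "b = \<zero>\<^bsub>B\<^esub>" if "y = b"
      using B.eq_zero_if_below_self[OF ab(2) ab(2)] le(4)[OF xy] B.le_refl[OF ab(2)] that by simp
    ultimately have "x = a \<longleftrightarrow> y = b"
      using ab(3) by metis
    then show ?thesis
      using le[OF xy] w(3,4)[OF xy] ab(1,2) A.below_alg[of x a] B.below_alg[of y b] by simp
  qed
  have self: "a \<squnion>\<^bsub>A\<^esub> a = a" "a \<sqinter>\<^bsub>A\<^esub> a = a" "a \<ominus>\<^bsub>A\<^esub> a = \<zero>\<^bsub>A\<^esub>"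
    "b \<squnion>\<^bsub>B\<^esub> b = b" "b \<sqinter>\<^bsub>B\<^esub> b = b" "b \<ominus>\<^bsub>B\<^esub> b = \<zero>\<^bsub>B\<^esub>"
    using ab by (simp_all add: A.eq_iff B.eq_iff cdiff_def)
  show "partial_iso A B (insert (a, b) R)"
    unfolding partial_iso_def
  proof (intro ballI, clarify)
    fix x y x' y'
    assume "(x, y) \<in> insert (a, b) R" "(x', y') \<in> insert (a, b) R"
    then consider "(x, y) \<in> R" "(x', y') \<in> R" | "x = a" "y = b" "(x', y') \<in> R"
      | "(x, y) \<in> R" "x' = a" "y' = b" | "x = a" "y = b" "x' = a" "y' = b"
      by blast
    then show "(x \<squnion>\<^bsub>A\<^esub> x', y \<squnion>\<^bsub>B\<^esub> y') \<in> insert (a, b) R \<and> (x \<sqinter>\<^bsub>A\<^esub> x', y \<sqinter>\<^bsub>B\<^esub> y') \<in> insert (a, b) R \<and>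
        (x \<ominus>\<^bsub>A\<^esub> x', y \<ominus>\<^bsub>B\<^esub> y') \<in> insert (a, b) R \<and> (x = x' \<longleftrightarrow> y = y')"
    proof cases
      case 1
      then show ?thesis
        using partial_isoD[OF R(1)] by auto
    next
      case 2
      then show ?thesis
        using below[of x' y'] by auto
    next
      case 3
      then show ?thesis
        using below[of x y] w(2) by auto
    next
      case 4
      then show ?thesis
        using self w(2) by auto
    qed
  qed
qed

lemma sys_iso: "sys A B R a b \<Longrightarrow> partial_iso A B R \<and> bounded_by A B R a b"
proof (induction rule: sys.induct)
  case empty
  then show ?case
    by (simp add: partial_iso_def bounded_by_def A.le_refl B.le_refl) (simp add: A.eq_iff B.eq_iff cdiff_def)
next
  case (node R c d R' a' b' a b)
  then show ?case
    using dsum_iso insert_iso by metis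
qed

end

section \<open>Extending an isomorphism of forests\<close>

context v6
begin

lemma eq_zero_if_below_zero: "x \<in> C \<Longrightarrow> y \<in> C \<Longrightarrow> x \<lless> y \<Longrightarrow> y = \<zero> \<Longrightarrow> x = \<zero>"
  by (simp add: pointwise)

lemma join_eq_zero: "x \<in> C \<Longrightarrow> y \<in> C \<Longrightarrow> x \<squnion> y = \<zero> \<longleftrightarrow> x = \<zero> \<and> y = \<zero>"
  by (metis join_le le_zero le_refl closed(1,3))

lemma join_swap:
  "x \<in> C \<Longrightarrow> y \<in> C \<Longrightarrow> z \<in> C \<Longrightarrow> w \<in> C \<Longrightarrow> x \<squnion> y \<squnion> (z \<squnion> w) = x \<squnion> z \<squnion> (y \<squnion> w)"
  by (intro val_eqI) (simp_all add: max.assoc max.left_commute)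

end

text \<open>Only the side on which nodes are copied satisfies D6 and S6. So \<open>A\<close> can be
  any algebra of the variety when its finite subsets are to be covered by a forest, and the locale
  is used in both directions for two dense models.\<close>

locale v6_extension = v6_pair A B + B: v6_dense B for A :: "'a struct" and B :: "'b struct"
begin

text \<open>Each root is cut into its parts in \<open>u\<close> and \<open>v\<close>, with the
  correspondingly cut children beneath them, and S6 supplies matching pieces in \<open>B\<close>.
  The inclusion records that no pair related before is lost.\<close>

lemma sys_split:
  "sys A B R a b \<Longrightarrow> u \<in> carrier A \<Longrightarrow> v \<in> carrier A \<Longrightarrow> u \<squnion>\<^bsub>A\<^esub> v = a \<Longrightarrow> u \<sqinter>\<^bsub>A\<^esub> v = \<zero>\<^bsub>A\<^esub> \<Longrightarrow>
    \<exists>R1 b1 R2 b2. sys A B R1 u b1 \<and> sys A B R2 v b2 \<and>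
      b1 \<squnion>\<^bsub>B\<^esub> b2 = b \<and> b1 \<sqinter>\<^bsub>B\<^esub> b2 = \<zero>\<^bsub>B\<^esub> \<and> R \<subseteq> dsum A B R1 R2"
proof (induction arbitrary: u v rule: sys.induct)
  case empty
  have "u \<sqsubseteq>\<^bsub>A\<^esub> \<zero>\<^bsub>A\<^esub>" "v \<sqsubseteq>\<^bsub>A\<^esub> \<zero>\<^bsub>A\<^esub>"
    using A.le_join1[OF empty(1,2)] A.le_join2[OF empty(1,2)] empty(3) by simp_all
  then have "u = \<zero>\<^bsub>A\<^esub>" "v = \<zero>\<^bsub>A\<^esub>"
    using empty(1,2) by (simp_all add: A.le_zero)
  then show ?case
    using sys.empty[of A B] dsumI[of "\<zero>\<^bsub>A\<^esub>" "\<zero>\<^bsub>B\<^esub>" "{(\<zero>\<^bsub>A\<^esub>, \<zero>\<^bsub>B\<^esub>)}" "\<zero>\<^bsub>A\<^esub>" "\<zero>\<^bsub>B\<^esub>" "{(\<zero>\<^bsub>A\<^esub>, \<zero>\<^bsub>B\<^esub>)}" A B]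
    by (intro exI[of _ "{(\<zero>\<^bsub>A\<^esub>, \<zero>\<^bsub>B\<^esub>)}"] exI[of _ "\<zero>\<^bsub>B\<^esub>"]) simp
next
  case (node R c d R' a' b' a b)
  note R = sys_iso[OF node.hyps(1)] and R' = sys_iso[OF node.hyps(2)]
  note c = boundedD(3,4)[OF conjunct2[OF R] boundedD(1)[OF conjunct2[OF R]]]
  note a' = boundedD(3,4)[OF conjunct2[OF R'] boundedD(1)[OF conjunct2[OF R']]]
  note a = node.hyps(3,4)
  note uv = node.prems(1,2)
  note alg = A.split_alg[OF a(1) a'(1) uv c(1) node.prems(3,4) node.hyps(8,6)]
  obtain R1 d1 R2 d2 where R12: "sys A B R1 (u \<sqinter>\<^bsub>A\<^esub> c) d1" "sys A B R2 (v \<sqinter>\<^bsub>A\<^esub> c) d2"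
      "d1 \<squnion>\<^bsub>B\<^esub> d2 = d" "d1 \<sqinter>\<^bsub>B\<^esub> d2 = \<zero>\<^bsub>B\<^esub>" "R \<subseteq> dsum A B R1 R2"
    using node.IH(1)[OF _ _ alg(1,2)] uv c by blast
  obtain R1' b1' R2' b2' where R12': "sys A B R1' (u \<sqinter>\<^bsub>A\<^esub> a') b1'" "sys A B R2' (v \<sqinter>\<^bsub>A\<^esub> a') b2'"
      "b1' \<squnion>\<^bsub>B\<^esub> b2' = b'" "b1' \<sqinter>\<^bsub>B\<^esub> b2' = \<zero>\<^bsub>B\<^esub>" "R' \<subseteq> dsum A B R1' R2'"
    using node.IH(2)[OF _ _ alg(3,4)] uv a' by blast
  note iso = sys_iso[OF R12(1)] sys_iso[OF R12(2)] sys_iso[OF R12'(1)] sys_iso[OF R12'(2)]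
  have d: "d1 \<in> carrier B" "d2 \<in> carrier B" "b1' \<in> carrier B" "b2' \<in> carrier B"
    using iso boundedD(1,4) by blast+
  \<comment> \<open>A zero part of the root leaves no room for children: its share of
    \<open>c\<close> is zero, and so is the partner of that share.\<close>
  have "u \<sqinter>\<^bsub>A\<^esub> a = \<zero>\<^bsub>A\<^esub> \<Longrightarrow> d1 = \<zero>\<^bsub>B\<^esub>"
    using A.eq_zero_if_below_zero[OF _ _ alg(6)] uv a c
      partial_isoD(4)[OF _ boundedD(1) boundedD(2)] iso(1) by (metis A.closed(4))
  moreover have "v \<sqinter>\<^bsub>A\<^esub> a = \<zero>\<^bsub>A\<^esub> \<Longrightarrow> d2 = \<zero>\<^bsub>B\<^esub>"
    using A.eq_zero_if_below_zero[OF _ _ alg(7)] uv a c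
      partial_isoD(4)[OF _ boundedD(1) boundedD(2)] iso(2) by (metis A.closed(4))
  moreover have "b = \<zero>\<^bsub>B\<^esub> \<longleftrightarrow> \<not> u \<sqinter>\<^bsub>A\<^esub> a \<noteq> \<zero>\<^bsub>A\<^esub> \<and> \<not> v \<sqinter>\<^bsub>A\<^esub> a \<noteq> \<zero>\<^bsub>A\<^esub>"
    using A.join_eq_zero[of "u \<sqinter>\<^bsub>A\<^esub> a" "v \<sqinter>\<^bsub>A\<^esub> a"] alg(5) node.hyps(5) uv a by simp
  ultimately obtain b1 b2 where b: "b1 \<in> carrier B" "b2 \<in> carrier B" "b1 \<squnion>\<^bsub>B\<^esub> b2 = b" "b1 \<sqinter>\<^bsub>B\<^esub> b2 = \<zero>\<^bsub>B\<^esub>"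
      "d1 \<lless>\<^bsub>B\<^esub> b1" "d2 \<lless>\<^bsub>B\<^esub> b2" "b1 = \<zero>\<^bsub>B\<^esub> \<longleftrightarrow> \<not> u \<sqinter>\<^bsub>A\<^esub> a \<noteq> \<zero>\<^bsub>A\<^esub>" "b2 = \<zero>\<^bsub>B\<^esub> \<longleftrightarrow> \<not> v \<sqinter>\<^bsub>A\<^esub> a \<noteq> \<zero>\<^bsub>A\<^esub>"
    using B.realize_split[OF a(2) d(1,2), of "u \<sqinter>\<^bsub>A\<^esub> a \<noteq> \<zero>\<^bsub>A\<^esub>" "v \<sqinter>\<^bsub>A\<^esub> a \<noteq> \<zero>\<^bsub>A\<^esub>"] R12(3,4) node.hyps(7)
    by blast
  have le: "b1 \<sqsubseteq>\<^bsub>B\<^esub> b" "b2 \<sqsubseteq>\<^bsub>B\<^esub> b" "b1' \<sqsubseteq>\<^bsub>B\<^esub> b'" "b2' \<sqsubseteq>\<^bsub>B\<^esub> b'"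
    using b(1-3) d(3,4) R12'(3) B.le_join1 B.le_join2 by blast+
  have dis: "b1 \<sqinter>\<^bsub>B\<^esub> b1' = \<zero>\<^bsub>B\<^esub>" "b2 \<sqinter>\<^bsub>B\<^esub> b2' = \<zero>\<^bsub>B\<^esub>"
    using B.meet_zero_mono[OF _ _ a(2) a'(2) _ _ node.hyps(9)] b(1,2) d le by blast+
  let ?R1 = "dsum A B (insert (u \<sqinter>\<^bsub>A\<^esub> a, b1) R1) R1'"
  let ?R2 = "dsum A B (insert (v \<sqinter>\<^bsub>A\<^esub> a, b2) R2) R2'"
  have 1: "sys A B ?R1 u (b1 \<squnion>\<^bsub>B\<^esub> b1')"
    using sys.node[OF R12(1) R12'(1) _ b(1) _ alg(6) b(5) alg(8) dis(1)] uv a b(7) alg(10) by simp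
  have 2: "sys A B ?R2 v (b2 \<squnion>\<^bsub>B\<^esub> b2')"
    using sys.node[OF R12(2) R12'(2) _ b(2) _ alg(7) b(6) alg(9) dis(2)] uv a b(8) alg(11) by simp
  have 3: "b1 \<squnion>\<^bsub>B\<^esub> b1' \<squnion>\<^bsub>B\<^esub> (b2 \<squnion>\<^bsub>B\<^esub> b2') = b \<squnion>\<^bsub>B\<^esub> b'"
    using B.join_swap[of b1 b1' b2 b2'] b d R12'(3) by simp
  have 4: "(b1 \<squnion>\<^bsub>B\<^esub> b1') \<sqinter>\<^bsub>B\<^esub> (b2 \<squnion>\<^bsub>B\<^esub> b2') = \<zero>\<^bsub>B\<^esub>"
    using B.disjoint_meet[OF b(1) d(3) b(2) d(4) a(2) a'(2) le(1,2,3,4) node.hyps(9)] b(4) R12'(4) by simp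
  have "dsum A B (insert (a, b) R) R' \<subseteq> dsum A B ?R1 ?R2"
  proof
    fix p assume "p \<in> dsum A B (insert (a, b) R) R'"
    then obtain x y x' y' where p: "p = (x \<squnion>\<^bsub>A\<^esub> x', y \<squnion>\<^bsub>B\<^esub> y')" "(x, y) \<in> insert (a, b) R" "(x', y') \<in> R'"
      by (rule dsumE)
    obtain x1 x2 y1 y2 where x: "x = x1 \<squnion>\<^bsub>A\<^esub> x2" "y = y1 \<squnion>\<^bsub>B\<^esub> y2"
      "(x1, y1) \<in> insert (u \<sqinter>\<^bsub>A\<^esub> a, b1) R1" "(x2, y2) \<in> insert (v \<sqinter>\<^bsub>A\<^esub> a, b2) R2"
    proof (cases "(x, y) = (a, b)")
      case True
      then show ?thesis
        using that[of "u \<sqinter>\<^bsub>A\<^esub> a" "v \<sqinter>\<^bsub>A\<^esub> a" b1 b2] alg(5) b(3) by simp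
    next
      case False
      then show ?thesis
        using that p(2) R12(5) by (auto elim!: dsumE)
    qed
    obtain x1' x2' y1' y2' where x': "x' = x1' \<squnion>\<^bsub>A\<^esub> x2'" "y' = y1' \<squnion>\<^bsub>B\<^esub> y2'" "(x1', y1') \<in> R1'" "(x2', y2') \<in> R2'"
      using p(3) R12'(5) by (auto elim!: dsumE)
    have C: "x1 \<in> carrier A" "x2 \<in> carrier A" "y1 \<in> carrier B" "y2 \<in> carrier B"
        "x1' \<in> carrier A" "x2' \<in> carrier A" "y1' \<in> carrier B" "y2' \<in> carrier B"
      using x(3,4) x'(3,4) boundedD(3,4)[OF conjunct2[OF iso(1)]] boundedD(3,4)[OF conjunct2[OF iso(2)]]
        boundedD(3,4)[OF conjunct2[OF iso(3)]] boundedD(3,4)[OF conjunct2[OF iso(4)]] uv a b by auto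
    have "p = (x1 \<squnion>\<^bsub>A\<^esub> x1' \<squnion>\<^bsub>A\<^esub> (x2 \<squnion>\<^bsub>A\<^esub> x2'), y1 \<squnion>\<^bsub>B\<^esub> y1' \<squnion>\<^bsub>B\<^esub> (y2 \<squnion>\<^bsub>B\<^esub> y2'))"
      using p(1) x(1,2) x'(1,2) C A.join_swap[of x1 x1' x2 x2'] B.join_swap[of y1 y1' y2 y2'] by simp
    then show "p \<in> dsum A B ?R1 ?R2"
      using dsumI x(3,4) x'(3,4) by metis
  qed
  with 1 2 3 4 show ?case
    by blast
qed

text \<open>The parts of \<open>x\<close> below the children and below the other roots are treated
  by induction; what remains concerns the root \<open>a\<close> alone. It falls into
  \<open>a1\<close>, which is contained in \<open>x\<close>, and \<open>a2\<close>, under which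
  \<open>x2\<close> is inserted above those children that \<open>x2\<close> dominates.\<close>

lemma sys_extend:
  "sys A B R a b \<Longrightarrow> x \<in> carrier A \<Longrightarrow> x \<sqsubseteq>\<^bsub>A\<^esub> a \<Longrightarrow> \<exists>R'. sys A B R' a b \<and> R \<subseteq> R' \<and> x \<in> Domain R'"
proof (induction arbitrary: x rule: sys.induct)
  case empty
  then have "x = \<zero>\<^bsub>A\<^esub>"
    by (simp add: A.le_zero)
  then show ?case
    using sys.empty[of A B] by blast
next
  case (node R c d R' a' b' a b)
  note a = node.hyps(3,4)
  note x = node.prems(1)
  note R = sys_iso[OF node.hyps(1)] and R' = sys_iso[OF node.hyps(2)]
  note c = boundedD(3,4)[OF conjunct2[OF R] boundedD(1)[OF conjunct2[OF R]]]
  note a' = boundedD(3,4)[OF conjunct2[OF R'] boundedD(1)[OF conjunct2[OF R']]]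
  obtain Rc where Rc: "sys A B Rc c d" "R \<subseteq> Rc" "x \<sqinter>\<^bsub>A\<^esub> c \<in> Domain Rc"
    using node.IH(1)[of "x \<sqinter>\<^bsub>A\<^esub> c"] x c A.meet_le2 by blast
  obtain Ra where Ra: "sys A B Ra a' b'" "R' \<subseteq> Ra" "x \<sqinter>\<^bsub>A\<^esub> a' \<in> Domain Ra"
    using node.IH(2)[of "x \<sqinter>\<^bsub>A\<^esub> a'"] x a' A.meet_le2 by blast
  define a2 where "a2 = a \<ominus>\<^bsub>A\<^esub> ((x \<sqinter>\<^bsub>A\<^esub> a) \<ominus>\<^bsub>A\<^esub> c)"
  define a1 where "a1 = a \<ominus>\<^bsub>A\<^esub> a2"
  define x2 where "x2 = ((x \<sqinter>\<^bsub>A\<^esub> a) \<ominus>\<^bsub>A\<^esub> c) \<sqinter>\<^bsub>A\<^esub> a2"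
  have C: "a1 \<in> carrier A" "a2 \<in> carrier A" "x2 \<in> carrier A"
    using a c x unfolding a1_def a2_def x2_def by auto
  note alg = A.extend_alg[OF a(1) a'(1) x c(1) node.prems(2) node.hyps(8,6) a2_def a1_def x2_def]
  obtain R1 d1 R2 d2 where R12: "sys A B R1 (c \<sqinter>\<^bsub>A\<^esub> a1) d1" "sys A B R2 (c \<sqinter>\<^bsub>A\<^esub> a2) d2"
      "d1 \<squnion>\<^bsub>B\<^esub> d2 = d" "d1 \<sqinter>\<^bsub>B\<^esub> d2 = \<zero>\<^bsub>B\<^esub>" "Rc \<subseteq> dsum A B R1 R2"
    using sys_split[OF Rc(1) _ _ alg(1,2)] c C by blast
  \<comment> \<open>The share of the children of \<open>a2\<close> that stays beside
    \<open>x2\<close>.\<close>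
  let ?h = "(c \<sqinter>\<^bsub>A\<^esub> a2) \<ominus>\<^bsub>A\<^esub> x2"
  obtain G g H h where GH: "sys A B G (c \<sqinter>\<^bsub>A\<^esub> a2 \<sqinter>\<^bsub>A\<^esub> x2) g" "sys A B H ?h h"
      "g \<squnion>\<^bsub>B\<^esub> h = d2" "g \<sqinter>\<^bsub>B\<^esub> h = \<zero>\<^bsub>B\<^esub>" "R2 \<subseteq> dsum A B G H"
    using sys_split[OF R12(2) _ _ alg(6,7)] c C by blast
  note iso = sys_iso[OF R12(1)] sys_iso[OF R12(2)] sys_iso[OF GH(1)] sys_iso[OF GH(2)] sys_iso[OF Ra(1)]
  have d: "d1 \<in> carrier B" "d2 \<in> carrier B" "g \<in> carrier B" "h \<in> carrier B"
    using iso boundedD(1,4) by blast+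
  have "a1 = \<zero>\<^bsub>A\<^esub> \<Longrightarrow> d1 = \<zero>\<^bsub>B\<^esub>" "a2 = \<zero>\<^bsub>A\<^esub> \<Longrightarrow> d2 = \<zero>\<^bsub>B\<^esub>" and g: "x2 = \<zero>\<^bsub>A\<^esub> \<Longrightarrow> g = \<zero>\<^bsub>B\<^esub>"
    using partial_isoD(4)[OF _ boundedD(1) boundedD(2)] iso(1-3) c C
    by (metis A.meet_zero(1) A.closed(4))+
  moreover have "b = \<zero>\<^bsub>B\<^esub> \<longleftrightarrow> \<not> a1 \<noteq> \<zero>\<^bsub>A\<^esub> \<and> \<not> a2 \<noteq> \<zero>\<^bsub>A\<^esub>"
    using A.join_eq_zero[OF C(1,2)] alg(3) node.hyps(5) by simp
  ultimately obtain b1 b2 where b: "b1 \<in> carrier B" "b2 \<in> carrier B" "b1 \<squnion>\<^bsub>B\<^esub> b2 = b" "b1 \<sqinter>\<^bsub>B\<^esub> b2 = \<zero>\<^bsub>B\<^esub>"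
      "d1 \<lless>\<^bsub>B\<^esub> b1" "d2 \<lless>\<^bsub>B\<^esub> b2" "b1 = \<zero>\<^bsub>B\<^esub> \<longleftrightarrow> \<not> a1 \<noteq> \<zero>\<^bsub>A\<^esub>" "b2 = \<zero>\<^bsub>B\<^esub> \<longleftrightarrow> \<not> a2 \<noteq> \<zero>\<^bsub>A\<^esub>"
    using B.realize_split[OF a(2) d(1,2), of "a1 \<noteq> \<zero>\<^bsub>A\<^esub>" "a2 \<noteq> \<zero>\<^bsub>A\<^esub>"] R12(3,4) node.hyps(7) by blast
  have "b2 = \<zero>\<^bsub>B\<^esub> \<Longrightarrow> \<not> x2 \<noteq> \<zero>\<^bsub>A\<^esub>"
    using b(8) a c x unfolding x2_def by simp
  then obtain r where r: "r \<in> carrier B" "g \<lless>\<^bsub>B\<^esub> r" "r \<squnion>\<^bsub>B\<^esub> h \<lless>\<^bsub>B\<^esub> b2" "r \<sqinter>\<^bsub>B\<^esub> h = \<zero>\<^bsub>B\<^esub>"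
      "r = \<zero>\<^bsub>B\<^esub> \<longleftrightarrow> \<not> x2 \<noteq> \<zero>\<^bsub>A\<^esub>"
    using B.realize_insert[OF b(2) d(3,4), of "x2 \<noteq> \<zero>\<^bsub>A\<^esub>"] GH(3,4) b(6) g by blast
  have le: "b1 \<sqsubseteq>\<^bsub>B\<^esub> b" "b2 \<sqsubseteq>\<^bsub>B\<^esub> b" "b' \<sqsubseteq>\<^bsub>B\<^esub> b'"
    using b(1-3) a' B.le_join1 B.le_join2 B.le_refl by blast+
  have dis: "b1 \<sqinter>\<^bsub>B\<^esub> b' = \<zero>\<^bsub>B\<^esub>" "b2 \<sqinter>\<^bsub>B\<^esub> b' = \<zero>\<^bsub>B\<^esub>"
    using B.meet_zero_mono[OF _ _ a(2) a'(2) _ _ node.hyps(9)] b(1,2) a'(2) le by blast+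
  \<comment> \<open>The new forest from the inside out: \<open>x2\<close> over its children with the
    remaining ones beside it, all this under \<open>a2\<close> with the other roots beside it, and
    next to that \<open>a1\<close> over its own children.\<close>
  let ?R3 = "dsum A B (insert (x2, r) G) H"
  let ?R2 = "dsum A B (insert (a2, b2) ?R3) Ra"
  let ?R1 = "dsum A B (insert (a1, b1) R1) ?R2"
  have "sys A B ?R3 (x2 \<squnion>\<^bsub>A\<^esub> ?h) (r \<squnion>\<^bsub>B\<^esub> h)"
    using sys.node[OF GH(1,2) C(3) r(1) _ alg(8) r(2) alg(9) r(4)] r(5) by simp
  then have S2: "sys A B ?R2 (a2 \<squnion>\<^bsub>A\<^esub> a') (b2 \<squnion>\<^bsub>B\<^esub> b')"
    using sys.node[OF _ Ra(1) C(2) b(2) _ alg(10) r(3) alg(11) dis(2)] b(8) by simp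
  have m: "b1 \<sqinter>\<^bsub>B\<^esub> (b2 \<squnion>\<^bsub>B\<^esub> b') = \<zero>\<^bsub>B\<^esub>"
    using B.distrib[OF b(1,2) a'(2)] b(4) dis(1) by simp
  have j: "b1 \<squnion>\<^bsub>B\<^esub> (b2 \<squnion>\<^bsub>B\<^esub> b') = b \<squnion>\<^bsub>B\<^esub> b'"
    using B.join_assoc[OF b(1,2) a'(2)] b(3) by simp
  have 1: "sys A B ?R1 (a \<squnion>\<^bsub>A\<^esub> a') (b \<squnion>\<^bsub>B\<^esub> b')"
    using sys.node[OF R12(1) S2 C(1) b(1) _ alg(5) b(5) alg(12) m] b(7) unfolding alg(13) j by simp
  have 2: "dsum A B (insert (a, b) Rc) Ra \<subseteq> ?R1"
  proof
    fix p assume "p \<in> dsum A B (insert (a, b) Rc) Ra"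
    then obtain s t s' t' where p: "p = (s \<squnion>\<^bsub>A\<^esub> s', t \<squnion>\<^bsub>B\<^esub> t')" "(s, t) \<in> insert (a, b) Rc" "(s', t') \<in> Ra"
      by (rule dsumE)
    obtain s1 s2 t1 t2 where s: "s = s1 \<squnion>\<^bsub>A\<^esub> s2" "t = t1 \<squnion>\<^bsub>B\<^esub> t2"
      "(s1, t1) \<in> insert (a1, b1) R1" "(s2, t2) \<in> insert (a2, b2) ?R3"
      "s2 \<in> carrier A" "t2 \<in> carrier B"
    proof (cases "(s, t) = (a, b)")
      case True
      then show ?thesis
        using that[of a1 a2 b1 b2] alg(3) b(2,3) C by simp
    next
      case False
      then obtain s1 s2 t1 t2 where s: "s = s1 \<squnion>\<^bsub>A\<^esub> s2" "t = t1 \<squnion>\<^bsub>B\<^esub> t2" "(s1, t1) \<in> R1" "(s2, t2) \<in> R2"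
        using p(2) R12(5) by (auto elim!: dsumE)
      moreover have "(s2, t2) \<in> ?R3"
        using s(4) GH(5) unfolding dsum_def by blast
      ultimately show ?thesis
        using that[of s1 s2 t1 t2] boundedD(3,4)[OF conjunct2[OF iso(2)]] by blast
    qed
    have C': "s1 \<in> carrier A" "t1 \<in> carrier B" "s' \<in> carrier A" "t' \<in> carrier B"
      using s(3) p(3) boundedD(3,4)[OF conjunct2[OF iso(1)]] boundedD(3,4)[OF conjunct2[OF iso(5)]] C b by auto
    have "p = (s1 \<squnion>\<^bsub>A\<^esub> (s2 \<squnion>\<^bsub>A\<^esub> s'), t1 \<squnion>\<^bsub>B\<^esub> (t2 \<squnion>\<^bsub>B\<^esub> t'))"
      using p(1) s(1,2,5,6) C' A.join_assoc B.join_assoc by simp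
    then show "p \<in> ?R1"
      using dsumI[OF s(3) dsumI[OF s(4) p(3)]] by simp
  qed
  have 3: "x \<in> Domain ?R1"
  proof -
    obtain y y' where "(x \<sqinter>\<^bsub>A\<^esub> c, y) \<in> Rc" "(x \<sqinter>\<^bsub>A\<^esub> a', y') \<in> Ra"
      using Rc(3) Ra(3) by blast
    then have "((x \<sqinter>\<^bsub>A\<^esub> c) \<squnion>\<^bsub>A\<^esub> (x \<sqinter>\<^bsub>A\<^esub> a'), y \<squnion>\<^bsub>B\<^esub> y') \<in> ?R1"
      using 2 dsumI[of "x \<sqinter>\<^bsub>A\<^esub> c" y "insert (a, b) Rc"] by blast
    \<comment> \<open>The join of \<open>a1\<close> and \<open>x2\<close>, with zero as the
      contribution of the forests \<open>H\<close> and \<open>Ra\<close>.\<close>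
    moreover have "(a1 \<squnion>\<^bsub>A\<^esub> (x2 \<squnion>\<^bsub>A\<^esub> \<zero>\<^bsub>A\<^esub> \<squnion>\<^bsub>A\<^esub> \<zero>\<^bsub>A\<^esub>), b1 \<squnion>\<^bsub>B\<^esub> (r \<squnion>\<^bsub>B\<^esub> \<zero>\<^bsub>B\<^esub> \<squnion>\<^bsub>B\<^esub> \<zero>\<^bsub>B\<^esub>)) \<in> ?R1"
      using boundedD(2)[OF conjunct2[OF iso(4)]] boundedD(2)[OF conjunct2[OF iso(5)]]
      by (intro dsumI[OF insertI1 dsumI[OF insertI2[OF dsumI[OF insertI1]]]])
    ultimately have "(x \<sqinter>\<^bsub>A\<^esub> c) \<squnion>\<^bsub>A\<^esub> (x \<sqinter>\<^bsub>A\<^esub> a') \<squnion>\<^bsub>A\<^esub> (a1 \<squnion>\<^bsub>A\<^esub> (x2 \<squnion>\<^bsub>A\<^esub> \<zero>\<^bsub>A\<^esub> \<squnion>\<^bsub>A\<^esub> \<zero>\<^bsub>A\<^esub>)) \<in> Domain ?R1"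
      using partial_isoD(1)[OF conjunct1[OF sys_iso[OF 1]]] by blast
    moreover have "(x \<sqinter>\<^bsub>A\<^esub> c) \<squnion>\<^bsub>A\<^esub> (x \<sqinter>\<^bsub>A\<^esub> a') \<squnion>\<^bsub>A\<^esub> (a1 \<squnion>\<^bsub>A\<^esub> (x2 \<squnion>\<^bsub>A\<^esub> \<zero>\<^bsub>A\<^esub> \<squnion>\<^bsub>A\<^esub> \<zero>\<^bsub>A\<^esub>)) = x"
      using A.join_swap[of "x \<sqinter>\<^bsub>A\<^esub> c" "x \<sqinter>\<^bsub>A\<^esub> a'" a1 x2] A.join_comm[of "x \<sqinter>\<^bsub>A\<^esub> a'" x2]
        alg(14) C x c a' by simp
    ultimately show ?thesis by simp
  qed
  have "dsum A B (insert (a, b) R) R' \<subseteq> dsum A B (insert (a, b) Rc) Ra"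
    using Rc(2) Ra(2) unfolding dsum_def by blast
  with 1 2 3 show ?case
    by blast
qed

text \<open>The start is a forest with the single node \<one>. The hypothesis \<open>one\<close> is
  the condition that both sides of this node vanish together, which is the case of trivial
  algebras.\<close>

lemma sys_cover:
  assumes one: "\<one>\<^bsub>A\<^esub> = \<zero>\<^bsub>A\<^esub> \<longleftrightarrow> \<one>\<^bsub>B\<^esub> = \<zero>\<^bsub>B\<^esub>"
    and "finite X" "X \<subseteq> carrier A"
  shows "\<exists>R. sys A B R \<one>\<^bsub>A\<^esub> \<one>\<^bsub>B\<^esub> \<and> X \<subseteq> Domain R"
  using assms(2,3)
proof (induction X rule: finite_induct)
  case empty
  have "sys A B (dsum A B (insert (\<one>\<^bsub>A\<^esub>, \<one>\<^bsub>B\<^esub>) {(\<zero>\<^bsub>A\<^esub>, \<zero>\<^bsub>B\<^esub>)}) {(\<zero>\<^bsub>A\<^esub>, \<zero>\<^bsub>B\<^esub>)})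
      (\<one>\<^bsub>A\<^esub> \<squnion>\<^bsub>A\<^esub> \<zero>\<^bsub>A\<^esub>) (\<one>\<^bsub>B\<^esub> \<squnion>\<^bsub>B\<^esub> \<zero>\<^bsub>B\<^esub>)"
    using one by (intro sys.node[OF sys.empty sys.empty]) (simp_all add: A.zero_below B.zero_below)
  then show ?case
    by auto
next
  case (insert x X)
  then obtain R where R: "sys A B R \<one>\<^bsub>A\<^esub> \<one>\<^bsub>B\<^esub>" "X \<subseteq> Domain R"
    by auto
  then obtain R' where "sys A B R' \<one>\<^bsub>A\<^esub> \<one>\<^bsub>B\<^esub>" "R \<subseteq> R'" "x \<in> Domain R'"
    using sys_extend[OF R(1), of x] insert.prems A.le_one by blast
  with R(2) show ?case
    by blast
qed

end

section \<open>Invariance of satisfaction under isomorphisms of forests\<close>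

primrec fv_tm :: "tm \<Rightarrow> nat set" where
  "fv_tm (Var n) = {n}"
| "fv_tm Zero = {}"
| "fv_tm One = {}"
| "fv_tm (Join s t) = fv_tm s \<union> fv_tm t"
| "fv_tm (Meet s t) = fv_tm s \<union> fv_tm t"
| "fv_tm (Diff s t) = fv_tm s \<union> fv_tm t"

primrec fv :: "fm \<Rightarrow> nat set" where
  "fv (Eq s t) = fv_tm s \<union> fv_tm t"
| "fv (Neg p) = fv p"
| "fv (Conj p q) = fv p \<union> fv q"
| "fv (All n p) = fv p - {n}"

lemma finite_fv: "finite (fv p)"
proof -
  have "finite (fv_tm t)" for t
    by (induction t) auto
  then show ?thesis
    by (induction p) auto
qed

lemma (in v6_pair) tval_sys:
  assumes "sys A B R \<one>\<^bsub>A\<^esub> \<one>\<^bsub>B\<^esub>" "\<forall>n\<in>fv_tm t. (v n, w n) \<in> R"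
  shows "(tval A v t, tval B w t) \<in> R"
  using assms(2)
proof (induction t)
  case (Join s t)
  then show ?case
    using partial_isoD(1)[OF conjunct1[OF sys_iso[OF assms(1)]]] by simp
next
  case (Meet s t)
  then show ?case
    using partial_isoD(2)[OF conjunct1[OF sys_iso[OF assms(1)]]] by simp
next
  case (Diff s t)
  then show ?case
    using partial_isoD(3)[OF conjunct1[OF sys_iso[OF assms(1)]]] by simp
qed (use boundedD(1,2)[OF conjunct2[OF sys_iso[OF assms(1)]]] in auto)

text \<open>The correspondence has to cover the values of the free variables only. At a quantifier
  it is extended by the new element; an element of \<open>B\<close> is treated by turning the
  correspondence around.\<close>

lemma sat_sys:
  assumes A: "v6_dense A" and B: "v6_dense B"
    and "sys A B R \<one>\<^bsub>A\<^esub> \<one>\<^bsub>B\<^esub>" "\<forall>n\<in>fv p. (v n, w n) \<in> R"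
  shows "sat A v p \<longleftrightarrow> sat B w p"
proof -
  interpret A: v6_dense A by (rule A)
  interpret B: v6_dense B by (rule B)
  interpret AB: v6_extension A B by unfold_locales
  interpret BA: v6_extension B A by unfold_locales
  show ?thesis
    using assms(3,4)
  proof (induction p arbitrary: R v w)
    case (Eq s t)
    then have "(tval A v s, tval B w s) \<in> R" "(tval A v t, tval B w t) \<in> R"
      by (simp_all add: AB.tval_sys)
    then show ?case
      using AB.partial_isoD(4)[OF conjunct1[OF AB.sys_iso[OF Eq.prems(1)]]] by simp
  next
    case (Neg p)
    then show ?case by simp
  next
    case (Conj p q)
    then show ?case by (metis UnCI fv.simps(3) sat.simps(3))
  next
    case (All n p)
    have IH: "sat A (v(n := x)) p \<longleftrightarrow> sat B (w(n := y)) p"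
      if "sys A B R' \<one>\<^bsub>A\<^esub> \<one>\<^bsub>B\<^esub>" "R \<subseteq> R'" "(x, y) \<in> R'" for R' x y
      using that All.prems(2) by (intro All.IH[OF that(1)]) auto
    have "\<exists>y\<in>carrier B. sat A (v(n := x)) p \<longleftrightarrow> sat B (w(n := y)) p" if x: "x \<in> carrier A" for x
    proof -
      obtain R' y where R': "sys A B R' \<one>\<^bsub>A\<^esub> \<one>\<^bsub>B\<^esub>" "R \<subseteq> R'" "(x, y) \<in> R'"
        using AB.sys_extend[OF All.prems(1) x A.le_one[OF x]] by blast
      then show ?thesis
        using IH[OF R'] AB.boundedD(4)[OF conjunct2[OF AB.sys_iso[OF R'(1)]] R'(3)] by blast
    qed
    moreover have "\<exists>x\<in>carrier A. sat A (v(n := x)) p \<longleftrightarrow> sat B (w(n := y)) p" if y: "y \<in> carrier B" for y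
    proof -
      obtain R' x where R': "sys B A R' \<one>\<^bsub>B\<^esub> \<one>\<^bsub>A\<^esub>" "R\<inverse> \<subseteq> R'" "(y, x) \<in> R'"
        using BA.sys_extend[OF sys_converse[OF All.prems(1)] y B.le_one[OF y]] by blast
      have "R \<subseteq> R'\<inverse>" "(x, y) \<in> R'\<inverse>"
        using R'(2,3) by auto
      then have "sat A (v(n := x)) p \<longleftrightarrow> sat B (w(n := y)) p"
        by (rule IH[OF sys_converse[OF R'(1)]])
      then show ?thesis
        using BA.boundedD(4)[OF conjunct2[OF BA.sys_iso[OF R'(1)]] R'(3)] by blast
    qed
    ultimately show ?case
      by (metis sat.simps(4))
  qed
qed

section \<open>Forests in a common subalgebra\<close>

lemma embeddingD:
  assumes "embedding f A B"
  shows "x \<in> carrier A \<Longrightarrow> f x \<in> carrier B" "f \<zero>\<^bsub>A\<^esub> = \<zero>\<^bsub>B\<^esub>" "f \<one>\<^bsub>A\<^esub> = \<one>\<^bsub>B\<^esub>"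
    "x \<in> carrier A \<Longrightarrow> y \<in> carrier A \<Longrightarrow> f (x \<squnion>\<^bsub>A\<^esub> y) = f x \<squnion>\<^bsub>B\<^esub> f y"
    "x \<in> carrier A \<Longrightarrow> y \<in> carrier A \<Longrightarrow> f (x \<sqinter>\<^bsub>A\<^esub> y) = f x \<sqinter>\<^bsub>B\<^esub> f y"
    "x \<in> carrier A \<Longrightarrow> y \<in> carrier A \<Longrightarrow> f (x \<ominus>\<^bsub>A\<^esub> y) = f x \<ominus>\<^bsub>B\<^esub> f y"
    "x \<in> carrier A \<Longrightarrow> y \<in> carrier A \<Longrightarrow> f x = f y \<longleftrightarrow> x = y"
  using assms unfolding embedding_def by (auto dest: inj_onD)

lemma embedding_below:
  assumes "embedding f A B" "x \<in> carrier A" "y \<in> carrier A" "x \<lless>\<^bsub>A\<^esub> y"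
  shows "f x \<lless>\<^bsub>B\<^esub> f y"
  using assms(2-4) embeddingD(4,6)[OF assms(1)] unfolding below_in_def le_in_def by metis

text \<open>The conditions on the nodes are equations and inequations, which embeddings preserve. So
  the two images of a forest in \<open>A\<close> are isomorphic. The partners in \<open>B\<close>
  are forgotten: their only use is that \<open>sys\<close> describes forests in pairs.\<close>

lemma (in v6_pair) sys_embedding:
  assumes f: "embedding f A N1" "embedding g A N2"
  shows "sys A B R a b \<Longrightarrow> sys N1 N2 ((\<lambda>x. (f x, g x)) ` Domain R) (f a) (g a)"
proof (induction rule: sys.induct)
  case empty
  then show ?case
    using sys.empty[of N1 N2] embeddingD(2)[OF f(1)] embeddingD(2)[OF f(2)] by simp
next
  case (node R c d R' a' b' a b)
  let ?h = "\<lambda>x. (f x, g x)"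
  note w = boundedD[OF conjunct2[OF sys_iso[OF node.hyps(1)]]]
    and w' = boundedD[OF conjunct2[OF sys_iso[OF node.hyps(2)]]]
  note c = w(3)[OF w(1)] and a' = w'(3)[OF w'(1)] and a = node.hyps(3)
  have hom: "f (x \<squnion>\<^bsub>A\<^esub> x') = f x \<squnion>\<^bsub>N1\<^esub> f x'" "g (x \<squnion>\<^bsub>A\<^esub> x') = g x \<squnion>\<^bsub>N2\<^esub> g x'"
    if "x \<in> carrier A" "x' \<in> carrier A" for x x'
    using that embeddingD(4) f by metis+
  have "sys N1 N2 (dsum N1 N2 (insert (f a, g a) (?h ` Domain R)) (?h ` Domain R'))
      (f a \<squnion>\<^bsub>N1\<^esub> f a') (g a \<squnion>\<^bsub>N2\<^esub> g a')"
  proof (rule sys.node[OF node.IH])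
    show "f a \<in> carrier N1" "g a \<in> carrier N2"
      using embeddingD(1) f a by metis+
    show "f a = \<zero>\<^bsub>N1\<^esub> \<longleftrightarrow> g a = \<zero>\<^bsub>N2\<^esub>"
      using embeddingD(2,7) f a A.closed(1) by metis
    show "f c \<lless>\<^bsub>N1\<^esub> f a" "g c \<lless>\<^bsub>N2\<^esub> g a"
      using embedding_below f a c node.hyps(6) by metis+
    show "f a \<sqinter>\<^bsub>N1\<^esub> f a' = \<zero>\<^bsub>N1\<^esub>" "g a \<sqinter>\<^bsub>N2\<^esub> g a' = \<zero>\<^bsub>N2\<^esub>"
      using embeddingD(2,5) f a a' node.hyps(8) by metis+
  qed
  moreover have "?h ` Domain (dsum A B (insert (a, b) R) R') =
      dsum N1 N2 (insert (f a, g a) (?h ` Domain R)) (?h ` Domain R')" (is "?L = ?D")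
  proof
    show "?L \<subseteq> ?D"
    proof
      fix q assume "q \<in> ?L"
      then obtain x y where "q = ?h x" "(x, y) \<in> dsum A B (insert (a, b) R) R'"
        by blast
      then obtain s t s' t' where q: "q = ?h (s \<squnion>\<^bsub>A\<^esub> s')" "(s, t) \<in> insert (a, b) R" "(s', t') \<in> R'"
        by (auto elim!: dsumE)
      then have "q = (f s \<squnion>\<^bsub>N1\<^esub> f s', g s \<squnion>\<^bsub>N2\<^esub> g s')"
        using hom[of s s'] w(3) w'(3) a by auto
      moreover have "?h s \<in> insert (f a, g a) (?h ` Domain R)" "?h s' \<in> ?h ` Domain R'"
        using q(2,3) by auto
      ultimately show "q \<in> ?D"
        using dsumI by metis
    qed
    show "?D \<subseteq> ?L"
    proof
      fix q assume "q \<in> ?D"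
      then obtain s t s' t' where q: "q = (f s \<squnion>\<^bsub>N1\<^esub> f s', g s \<squnion>\<^bsub>N2\<^esub> g s')"
          "(s, t) \<in> insert (a, b) R" "(s', t') \<in> R'"
        by (auto elim!: dsumE; blast)
      then have "q = ?h (s \<squnion>\<^bsub>A\<^esub> s')"
        using hom[of s s'] w(3) w'(3) a by auto
      moreover have "s \<squnion>\<^bsub>A\<^esub> s' \<in> Domain (dsum A B (insert (a, b) R) R')"
        using dsumI[OF q(2,3)] by blast
      ultimately show "q \<in> ?L"
        by blast
    qed
  qed
  ultimately show ?case
    using hom[OF a a'] by simp
qed

lemma v6_dense_if_model:
  assumes "is_model A (V6 \<union> {D6, S6})"
  shows "v6_dense A"
proof
  show "is_model A V6"
    using assms by (auto simp: is_model_def)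
qed (rule assms)

text \<open>The values of the free variables are covered by a forest in \<open>M\<close>, which is
  first found together with some copy of it in \<open>N2\<close>. The copy is then replaced by the
  pair of images under \<open>f\<close> and \<open>g\<close>, which relates the two given
  valuations.\<close>

theorem complete_over_diagram:
  assumes M: "is_model M V6" and N: "is_model N1 (V6 \<union> {D6, S6})" "is_model N2 (V6 \<union> {D6, S6})"
    and f: "embedding f M N1" "embedding g M N2" and v: "range v \<subseteq> carrier M"
  shows "sat N1 (f \<circ> v) p \<longleftrightarrow> sat N2 (g \<circ> v) p"
proof -
  interpret M: v6 M by (unfold_locales) (rule M)
  interpret N2: v6_dense N2 by (rule v6_dense_if_model) (rule N)
  interpret MN: v6_extension M N2 by unfold_locales
  have "\<one>\<^bsub>M\<^esub> = \<zero>\<^bsub>M\<^esub> \<longleftrightarrow> \<one>\<^bsub>N2\<^esub> = \<zero>\<^bsub>N2\<^esub>"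
    using embeddingD(2,3,7)[OF f(2)] by (metis M.closed(1,2))
  then obtain R where R: "sys M N2 R \<one>\<^bsub>M\<^esub> \<one>\<^bsub>N2\<^esub>" "v ` fv p \<subseteq> Domain R"
    using MN.sys_cover[of "v ` fv p"] finite_fv v by blast
  let ?R = "(\<lambda>x. (f x, g x)) ` Domain R"
  have "sys N1 N2 ?R \<one>\<^bsub>N1\<^esub> \<one>\<^bsub>N2\<^esub>"
    using MN.sys_embedding[OF f R(1)] embeddingD(3)[OF f(1)] embeddingD(3)[OF f(2)] by simp
  moreover have "\<forall>n\<in>fv p. ((f \<circ> v) n, (g \<circ> v) n) \<in> ?R"
  proof
    fix n assume "n \<in> fv p"
    then have "v n \<in> Domain R"
      using R(2) by blast
    then show "((f \<circ> v) n, (g \<circ> v) n) \<in> ?R"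
      by (rule rev_image_eqI) simp
  qed
  ultimately show ?thesis
    by (rule sat_sys[OF v6_dense_if_model[OF N(1)] v6_dense_if_model[OF N(2)]])
qed

section \<open>Embedding into a model of the density and splitting axioms\<close>

definition trunc :: "nat \<Rightarrow> (nat \<Rightarrow> 'a chain) \<Rightarrow> nat \<Rightarrow> 'a chain" where
  "trunc n t k = (if k < n then t k else base)"

text \<open>The quotient map of a chain: the values sent to \<open>base\<close> form an initial
  segment, which is why the operations on values from \<open>base\<close> upwards are
  preserved.\<close>

definition cutoff :: "nat \<Rightarrow> (nat \<Rightarrow> 'a chain) \<Rightarrow> 'a chain \<Rightarrow> 'a chain" where
  "cutoff n t x = (if \<forall>k\<ge>n. t k < x then x else base)"

lemma trunc_trunc: "n \<le> m \<Longrightarrow> trunc n (trunc m t) = trunc n t"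
  by (auto simp: trunc_def)

lemma cutoff_base [simp]: "cutoff n t base = base"
  by (simp add: cutoff_def)

lemma cutoff_trunc [simp]: "base \<le> x \<Longrightarrow> cutoff n (trunc n t) x = x"
  by (auto simp: cutoff_def trunc_def)

lemma cutoff_le: "base \<le> x \<Longrightarrow> cutoff n t x \<le> x"
  by (simp add: cutoff_def)

lemma base_le_cutoff: "base \<le> x \<Longrightarrow> base \<le> cutoff n t x"
  by (simp add: cutoff_def)

lemma cutoff_mono:
  assumes "base \<le> x" "x \<le> y"
  shows "cutoff n t x \<le> cutoff n t y"
proof (cases "\<forall>k\<ge>n. t k < x")
  case True
  then have "\<forall>k\<ge>n. t k < y"
    using assms(2) less_le_trans by blast
  then show ?thesis
    using assms True by (simp add: cutoff_def)
next
  case False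
  then have "cutoff n t x = base"
    unfolding cutoff_def by (rule if_not_P)
  then show ?thesis
    using assms base_le_cutoff[of y n t] by simp
qed

lemma cutoff_max:
  assumes "base \<le> x" "base \<le> y"
  shows "cutoff n t (max x y) = max (cutoff n t x) (cutoff n t y)"
  using assms cutoff_mono[of x y n t] cutoff_mono[of y x n t] by (cases "x \<le> y") (simp_all add: max_absorb1 max_absorb2)

lemma cutoff_min:
  assumes "base \<le> x" "base \<le> y"
  shows "cutoff n t (min x y) = min (cutoff n t x) (cutoff n t y)"
  using assms cutoff_mono[of x y n t] cutoff_mono[of y x n t] by (cases "x \<le> y") (simp_all add: min_absorb1 min_absorb2)

lemma cutoff_cdiff:
  assumes "base \<le> x" "base \<le> y"
  shows "cutoff n t (cdiff x y) = cdiff (cutoff n t x) (cutoff n t y)"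
proof (cases "x \<le> y")
  case True
  then show ?thesis
    using assms cutoff_mono[of x y n t] by (simp add: cdiff_def)
next
  case False
  show ?thesis
  proof (cases "\<forall>k\<ge>n. t k < x")
    case True
    then have "cutoff n t x = x"
      by (simp add: cutoff_def)
    moreover have "\<not> x \<le> cutoff n t y"
      using False cutoff_le[of y n t] assms by auto
    ultimately show ?thesis
      using False by (simp add: cdiff_def)
  next
    case 2: False
    then have "cutoff n t x = base"
      unfolding cutoff_def by (rule if_not_P)
    then show ?thesis
      using False assms base_le_cutoff[of y n t] by (simp add: cdiff_def)
  qed
qed

text \<open>Cutting at the coordinates from \<open>n\<close> to \<open>m - 1\<close> and then at
  those from \<open>m\<close> on amounts to cutting at all from \<open>n\<close> on, because a
  coordinate \<open>base\<close> has no effect on values above \<open>base\<close>. This makes the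
  levels increasing.\<close>

lemma cutoff_cut:
  assumes "n \<le> m" "\<And>k. base \<le> t k"
  shows "cutoff m t (cutoff n (trunc m t) y) = cutoff n t y"
proof (cases "\<forall>k\<ge>n. t k < y")
  case True
  then have "\<forall>k\<ge>n. trunc m t k < y"
    using assms(2) le_less_trans unfolding trunc_def by fastforce
  then show ?thesis
    using True assms(1) by (simp add: cutoff_def)
next
  case False
  then obtain k where k: "n \<le> k" "\<not> t k < y"
    by blast
  have "cutoff m t (cutoff n (trunc m t) y) = base"
  proof (cases "k < m")
    case True
    then have "cutoff n (trunc m t) y = base"
      using k unfolding cutoff_def trunc_def by auto
    then show ?thesis by simp
  next
    case False
    then have "cutoff m t y = base"
      using k unfolding cutoff_def by auto
    then show ?thesis
      using cutoff_base by (metis cutoff_def)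
  qed
  moreover have "cutoff n t y = base"
    using False unfolding cutoff_def by (rule if_not_P)
  ultimately show ?thesis
    by simp
qed

text \<open>A fixed choice, so that the intermediate value depends on the two bounds alone. The
  default is the value wanted where both bounds are \<open>base\<close>.\<close>

definition mid :: "'a chain \<Rightarrow> 'a chain \<Rightarrow> 'a chain" where
  "mid x y = (if x < y then SOME z. x < z \<and> z < y else base)"

lemma mid:
  assumes "x < y"
  shows "x < mid x y" "mid x y < y"
  using someI_ex[OF dense[OF assms]] assms by (simp_all add: mid_def)

section \<open>The algebra of functions of cuts\<close>

context v6
begin

text \<open>Cuts stay below the value of \<one>, so that \<one> survives in the quotient. If
  \<open>I\<close> is not a prime ideal, this value is \<open>base\<close> and there are no cuts at
  all.\<close>

definition cuts :: "'a set \<Rightarrow> (nat \<Rightarrow> 'a chain) set" where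
  "cuts I = {t. (\<forall>k. base \<le> t k \<and> t k < val I \<one>) \<and> (\<exists>m. \<forall>k\<ge>m. t k = base)}"

text \<open>Functions that depend on \<open>I\<close> and the first \<open>n\<close> cuts only, before they are cut off at the others.\<close>

definition level :: "nat \<Rightarrow> ('a set \<times> (nat \<Rightarrow> 'a chain) \<Rightarrow> 'a chain) set" where
  "level n = {f. \<forall>I t. base \<le> f (I, t) \<and> (t \<notin> cuts I \<longrightarrow> f (I, t) = base) \<and>
     (t \<in> cuts I \<longrightarrow> f (I, t) \<le> val I \<one> \<and> f (I, t) = cutoff n t (f (I, trunc n t)))}"

text \<open>The functions take values in the whole interval up to \<open>val I \<one>\<close>, not
  only those attained by the given algebra; here the density of the order enters.\<close>

definition ext_struct :: "('a set \<times> (nat \<Rightarrow> 'a chain) \<Rightarrow> 'a chain) struct" where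
  "ext_struct = \<lparr>carrier = (\<Union>n. level n), zero_of = (\<lambda>_. base),
     one_of = (\<lambda>(I, t). if t \<in> cuts I then val I \<one> else base),
     join_of = (\<lambda>f g j. max (f j) (g j)), meet_of = (\<lambda>f g j. min (f j) (g j)),
     diff_of = (\<lambda>f g j. cdiff (f j) (g j))\<rparr>"

lemma ext_simps [simp]:
  "carrier ext_struct = (\<Union>n. level n)" "zero_of ext_struct = (\<lambda>_. base)"
  "one_of ext_struct = (\<lambda>(I, t). if t \<in> cuts I then val I \<one> else base)"
  "join_of ext_struct = (\<lambda>f g j. max (f j) (g j))"
  "meet_of ext_struct = (\<lambda>f g j. min (f j) (g j))"
  "diff_of ext_struct = (\<lambda>f g j. cdiff (f j) (g j))"
  by (simp_all add: ext_struct_def)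

lemma cutsD:
  assumes "t \<in> cuts I"
  shows "base \<le> t k" "t k < val I \<one>"
  using assms by (auto simp: cuts_def)

lemma trunc_cuts:
  assumes "t \<in> cuts I"
  shows "trunc n t \<in> cuts I"
proof -
  have "base < val I \<one>"
    using cutsD[OF assms, of 0] by simp
  then show ?thesis
    using assms by (auto simp: cuts_def trunc_def)
qed

lemma levelI:
  assumes "\<And>I t. base \<le> f (I, t)" "\<And>I t. t \<notin> cuts I \<Longrightarrow> f (I, t) = base"
    "\<And>I t. t \<in> cuts I \<Longrightarrow> f (I, t) \<le> val I \<one>"
    "\<And>I t. t \<in> cuts I \<Longrightarrow> f (I, t) = cutoff n t (f (I, trunc n t))"
  shows "f \<in> level n"
  unfolding level_def using assms by blast

lemma levelD:
  assumes "f \<in> level n"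
  shows "base \<le> f j" "t \<notin> cuts I \<Longrightarrow> f (I, t) = base" "t \<in> cuts I \<Longrightarrow> f (I, t) \<le> val I \<one>"
    "t \<in> cuts I \<Longrightarrow> f (I, t) = cutoff n t (f (I, trunc n t))"
  using assms unfolding level_def by (cases j; blast)+

lemma level_mono:
  assumes "n \<le> m" "f \<in> level n"
  shows "f \<in> level m"
proof (rule levelI)
  fix I t assume t: "t \<in> cuts I"
  have "f (I, trunc m t) = cutoff n (trunc m t) (f (I, trunc n t))"
    using levelD(4)[OF assms(2) trunc_cuts[OF t, of m]] trunc_trunc[OF assms(1), of t] by simp
  then show "f (I, t) = cutoff m t (f (I, trunc m t))"
    using cutoff_cut[OF assms(1) cutsD(1)[OF t]] levelD(4)[OF assms(2) t] by simp
qed (use levelD[OF assms(2)] in auto)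

lemma common_level:
  assumes "f \<in> carrier ext_struct" "g \<in> carrier ext_struct"
  obtains n where "f \<in> level n" "g \<in> level n"
proof -
  obtain n m where "f \<in> level n" "g \<in> level m"
    using assms by auto
  then show thesis
    by (intro that[of "max n m"]) (auto elim: level_mono[rotated])
qed

text \<open>An operation on values that commutes with cutoffs and stays within the bounds preserves
  each level; this treats the three operations alike.\<close>

lemma level_op:
  assumes f: "f \<in> level n" and g: "g \<in> level n" and "h base base = base"
    and ge: "\<And>x y. base \<le> x \<Longrightarrow> base \<le> y \<Longrightarrow> base \<le> h x y"
    and le: "\<And>x y z. base \<le> x \<Longrightarrow> x \<le> z \<Longrightarrow> y \<le> z \<Longrightarrow> h x y \<le> z"
    and cutoff: "\<And>t x y. base \<le> x \<Longrightarrow> base \<le> y \<Longrightarrow> cutoff n t (h x y) = h (cutoff n t x) (cutoff n t y)"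
  shows "(\<lambda>j. h (f j) (g j)) \<in> level n"
proof (rule levelI)
  fix I t
  show "base \<le> h (f (I, t)) (g (I, t))"
    using ge levelD(1)[OF f] levelD(1)[OF g] .
  show "h (f (I, t)) (g (I, t)) = base" if "t \<notin> cuts I"
    using levelD(2)[OF f that] levelD(2)[OF g that] assms(3) by simp
  assume t: "t \<in> cuts I"
  show "h (f (I, t)) (g (I, t)) \<le> val I \<one>"
    using le levelD(1,3)[OF f] levelD(3)[OF g] t by blast
  show "h (f (I, t)) (g (I, t)) = cutoff n t (h (f (I, trunc n t)) (g (I, trunc n t)))"
    using cutoff[OF levelD(1)[OF f] levelD(1)[OF g], of t "(I, trunc n t)" "(I, trunc n t)"]
      levelD(4)[OF f t] levelD(4)[OF g t] by simp
qed

lemma level_closed: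
  assumes f: "f \<in> level n" and g: "g \<in> level n"
  shows "(\<lambda>j. max (f j) (g j)) \<in> level n" "(\<lambda>j. min (f j) (g j)) \<in> level n"
    "(\<lambda>j. cdiff (f j) (g j)) \<in> level n"
proof -
  show "(\<lambda>j. max (f j) (g j)) \<in> level n"
    by (rule level_op[OF f g, where h = max]) (auto simp: cutoff_max le_max_iff_disj)
  show "(\<lambda>j. min (f j) (g j)) \<in> level n"
    by (rule level_op[OF f g, where h = min]) (auto simp: cutoff_min min_le_iff_disj)
  show "(\<lambda>j. cdiff (f j) (g j)) \<in> level n"
    by (rule level_op[OF f g, where h = cdiff], rule_tac [4] cutoff_cdiff) (auto simp: cdiff_def)
qed

lemma zero_level: "(\<lambda>_. base) \<in> level n"
  by (rule levelI) auto

lemma one_level: "(\<lambda>(I, t). if t \<in> cuts I then val I \<one> else base) \<in> level n"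
  using trunc_cuts cutsD(2) by (intro levelI) (auto simp: cutoff_def)

lemma ext_is_struct: "is_struct ext_struct"
  unfolding is_struct_def
proof (intro conjI ballI)
  show "zero_of ext_struct \<in> carrier ext_struct" "one_of ext_struct \<in> carrier ext_struct"
    using zero_level one_level by auto
  fix f g assume "f \<in> carrier ext_struct" "g \<in> carrier ext_struct"
  then obtain n where "f \<in> level n" "g \<in> level n"
    by (rule common_level)
  then show "join_of ext_struct f g \<in> carrier ext_struct" "meet_of ext_struct f g \<in> carrier ext_struct"
    "diff_of ext_struct f g \<in> carrier ext_struct"
    using level_closed[of f n g] by auto
qed

lemma ext_bounds:
  assumes "f \<in> carrier ext_struct"
  shows "base \<le> f j" "f j \<le> one_of ext_struct j"
proof -
  obtain n where f: "f \<in> level n"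
    using assms by auto
  show "base \<le> f j" "f j \<le> one_of ext_struct j"
    using levelD(1)[OF f] levelD(2,3)[OF f] by (auto split: prod.splits)
qed

lemma ext_le: "le_in ext_struct f g \<longleftrightarrow> (\<forall>j. f j \<le> g j)"
proof -
  have "max x y = y \<longleftrightarrow> x \<le> y" for x y :: "'a chain"
    by (auto simp: max_def)
  then show ?thesis
    by (simp add: le_in_def fun_eq_iff)
qed

lemma ext_below:
  assumes "f \<in> carrier ext_struct" "g \<in> carrier ext_struct"
  shows "below_in ext_struct f g \<longleftrightarrow> (\<forall>j. f j < g j \<or> g j = base \<and> f j = base)"
proof -
  have "cdiff (g j) (f j) = g j \<and> f j \<le> g j \<longleftrightarrow> f j < g j \<or> g j = base \<and> f j = base" for j
    using ext_bounds(1)[OF assms(1)] unfolding cdiff_def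
    by (cases "f j" "g j" rule: linorder_cases) auto
  then show ?thesis
    by (simp add: below_in_def ext_le fun_eq_iff flip: all_conj_distrib)
qed

lemma ext_V6: "is_model ext_struct V6"
  unfolding is_model_V6_iff
proof (intro conjI ballI ext_is_struct)
  fix f g h
  assume C: "f \<in> carrier ext_struct" "g \<in> carrier ext_struct" "h \<in> carrier ext_struct"
  note b = ext_bounds(1)[OF C(1)] ext_bounds(1)[OF C(2)] ext_bounds(1)[OF C(3)]
  show "le_in ext_struct (zero_of ext_struct) f" "le_in ext_struct f (one_of ext_struct)"
    using ext_bounds[OF C(1)] by (auto simp: ext_le)
  show "le_in ext_struct f (join_of ext_struct g (diff_of ext_struct f g))"
    by (auto simp: ext_le cdiff_def le_max_iff_disj)
  show "le_in ext_struct f (join_of ext_struct g h) \<longrightarrow> le_in ext_struct (diff_of ext_struct f g) h"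
    using b by (auto simp: ext_le cdiff_def le_max_iff_disj)
  have "min (cdiff (f j) (g j)) (cdiff (g j) (f j)) = base" for j
    using b(1,2)[of j] by (auto simp: cdiff_def min_def)
  then show "meet_of ext_struct (diff_of ext_struct f g) (diff_of ext_struct g f) = zero_of ext_struct"
    by simp
qed (auto simp: fun_eq_iff max.assoc min.assoc max.commute min.commute max_min_distrib2 min_max_distrib2 max_def min_def)

section \<open>The axioms D6 and S6 in the algebra of functions\<close>

lemma ext_D6: "sat ext_struct v D6"
  unfolding sat_D6_iff
proof (intro ballI impI)
  fix a c assume C: "a \<in> carrier ext_struct" "c \<in> carrier ext_struct"
    and *: "below_in ext_struct c a \<and> a \<noteq> zero_of ext_struct"
  then have below: "c j < a j \<or> a j = base \<and> c j = base" for j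
    using ext_below[OF C(2,1)] by blast
  obtain I0 t0 where 0: "a (I0, t0) \<noteq> base"
    using * by (auto simp: fun_eq_iff)
  obtain n where a: "a \<in> level n" and c: "c \<in> level n"
    using common_level C by blast
  note bc = levelD(1)[OF c] and ba = levelD(1)[OF a]
  \<comment> \<open>The intermediate value is chosen before the cutoff. Chosen between the values at
    \<open>t\<close> itself, it would in general not be the cutoff of the value at
    \<open>trunc n t\<close>, and \<open>b\<close> could leave the level.\<close>
  define b where "b = (\<lambda>(I, t). if t \<in> cuts I then
    cutoff n t (mid (c (I, trunc n t)) (a (I, trunc n t))) else base)"
  have mid_le: "c j \<le> mid (c j) (a j)" "mid (c j) (a j) \<le> a j" "base \<le> mid (c j) (a j)" for j
  proof -
    show "c j \<le> mid (c j) (a j)" "mid (c j) (a j) \<le> a j"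
      using mid[of "c j" "a j"] below[of j] by (auto simp: mid_def)
    then show "base \<le> mid (c j) (a j)"
      using bc[of j] by simp
  qed
  have b_eq: "b (I, t) = cutoff n t (mid (c (I, trunc n t)) (a (I, trunc n t)))" if "t \<in> cuts I" for I t
    using that by (simp add: b_def)
  have b: "b \<in> level n"
  proof (rule levelI)
    fix I t
    show "base \<le> b (I, t)" "t \<notin> cuts I \<Longrightarrow> b (I, t) = base"
      using mid_le(3) by (auto simp: b_def base_le_cutoff)
    assume t: "t \<in> cuts I"
    have "mid (c (I, trunc n t)) (a (I, trunc n t)) \<le> val I \<one>"
      using mid_le(2) levelD(3)[OF a trunc_cuts[OF t]] by (rule order.trans)
    then show "b (I, t) \<le> val I \<one>"
      using b_eq[OF t] cutoff_le[OF mid_le(3)] by (metis order.trans)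
    show "b (I, t) = cutoff n t (b (I, trunc n t))"
      using b_eq[OF t] b_eq[OF trunc_cuts[OF t, of n]] mid_le(3) by (simp add: trunc_trunc)
  qed
  have bb: "(c j < b j \<or> b j = base \<and> c j = base) \<and> (b j < a j \<or> a j = base \<and> b j = base)" for j
  proof (cases j)
    case (Pair I t)
    show ?thesis
    proof (cases "t \<in> cuts I")
      case False
      then show ?thesis
        using Pair levelD(2)[OF a] levelD(2)[OF b] levelD(2)[OF c] by simp
    next
      case True
      let ?j = "(I, trunc n t)"
      have eq: "b j = cutoff n t (mid (c ?j) (a ?j))" "c j = cutoff n t (c ?j)" "a j = cutoff n t (a ?j)"
        using Pair b_eq[OF True] levelD(4)[OF c True] levelD(4)[OF a True] by simp_all
      show ?thesis
      proof (cases "c ?j < a ?j")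
        case False
        then show ?thesis
          using below[of ?j] eq by (simp add: mid_def)
      next
        case less: True
        note m = mid[OF less]
        have le: "c j \<le> c ?j" "b j \<le> mid (c ?j) (a ?j)"
          using eq cutoff_le[OF bc, of n t ?j] cutoff_le[OF mid_le(3), of n t ?j] by simp_all
        \<comment> \<open>Of two values a cutoff kills the smaller one first: if the larger one is
          killed, so is the smaller, and otherwise the larger one keeps its full value, so that
          strictness remains.\<close>
        have "c j < b j \<or> b j = base \<and> c j = base"
        proof (cases "b j = base")
          case True
          then show ?thesis
            using eq(1,2) cutoff_mono[OF bc mid_le(1), of n t ?j] bc[of j] by simp
        next
          case False
          then have "b j = mid (c ?j) (a ?j)"
            using eq(1) by (metis cutoff_def)
          then show ?thesis
            using le_less_trans[OF le(1) m(1)] by simp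
        qed
        moreover have "b j < a j \<or> a j = base \<and> b j = base"
        proof (cases "a j = base")
          case True
          then show ?thesis
            using eq(1,3) cutoff_mono[OF mid_le(3,2), of n t ?j] levelD(1)[OF b, of j] by simp
        next
          case False
          then have "a j = a ?j"
            using eq(3) by (metis cutoff_def)
          then show ?thesis
            using le_less_trans[OF le(2) m(2)] by simp
        qed
        ultimately show ?thesis ..
      qed
    qed
  qed
  have "b \<noteq> zero_of ext_struct"
  proof -
    have t0: "t0 \<in> cuts I0"
      using 0 levelD(2)[OF a] by blast
    \<comment> \<open>At a truncated sequence nothing of level \<open>n\<close> is cut off, so the
      chosen intermediate value survives.\<close>
    let ?j = "(I0, trunc n t0)"
    have "a ?j \<noteq> base"
      using 0 levelD(4)[OF a t0] by auto
    then have "c ?j < a ?j"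
      using below[of ?j] by simp
    then have "base < mid (c ?j) (a ?j)"
      using le_less_trans[OF bc mid(1)] by blast
    moreover have "b ?j = mid (c ?j) (a ?j)"
      using b_eq[OF trunc_cuts[OF t0, of n]] mid_le(3) by (simp add: trunc_trunc)
    ultimately have "b ?j \<noteq> base"
      by simp
    then show ?thesis
      by auto
  qed
  moreover have "b \<in> carrier ext_struct"
    using b by auto
  ultimately show "\<exists>b\<in>carrier ext_struct. b \<noteq> zero_of ext_struct \<and> below_in ext_struct c b \<and> below_in ext_struct b a"
    using bb C by (intro bexI[of _ b]) (simp_all only: ext_below simp_thms)
qed

text \<open>The witnesses are the restrictions of \<open>a\<close> to a set of indices and to its
  complement. An index where \<open>b1\<close> is nonzero has to be selected, one where
  \<open>b2\<close> is nonzero must not be; where both vanish the new coordinate \<open>t n\<close>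
  decides.\<close>

lemma ext_S6: "sat ext_struct v S6"
  unfolding sat_S6_iff
proof (intro ballI impI)
  fix a b1 b2 assume C: "a \<in> carrier ext_struct" "b1 \<in> carrier ext_struct" "b2 \<in> carrier ext_struct"
    and *: "below_in ext_struct (join_of ext_struct b1 b2) a \<and> a \<noteq> zero_of ext_struct \<and>
      meet_of ext_struct b1 b2 = zero_of ext_struct"
  have "join_of ext_struct b1 b2 \<in> carrier ext_struct"
    using ext_is_struct C unfolding is_struct_def by blast
  from ext_below[OF this C(1)] have below: "max (b1 j) (b2 j) < a j \<or> a j = base \<and> max (b1 j) (b2 j) = base" for j
    using * by (simp del: split_paired_All)
  have disj: "b1 j = base \<or> b2 j = base" for j
  proof -
    have "min (b1 j) (b2 j) = base"
      using * by (simp add: fun_eq_iff del: split_paired_All)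
    then show ?thesis
      by (simp add: min_def split: if_splits)
  qed
  obtain I0 t0 where 0: "a (I0, t0) \<noteq> base"
    using * by (auto simp: fun_eq_iff)
  obtain k l m where "a \<in> level k" "b1 \<in> level l" "b2 \<in> level m"
    using C by auto
  then obtain n where a: "a \<in> level n" and b1: "b1 \<in> level n" and b2: "b2 \<in> level n"
    using that[of "max k (max l m)"] level_mono[of k "max k (max l m)"]
      level_mono[of l "max k (max l m)"] level_mono[of m "max k (max l m)"] by simp
  note base_le = levelD(1)[OF a] levelD(1)[OF b1] levelD(1)[OF b2]
  have t0: "t0 \<in> cuts I0"
    using 0 levelD(2)[OF a] by blast
  let ?s = "trunc n t0"
  let ?\<beta> = "max (b1 (I0, ?s)) (b2 (I0, ?s))"
  have "a (I0, ?s) \<noteq> base"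
    using 0 levelD(4)[OF a t0] by auto
  then have "?\<beta> < a (I0, ?s)"
    using below[of "(I0, ?s)"] by blast
  \<comment> \<open>Two cuts above the values of \<open>b1\<close> and \<open>b2\<close> and below
    that of \<open>a\<close>. With either of them as coordinate \<open>n\<close>, both
    \<open>b1\<close> and \<open>b2\<close> vanish while \<open>a\<close> survives; \<tau>1 leads to
    a selected index and \<tau>2 to one that is not selected.\<close>
  then obtain \<tau>1 where \<tau>1: "?\<beta> < \<tau>1" "\<tau>1 < a (I0, ?s)"
    using dense by blast
  then obtain \<tau>2 where \<tau>2: "\<tau>1 < \<tau>2" "\<tau>2 < a (I0, ?s)"
    using dense by blast
  define sel where "sel j \<longleftrightarrow> b1 j \<noteq> base \<or> b2 j = base \<and> snd j n \<le> \<tau>1" for j :: "'a set \<times> (nat \<Rightarrow> 'a chain)"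
  \<comment> \<open>The selection looks at the first \<open>n + 1\<close> coordinates only, which
    keeps the two parts in level \<open>Suc n\<close>.\<close>
  define a1 where "a1 = (\<lambda>(I, t). if sel (I, trunc (Suc n) t) then a (I, t) else base)"
  define a2 where "a2 = (\<lambda>(I, t). if sel (I, trunc (Suc n) t) then base else a (I, t))"
  have a': "a \<in> level (Suc n)" and b1': "b1 \<in> level (Suc n)" and b2': "b2 \<in> level (Suc n)"
    using level_mono[of n "Suc n"] a b1 b2 by auto
  have a1: "a1 \<in> level (Suc n)"
    using levelD[OF a'] by (intro levelI) (auto simp: a1_def trunc_trunc intro: order.trans)
  have a2: "a2 \<in> level (Suc n)"
    using levelD[OF a'] by (intro levelI) (auto simp: a2_def trunc_trunc intro: order.trans)
  have val: "base \<le> \<tau>1" "base \<le> \<tau>2" "\<tau>1 < val I0 \<one>" "\<tau>2 < val I0 \<one>"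
    using \<tau>1 \<tau>2 base_le(2)[of "(I0, ?s)"] levelD(3)[OF a trunc_cuts[OF t0, of n]]
    by (auto simp: max_less_iff_conj)
  define pt where "pt \<tau> = (\<lambda>k. if k = n then \<tau> else trunc n t0 k)" for \<tau>
  have pt: "pt \<tau> \<in> cuts I0 \<and> trunc n (pt \<tau>) = ?s \<and> trunc (Suc n) (pt \<tau>) = pt \<tau> \<and>
      a (I0, pt \<tau>) = a (I0, ?s) \<and> b1 (I0, pt \<tau>) = base \<and> b2 (I0, pt \<tau>) = base"
    if \<tau>: "?\<beta> < \<tau>" "\<tau> < a (I0, ?s)" "base \<le> \<tau>" "\<tau> < val I0 \<one>" for \<tau>
  proof -
    have "\<forall>k\<ge>Suc n. pt \<tau> k = base"
      by (simp add: pt_def trunc_def)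
    moreover have "base \<le> pt \<tau> k \<and> pt \<tau> k < val I0 \<one>" for k
      using \<tau>(3,4) cutsD[OF trunc_cuts[OF t0, of n]] by (simp add: pt_def)
    ultimately have cuts: "pt \<tau> \<in> cuts I0"
      unfolding cuts_def by blast
    moreover have s: "trunc n (pt \<tau>) = ?s" "trunc (Suc n) (pt \<tau>) = pt \<tau>"
      by (auto simp: pt_def trunc_def fun_eq_iff)
    moreover have "pt \<tau> k < a (I0, ?s)" if "n \<le> k" for k
      using that \<tau> base_le(2)[of "(I0, ?s)"] by (auto simp: pt_def trunc_def)
    then have "a (I0, pt \<tau>) = a (I0, ?s)"
      using levelD(4)[OF a cuts] s by (simp add: cutoff_def)
    moreover have "\<not> pt \<tau> n < b1 (I0, ?s)" "\<not> pt \<tau> n < b2 (I0, ?s)"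
      using \<tau>(1) by (auto simp: pt_def)
    then have "b1 (I0, pt \<tau>) = base" "b2 (I0, pt \<tau>) = base"
      using levelD(4)[OF b1 cuts] levelD(4)[OF b2 cuts] s unfolding cutoff_def by auto
    ultimately show ?thesis by blast
  qed
  have "a1 (I0, pt \<tau>1) \<noteq> base"
    using pt[OF \<tau>1 val(1,3)] \<open>a (I0, ?s) \<noteq> base\<close> by (simp add: a1_def sel_def) (simp add: pt_def)
  moreover have "a2 (I0, pt \<tau>2) \<noteq> base"
    using pt[OF less_trans[OF \<tau>1(1) \<tau>2(1)] \<tau>2(2) val(2,4)] \<tau>2(1) \<open>a (I0, ?s) \<noteq> base\<close>
    by (simp add: a2_def sel_def) (simp add: pt_def)
  ultimately have nonzero: "a1 \<noteq> zero_of ext_struct" "a2 \<noteq> zero_of ext_struct"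
    by auto
  \<comment> \<open>Fewer cuts kill fewer values. This links the selection, which is made at the
    truncated sequence, to the values at the index itself.\<close>
  have b_trunc: "b1 (I, t) \<noteq> base \<Longrightarrow> b1 (I, trunc (Suc n) t) \<noteq> base"
    "b2 (I, t) \<noteq> base \<Longrightarrow> b2 (I, trunc (Suc n) t) \<noteq> base" for I t
    using levelD(2,4)[OF b1'] levelD(2,4)[OF b2'] by (metis cutoff_base)+
  have le: "b1 j \<le> a j" "b2 j \<le> a j" for j
    using below[of j] base_le(2,3)[of j] by (auto simp: max_def split: if_splits)
  have "cdiff (a j) (a2 j) = a1 j \<and> b1 j \<le> a1 j \<and> cdiff (a j) (a1 j) = a2 j \<and> b2 j \<le> a2 j \<and>
      min (a1 j) (a2 j) = base" for j
  proof (cases j)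
    case (Pair I t)
    show ?thesis
    proof (cases "sel (I, trunc (Suc n) t)")
      case True
      then have "b2 (I, trunc (Suc n) t) = base"
        using disj[of "(I, trunc (Suc n) t)"] by (auto simp: sel_def)
      then have "b2 j = base"
        using b_trunc(2) Pair by blast
      then show ?thesis
        using True Pair le(1)[of j] base_le(1)[of j] by (auto simp: a1_def a2_def cdiff_def min_def)
    next
      case False
      then have "b1 (I, trunc (Suc n) t) = base"
        by (auto simp: sel_def)
      then have "b1 j = base"
        using b_trunc(1) Pair by blast
      then show ?thesis
        using False Pair le(2)[of j] base_le(1)[of j] by (auto simp: a1_def a2_def cdiff_def min_def)
    qed
  qed
  then have "diff_of ext_struct a a2 = a1 \<and> le_in ext_struct b1 a1 \<and>
      diff_of ext_struct a a1 = a2 \<and> le_in ext_struct b2 a2 \<and>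
      meet_of ext_struct a1 a2 = meet_of ext_struct b1 b2"
    using * by (simp add: ext_le fun_eq_iff)
  moreover have "a1 \<in> carrier ext_struct" "a2 \<in> carrier ext_struct"
    using a1 a2 by auto
  ultimately show "\<exists>a1\<in>carrier ext_struct. \<exists>a2\<in>carrier ext_struct.
      a1 \<noteq> zero_of ext_struct \<and> a2 \<noteq> zero_of ext_struct \<and>
      diff_of ext_struct a a2 = a1 \<and> le_in ext_struct b1 a1 \<and>
      diff_of ext_struct a a1 = a2 \<and> le_in ext_struct b2 a2 \<and>
      meet_of ext_struct a1 a2 = meet_of ext_struct b1 b2"
    using nonzero by blast
qed

lemma ext_model: "is_model ext_struct (V6 \<union> {D6, S6})"
  using ext_V6 ext_D6 ext_S6 unfolding is_model_def by blast

definition ext_map :: "'a \<Rightarrow> 'a set \<times> (nat \<Rightarrow> 'a chain) \<Rightarrow> 'a chain" where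
  "ext_map x = (\<lambda>(I, t). if t \<in> cuts I then cutoff 0 t (val I x) else base)"

text \<open>Cutoffs are homomorphisms, so \<open>ext_map\<close> is one. It is injective because at
  the sequence that is constantly \<open>base\<close> nothing is cut off, and the valuations can be
  read off there.\<close>

lemma ext_map_embedding: "embedding ext_map A ext_struct"
proof -
  have "ext_map x \<in> level 0" if x: "x \<in> C" for x
  proof (rule levelI)
    fix I t
    show "base \<le> ext_map x (I, t)" "t \<notin> cuts I \<Longrightarrow> ext_map x (I, t) = base"
      by (auto simp: ext_map_def base_le_cutoff)
    assume t: "t \<in> cuts I"
    have "val I x \<le> val I \<one>"
      using le_one[OF x] x by (simp add: le_iff)
    then show "ext_map x (I, t) \<le> val I \<one>"
      using t cutoff_le[OF val_base(1), of 0 t I x] by (simp add: ext_map_def)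
    show "ext_map x (I, t) = cutoff 0 t (ext_map x (I, trunc 0 t))"
      using t trunc_cuts[OF t, of 0] by (simp add: ext_map_def)
  qed
  moreover have "inj_on ext_map C"
  proof (rule inj_onI, rule val_eqI)
    fix x y I
    assume xy: "x \<in> C" "y \<in> C" "ext_map x = ext_map y"
    show "val I x = val I y"
    proof (cases "prime_ideal I")
      case False
      then show ?thesis by (simp add: val_def)
    next
      case True
      \<comment> \<open>This is the constant sequence itself, written as a truncation so that
        \<open>cutoff_trunc\<close> applies.\<close>
      then have "trunc 0 (\<lambda>_. base) \<in> cuts I"
        using val_one_gt'[OF True] by (auto simp: cuts_def trunc_def)
      then have "ext_map z (I, trunc 0 (\<lambda>_. base)) = val I z" for z
        by (simp add: ext_map_def)
      then show ?thesis
        using xy(3) by metis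
    qed
  qed
  moreover have "ext_map \<one> = one_of ext_struct"
    by (auto simp: fun_eq_iff ext_map_def cutoff_def dest: cutsD(2))
  moreover have "ext_map \<zero> = zero_of ext_struct"
    by (simp add: fun_eq_iff ext_map_def)
  moreover have "ext_map (x \<squnion> y) = join_of ext_struct (ext_map x) (ext_map y) \<and>
      ext_map (x \<sqinter> y) = meet_of ext_struct (ext_map x) (ext_map y) \<and>
      ext_map (x \<ominus> y) = diff_of ext_struct (ext_map x) (ext_map y)" if "x \<in> C" "y \<in> C" for x y
    using that by (simp add: fun_eq_iff ext_map_def cutoff_max cutoff_min cutoff_cdiff) (simp add: cdiff_def)
  ultimately show ?thesis
    unfolding embedding_def by (intro conjI ballI) auto
qed

end

section \<open>Bounding the cardinality\<close>

lemma tval_embedding: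
  assumes "embedding g A B" "is_struct A" "range v \<subseteq> carrier A"
  shows "tval A v t \<in> carrier A \<and> g (tval A v t) = tval B (g \<circ> v) t"
proof (induction t)
  case (Var n)
  then show ?case
    using assms(3) by auto
qed (use assms(2) embeddingD[OF assms(1)] in \<open>simp_all add: is_struct_def\<close>)

lemma sat_iso:
  assumes g: "embedding g A B" "g ` carrier A = carrier B" and A: "is_struct A"
  shows "range v \<subseteq> carrier A \<Longrightarrow> sat B (g \<circ> v) p \<longleftrightarrow> sat A v p"
proof (induction p arbitrary: v)
  case (Eq s t)
  then show ?case
    using tval_embedding[OF g(1) A Eq] embeddingD(7)[OF g(1)] by (metis sat.simps(1))
next
  case (All n p)
  have "sat B ((g \<circ> v)(n := g x)) p \<longleftrightarrow> sat A (v(n := x)) p" if "x \<in> carrier A" for x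
  proof -
    have "range (v(n := x)) \<subseteq> carrier A" "(g \<circ> v)(n := g x) = g \<circ> v(n := x)"
      using that All.prems by auto
    then show ?thesis
      using All.IH by metis
  qed
  then show ?case
    unfolding sat.simps g(2)[symmetric] by simp
qed simp_all

lemma is_model_iso:
  assumes g: "embedding g A B" "g ` carrier A = carrier B" and B: "is_struct B" and A: "is_model A T"
  shows "is_model B T"
  unfolding is_model_def
proof (intro conjI ballI allI impI B)
  fix p and w :: "nat \<Rightarrow> _" assume p: "p \<in> T" and w: "range w \<subseteq> carrier B"
  let ?v = "inv_into (carrier A) g \<circ> w"
  have w: "w n \<in> g ` carrier A" for n
    using w g(2) by blast
  have "range ?v \<subseteq> carrier A" "g \<circ> ?v = w"
    using inv_into_into[OF w] f_inv_into_f[OF w] by auto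
  then show "sat B w p"
    using sat_iso[OF g, of ?v p] A p unfolding is_model_def by metis
qed

section \<open>Skolem hulls\<close>

text \<open>
  The operations and the witnesses for D6 (\<open>a = x\<close>, \<open>c = y\<close>) and S6 (\<open>a = x\<close>, \<open>b\<^sub>1 = y\<close>, \<open>b\<^sub>2 = z\<close>) in a single
  function. In S6 the witness \<open>a\<^sub>2\<close> is a difference of \<open>a\<close> and \<open>a\<^sub>1\<close>, and if no witness exists the
  value is arbitrary.
\<close>

definition skolem :: "'d struct \<Rightarrow> nat \<Rightarrow> 'd \<Rightarrow> 'd \<Rightarrow> 'd \<Rightarrow> 'd" where
  "skolem N i x y z =
    (if i = 0 then zero_of N else if i = 1 then one_of N
     else if i = 2 then join_of N x y else if i = 3 then meet_of N x y else if i = 4 then diff_of N x y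
     else if i = 5 then (SOME b. b \<in> carrier N \<and> b \<noteq> zero_of N \<and> below_in N y b \<and> below_in N b x)
     else if i = 6 then (SOME a1. a1 \<in> carrier N \<and> (\<exists>a2\<in>carrier N. a1 \<noteq> zero_of N \<and> a2 \<noteq> zero_of N \<and>
           diff_of N x a2 = a1 \<and> le_in N y a1 \<and> diff_of N x a1 = a2 \<and> le_in N z a2 \<and>
           meet_of N a1 a2 = meet_of N y z))
     else y)"

text \<open>A chosen value may lie outside the carrier when there is no witness; zero takes its
  place, so that the hull stays inside the carrier.\<close>

primrec skolem_hull :: "'d struct \<Rightarrow> 'd set \<Rightarrow> nat \<Rightarrow> 'd set" where
  "skolem_hull N X 0 = X"
| "skolem_hull N X (Suc n) = skolem_hull N X n \<union> (\<lambda>(i, x, y, z). if skolem N i x y z \<in> carrier N then skolem N i x y z else zero_of N) `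
     (UNIV \<times> skolem_hull N X n \<times> skolem_hull N X n \<times> skolem_hull N X n)"

lemma skolem_hull_mono: "n \<le> m \<Longrightarrow> skolem_hull N X n \<subseteq> skolem_hull N X m"
  by (induction m) (auto simp: le_Suc_eq)

lemma skolem_hull_skolem:
  assumes "x \<in> (\<Union>n. skolem_hull N X n)" "y \<in> (\<Union>n. skolem_hull N X n)" "z \<in> (\<Union>n. skolem_hull N X n)"
    "skolem N i x y z \<in> carrier N"
  shows "skolem N i x y z \<in> (\<Union>n. skolem_hull N X n)"
proof -
  obtain k l m where "x \<in> skolem_hull N X k" "y \<in> skolem_hull N X l" "z \<in> skolem_hull N X m"
    using assms by blast
  then have "x \<in> skolem_hull N X (k + l + m)" "y \<in> skolem_hull N X (k + l + m)" "z \<in> skolem_hull N X (k + l + m)"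
    using skolem_hull_mono[of _ "k + l + m" N X] by (meson le_add1 le_add2 order.trans subsetD trans_le_add1)+
  then have "skolem N i x y z \<in> skolem_hull N X (Suc (k + l + m))"
    using assms(4) by (auto intro!: image_eqI[of _ _ "(i, x, y, z)"])
  then show ?thesis
    by blast
qed

text \<open>Each stage adds an image of the product of the natural numbers with three copies of the
  previous stage, which an infinite cardinal absorbs, as it does the countable union.\<close>

lemma skolem_hull_card:
  fixes K :: "'k set"
  assumes K: "infinite K" and X: "(card_of X, card_of K) \<in> ordLeq"
  shows "(card_of (\<Union>n. skolem_hull N X n), card_of K) \<in> ordLeq"
proof -
  have nat: "(card_of (UNIV :: nat set), card_of K) \<in> ordLeq"
    using K infinite_iff_card_of_nat by blast
  have "(card_of (skolem_hull N X n), card_of K) \<in> ordLeq" for n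
  proof (induction n)
    case 0
    then show ?case
      using X by simp
  next
    case (Suc n)
    have *: "\<not> finite (Field (card_of K))" "Card_order (card_of K)"
      using K card_of_Card_order by (simp_all add: Field_card_of)
    have "(card_of ((UNIV :: nat set) \<times> skolem_hull N X n \<times> skolem_hull N X n \<times> skolem_hull N X n), card_of K) \<in> ordLeq"
      by (intro card_of_Times_ordLeq_infinite_Field * nat Suc)
    then have "(card_of ((\<lambda>(i, x, y, z). if skolem N i x y z \<in> carrier N then skolem N i x y z else zero_of N) `
        ((UNIV :: nat set) \<times> skolem_hull N X n \<times> skolem_hull N X n \<times> skolem_hull N X n)), card_of K) \<in> ordLeq"
      using card_of_image ordLeq_transitive by blast
    then show ?case
      using card_of_Un_ordLeq_infinite_Field[OF *(1) Suc _ *(2)] by simp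
  qed
  then show ?thesis
    using card_of_UNION_ordLeq_infinite[OF K nat] by blast
qed

lemma skolem_hull_carrier:
  assumes "is_struct N" "X \<subseteq> carrier N"
  shows "(\<Union>n. skolem_hull N X n) \<subseteq> carrier N"
proof -
  have "skolem_hull N X n \<subseteq> carrier N" for n
    using assms by (induction n) (auto simp: is_struct_def)
  then show ?thesis by blast
qed

text \<open>The laws of the variety are universal and pass to subsets closed under the operations.
  The relations in D6 and S6 are given by equations, so they mean the same in the hull, which
  contains the chosen witnesses.\<close>

lemma skolem_hull_model:
  assumes N: "is_model N (V6 \<union> {D6, S6})" and X: "X \<subseteq> carrier N" "X \<noteq> {}"
  defines "H \<equiv> N\<lparr>carrier := \<Union>n. skolem_hull N X n\<rparr>"
  shows "is_model H (V6 \<union> {D6, S6})"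
proof -
  interpret N: v6_dense N
    using N by (rule v6_dense_if_model)
  have struct: "is_struct N"
    using N by (simp add: is_model_def)
  have sub: "carrier H \<subseteq> carrier N"
    unfolding H_def using skolem_hull_carrier[OF struct X(1)] by simp
  have simps [simp]: "zero_of H = zero_of N" "one_of H = one_of N" "join_of H = join_of N"
    "meet_of H = meet_of N" "diff_of H = diff_of N" "le_in H = le_in N" "below_in H = below_in N"
    by (simp_all add: H_def le_in_def below_in_def fun_eq_iff)
  have skolem: "skolem N i x y z \<in> carrier H"
    if "x \<in> carrier H" "y \<in> carrier H" "z \<in> carrier H" "skolem N i x y z \<in> carrier N" for i x y z
    using that skolem_hull_skolem[of x N X y z i] by (simp add: H_def)
  \<comment> \<open>A dummy for the argument places that an operation or a witness does not depend
    on.\<close>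
  obtain e where "e \<in> X"
    using X by blast
  then have e: "e \<in> carrier H"
    using skolem_hull.simps(1)[of N X] unfolding H_def by (auto intro!: exI[of _ 0])
  have "zero_of N \<in> carrier H" "one_of N \<in> carrier H"
    using skolem[OF e e e, of 0] skolem[OF e e e, of 1] by (simp_all add: skolem_def)
  moreover have "join_of N x y \<in> carrier H" "meet_of N x y \<in> carrier H" "diff_of N x y \<in> carrier H"
    if "x \<in> carrier H" "y \<in> carrier H" for x y
    using skolem[OF that e, of 2] skolem[OF that e, of 3] skolem[OF that e, of 4] sub that
    by (auto simp: skolem_def)
  ultimately have H: "is_struct H"
    by (simp add: is_struct_def)
  have "is_model H V6"
    using N.model H sub unfolding is_model_V6_iff simps by (meson subsetD)
  moreover have "sat H v D6" for v
    unfolding sat_D6_iff simps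
  proof (intro ballI impI)
    fix a c assume ac: "a \<in> carrier H" "c \<in> carrier H" and *: "below_in N c a \<and> a \<noteq> zero_of N"
    let ?P = "\<lambda>b. b \<in> carrier N \<and> b \<noteq> zero_of N \<and> below_in N c b \<and> below_in N b a"
    have "\<exists>b. ?P b"
      using N.density ac * sub by (metis subsetD)
    then have "?P (SOME b. ?P b)"
      by (rule someI_ex)
    moreover have "skolem N 5 a c e = (SOME b. ?P b)"
      by (simp add: skolem_def)
    ultimately have "?P (skolem N 5 a c e)"
      by simp
    then show "\<exists>b\<in>carrier H. b \<noteq> zero_of N \<and> below_in N c b \<and> below_in N b a"
      using skolem[OF ac e, of 5] by blast
  qed
  moreover have "sat H v S6" for v
    unfolding sat_S6_iff simps
  proof (intro ballI impI)
    fix a b1 b2 assume ab: "a \<in> carrier H" "b1 \<in> carrier H" "b2 \<in> carrier H"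
      and *: "below_in N (join_of N b1 b2) a \<and> a \<noteq> zero_of N \<and> meet_of N b1 b2 = zero_of N"
    let ?P = "\<lambda>a1. a1 \<in> carrier N \<and> (\<exists>a2\<in>carrier N. a1 \<noteq> zero_of N \<and> a2 \<noteq> zero_of N \<and>
      diff_of N a a2 = a1 \<and> le_in N b1 a1 \<and> diff_of N a a1 = a2 \<and> le_in N b2 a2 \<and>
      meet_of N a1 a2 = meet_of N b1 b2)"
    have "\<exists>a1. ?P a1"
      using N.sat_axioms(2)[unfolded sat_S6_iff, rule_format, of a b1 b2] * ab sub by blast
    then have "?P (SOME a1. ?P a1)"
      by (rule someI_ex)
    moreover have "skolem N 6 a b1 b2 = (SOME a1. ?P a1)"
      by (simp add: skolem_def)
    ultimately have P: "?P (skolem N 6 a b1 b2)"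
      by simp
    define a1 where "a1 = skolem N 6 a b1 b2"
    have a1: "a1 \<in> carrier H"
      using skolem[OF ab, of 6] P by (simp add: a1_def)
    obtain a2 where a2: "a1 \<noteq> zero_of N \<and> a2 \<noteq> zero_of N \<and> diff_of N a a2 = a1 \<and> le_in N b1 a1 \<and>
        diff_of N a a1 = a2 \<and> le_in N b2 a2 \<and> meet_of N a1 a2 = meet_of N b1 b2"
      using P[folded a1_def] by (elim conjE bexE) (rule that, intro conjI)
    have "diff_of N a a1 \<in> carrier H"
      using H ab(1) a1 by (simp add: is_struct_def)
    then have "a2 \<in> carrier H"
      using a2 by simp
    with a1 a2 show "\<exists>a1\<in>carrier H. \<exists>a2\<in>carrier H. a1 \<noteq> zero_of N \<and> a2 \<noteq> zero_of N \<and>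
        diff_of N a a2 = a1 \<and> le_in N b1 a1 \<and> diff_of N a a1 = a2 \<and> le_in N b2 a2 \<and>
        meet_of N a1 a2 = meet_of N b1 b2"
      by (intro bexI[of _ a1] bexI[of _ a2])
  qed
  ultimately show ?thesis
    unfolding is_model_def by blast
qed

text \<open>The inverse of \<open>f\<close> injects the image of \<open>M\<close> into
  \<open>'a + nat\<close>. This type is infinite, so the Skolem hull of the image is no larger than
  it, and the hull can be copied along an injection.\<close>

lemma small_dense_extension:
  fixes M :: "'a struct" and N :: "'d struct"
  assumes M: "is_struct M" and N: "is_model N (V6 \<union> {D6, S6})" and f: "embedding f M N"
  shows "\<exists>(N' :: ('a + nat) struct) f'. is_model N' (V6 \<union> {D6, S6}) \<and> embedding f' M N'"
proof -
  define X where "X = f ` carrier M"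
  define H where "H = N\<lparr>carrier := \<Union>n. skolem_hull N X n\<rparr>"
  have X: "X \<subseteq> carrier N" "X \<noteq> {}"
    using f M unfolding X_def embedding_def is_struct_def by auto
  have H: "is_model H (V6 \<union> {D6, S6})"
    unfolding H_def using skolem_hull_model[OF N X] .
  have inf: "infinite (UNIV :: ('a + nat) set)"
    by (simp add: finite_Plus_UNIV_iff)
  have "inj_on (\<lambda>x. Inl (inv_into (carrier M) f x) :: 'a + nat) X"
    unfolding X_def by (auto simp: inj_on_def dest: inv_into_injective)
  then have "(card_of X, card_of (UNIV :: ('a + nat) set)) \<in> ordLeq"
    using card_of_ordLeq by blast
  then have "(card_of (carrier H), card_of (UNIV :: ('a + nat) set)) \<in> ordLeq"
    using skolem_hull_card[OF inf] by (simp add: H_def)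
  then obtain g :: "'d \<Rightarrow> 'a + nat" where g: "inj_on g (carrier H)"
    unfolding card_of_ordLeq[symmetric] by blast
  let ?h = "inv_into (carrier H) g"
  define N' where "N' = \<lparr>carrier = g ` carrier H, zero_of = g (zero_of H), one_of = g (one_of H),
    join_of = (\<lambda>x y. g (join_of H (?h x) (?h y))), meet_of = (\<lambda>x y. g (meet_of H (?h x) (?h y))),
    diff_of = (\<lambda>x y. g (diff_of H (?h x) (?h y)))\<rparr>"
  have HS: "is_struct H"
    using H by (simp add: is_model_def)
  have g_emb: "embedding g H N'"
    using g unfolding embedding_def N'_def by auto
  have "is_struct N'"
    using HS g unfolding is_struct_def N'_def by auto
  then have "is_model N' (V6 \<union> {D6, S6})"
    using is_model_iso[OF g_emb _ _ H] by (simp add: N'_def)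
  moreover have "embedding (g \<circ> f) M N'"
  proof -
    have "f x \<in> carrier H" if "x \<in> carrier M" for x
      using that skolem_hull.simps(1)[of N X] by (auto simp: H_def X_def intro!: exI[of _ 0])
    then have "embedding f M H"
      using f unfolding embedding_def H_def by auto
    then show ?thesis
      using g_emb unfolding embedding_def by (auto simp: inj_on_def image_subset_iff)
  qed
  ultimately show ?thesis
    by blast
qed

theorem theorem9p2:
  "model_completion TYPE('a) TYPE('b) TYPE('c) V6 (V6 \<union> {D6, S6})"
  unfolding model_completion_def
proof (intro conjI allI impI)
  fix N :: "'a struct" assume "is_model N (V6 \<union> {D6, S6})"
  then show "is_model N V6"
    by (auto simp: is_model_def)
next
  fix M :: "'a struct" assume M: "is_model M V6"
  interpret v6 M by unfold_locales (rule M)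
  show "\<exists>(N :: ('a + nat) struct) f. is_model N (V6 \<union> {D6, S6}) \<and> embedding f M N"
    using small_dense_extension[OF _ ext_model ext_map_embedding] M by (simp add: is_model_def)
next
  fix M :: "'a struct" and N1 :: "'b struct" and N2 :: "'c struct" and f g p and v :: "nat \<Rightarrow> 'a"
  assume "is_model M V6 \<and> is_model N1 (V6 \<union> {D6, S6}) \<and> is_model N2 (V6 \<union> {D6, S6}) \<and>
    embedding f M N1 \<and> embedding g M N2" and "range v \<subseteq> carrier M"
  then show "sat N1 (f \<circ> v) p = sat N2 (g \<circ> v) p"
    using complete_over_diagram[of M N1 N2 f g v p] by simp
qed

end
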